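(* Let $p$ be a prime, let $K$ be a finite extension of $\mathbb{Q}_p$, and let $\phi\in K(z)$ be a sub-hyperbolic rational map of degree at least $2$. Then there exist a countable state Markov shift $(\Sigma_A,\sigma)$ and a bijection $h: J_K(\phi)\to\Sigma_A$ such that $(I_K(\phi),\phi)$ is topologically conjugate to $(h(I_K(\phi)),\sigma)$ via $h$.
   Context: $\mathbb{C}_p$ is the completion of an algebraic closure of $\mathbb{Q}_p$ (containing $K$), with $p$-adic absolute value $|\cdot|_p$. For $L\in\{K,\mathbb{C}_p\}$, $\mathbb{P}^1_L=L\cup\{\infty\}$ carries the spherical metric $\rho(x,y)=\frac{|x-y|_p}{\max\{|x|_p,1\}\max\{|y|_p,1\}}$ for $x,y\in L$, $\rho(x,\infty)=1$ if $|x|_p\le 1$ and $\rho(x,\infty)=1/|x|_p$ if $|x|_p>1$. The Fatou set $F_L(\phi)$ is the set of points of $\mathbb{P}^1_L$ having a neighborhood in $\mathbb{P}^1_L$ on which $\{\phi^n\}_{n\ge 0}$ is equicontinuous with respect to $\rho$; the Julia set is $J_L(\phi)=\mathbb{P}^1_L\setminus F_L(\phi)$. The map $\phi$ is sub-hyperbolic if every critical point of $\phi$ (in $\mathbb{P}^1_{\mathbb{C}_p}$) lying in $J_{\mathbb{C}_p}(\phi)$ is eventually periodic, i.e. satisfies $\phi^{m+n}(x)=\phi^m(x)$ for some $m\ge 0$, $n\ge 1$. $\mathrm{Crit}_K^\ast(\phi)$ is the set of critical points of $\phi$ in $J_{\mathbb{C}_p}(\phi)\cap\mathbb{P}^1_K$,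 and $\mathrm{GO}_K(\mathrm{Crit}_K^\ast(\phi))$ is the union of the grand orbits in $\mathbb{P}^1_K$ of its elements, where the grand orbit of $x$ is $\{y\in\mathbb{P}^1_K:\phi^m(y)=\phi^n(x)\text{ for some }m,n\ge0\}$. Set $I_K(\phi)=J_K(\phi)\setminus\mathrm{GO}_K(\mathrm{Crit}_K^\ast(\phi))$. A countable state Markov shift: given a countable (possibly finite) discrete set $\mathcal{A}$ of symbols and a zero-one matrix $A=(A_{ab})_{a,b\in\mathcal{A}}$, $\Sigma_A=\{(a_i)_{i\ge0}\in\mathcal{A}^{\mathbb{N}}:A_{a_ia_{i+1}}=1\ \forall i\}$ with the subspace topology of the product topology, and $\sigma$ is the left shift. "Topologically conjugate via $h$" means that $h$ restricts to a homeomorphism $I_K(\phi)\to h(I_K(\phi))$ (subspace topologies) with $h\circ\phi=\sigma\circ h$ on $I_K(\phi)$. *)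

theory Defs
  imports "HOL-Analysis.Analysis" "HOL-Computational_Algebra.Computational_Algebra"
begin

section \<open>The fields\<close>

text \<open>
  The field of complex $p$-adic numbers is the whole type \<open>'c\<close>, equipped with a real-valued
  absolute value; all other fields are subsets of \<open>'c\<close>.
\<close>

definition subfield_set :: "'c::field set \<Rightarrow> bool" where
  "subfield_set F \<longleftrightarrow> 0 \<in> F \<and> 1 \<in> F \<and>
     (\<forall>x\<in>F. \<forall>y\<in>F. x + y \<in> F \<and> x * y \<in> F) \<and>
     (\<forall>x\<in>F. - x \<in> F \<and> inverse x \<in> F)"

definition poly_over :: "'c::field set \<Rightarrow> 'c poly \<Rightarrow> bool" where
  "poly_over F f \<longleftrightarrow> (\<forall>i. coeff f i \<in> F)"

definition algebraic_closure_of :: "'c::field set \<Rightarrow> 'c set \<Rightarrow> bool" where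
  "algebraic_closure_of F E \<longleftrightarrow> subfield_set F \<and> subfield_set E \<and> F \<subseteq> E \<and>
     (\<forall>x\<in>E. \<exists>f. poly_over F f \<and> f \<noteq> 0 \<and> poly f x = 0) \<and>
     (\<forall>f. poly_over E f \<and> degree f > 0 \<longrightarrow> (\<exists>x\<in>E. poly f x = 0))"

definition finite_extension_of :: "'c::field set \<Rightarrow> 'c set \<Rightarrow> bool" where
  "finite_extension_of F E \<longleftrightarrow> subfield_set F \<and> subfield_set E \<and> F \<subseteq> E \<and>
     (\<exists>B. finite B \<and> B \<subseteq> E \<and>
        (\<forall>x\<in>E. \<exists>c. (\<forall>b\<in>B. c b \<in> F) \<and> x = (\<Sum>b\<in>B. c b * b)))"

definition padic_abs_rat :: "nat \<Rightarrow> rat \<Rightarrow> real" where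
  "padic_abs_rat p r = (if r = 0 then 0 else
     (case quotient_of r of (a, b) \<Rightarrow>
        real p powi (int (multiplicity (int p) b) - int (multiplicity (int p) a))))"

locale nonarch_absolute_value =
  fixes nm :: "'c::field \<Rightarrow> real"
  assumes nm_nonneg: "nm x \<ge> 0"
    and nm_eq_0_iff: "nm x = 0 \<longleftrightarrow> x = 0"
    and nm_mult: "nm (x * y) = nm x * nm y"
    and nm_ultrametric: "nm (x + y) \<le> max (nm x) (nm y)"
begin

lemma nm_0 [simp]: "nm 0 = 0"
  by (simp add: nm_eq_0_iff)

lemma nm_1 [simp]: "nm 1 = 1"
  using nm_mult[of 1 1] nm_eq_0_iff[of 1] by simp

lemma nm_minus [simp]: "nm (- x) = nm x"
proof -
  have "nm (-1) * nm (-1) = 1"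
    using nm_mult[of "-1" "-1"] by simp
  hence "nm (-1) = 1"
    using nm_nonneg[of "-1"] by (metis abs_of_nonneg abs_square_eq_1 power2_eq_square)
  thus ?thesis
    using nm_mult[of "-1" x] by simp
qed

lemma nm_minus_commute: "nm (x - y) = nm (y - x)"
  by (metis minus_diff_eq nm_minus)

lemma nm_triangle: "nm (x + y) \<le> nm x + nm y"
  using nm_ultrametric[of x y] nm_nonneg[of x] nm_nonneg[of y] by linarith

lemma Metric_space_nm: "Metric_space UNIV (\<lambda>x y. nm (x - y))"
proof
  show "0 \<le> nm (x - y)" for x y by (rule nm_nonneg)
  show "nm (x - y) = nm (y - x)" for x y by (rule nm_minus_commute)
  show "nm (x - y) = 0 \<longleftrightarrow> x = y" for x y by (simp add: nm_eq_0_iff)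
  show "nm (x - z) \<le> nm (x - y) + nm (y - z)" for x y z
    using nm_triangle[of "x - y" "y - z"] by simp
qed

end

text \<open>
  A completion of a valued field is a complete valued field containing it as a dense subfield.
  Below, \<open>Qp\<close> is a completion of the rationals with the $p$-adic absolute value, \<open>Qpbar\<close> is an
  algebraic closure of \<open>Qp\<close>, and the whole type is a completion of \<open>Qpbar\<close>; this determines
  the data up to isometric isomorphism.
\<close>

locale padic_complex_numbers = nonarch_absolute_value nm
  for nm :: "'c::field_char_0 \<Rightarrow> real" +
  fixes p :: nat and Qp Qpbar :: "'c set"
  assumes nm_of_rat: "nm (of_rat r) = padic_abs_rat p r"
    and Qp_subfield: "subfield_set Qp"
    and Qp_complete: "Metric_space.mcomplete Qp (\<lambda>x y. nm (x - y))"
    and Rats_dense_Qp: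
      "Metric_space.mtopology Qp (\<lambda>x y. nm (x - y)) closure_of \<rat> = Qp"
    and Qpbar_algebraic_closure: "algebraic_closure_of Qp Qpbar"
    and Cp_complete: "Metric_space.mcomplete UNIV (\<lambda>x y. nm (x - y))"
    and Qpbar_dense_Cp:
      "Metric_space.mtopology UNIV (\<lambda>x y. nm (x - y)) closure_of Qpbar = UNIV"


section \<open>The projective line and the spherical metric\<close>

datatype 'c proj_pt = Fin 'c | Infty

definition proj_line :: "'c set \<Rightarrow> 'c proj_pt set" where
  "proj_line L = insert Infty (Fin ` L)"

fun sph_dist :: "('c::field \<Rightarrow> real) \<Rightarrow> 'c proj_pt \<Rightarrow> 'c proj_pt \<Rightarrow> real" where
  "sph_dist nm (Fin x) (Fin y) = nm (x - y) / (max (nm x) 1 * max (nm y) 1)"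
| "sph_dist nm (Fin x) Infty = (if nm x \<le> 1 then 1 else 1 / nm x)"
| "sph_dist nm Infty (Fin x) = (if nm x \<le> 1 then 1 else 1 / nm x)"
| "sph_dist nm Infty Infty = 0"

definition proj_top :: "('c::field \<Rightarrow> real) \<Rightarrow> 'c set \<Rightarrow> 'c proj_pt topology" where
  "proj_top nm L = Metric_space.mtopology (proj_line L) (sph_dist nm)"

lemma (in nonarch_absolute_value) Metric_space_sph_dist: "Metric_space M (sph_dist nm)"
proof -
  let ?m = "\<lambda>x. max (nm x) 1"
  have m_pos: "?m x > 0" and m_ge: "?m x \<ge> 1" and nm_le_m: "nm x \<le> ?m x" for x
    by auto
  have inf: "sph_dist nm (Fin x) Infty = 1 / ?m x" "sph_dist nm Infty (Fin x) = 1 / ?m x" for x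
    by (auto simp: max_def)
  have key: "nm (x - z) * ?m y \<le> nm (x - y) * ?m z + nm (y - z) * ?m x" for x y z
  proof (cases "nm y \<le> 1")
    case True
    have "nm (x - z) \<le> nm (x - y) + nm (y - z)"
      using nm_triangle[of "x - y" "y - z"] by simp
    also have "\<dots> \<le> nm (x - y) * ?m z + nm (y - z) * ?m x"
      using mult_left_mono[OF m_ge nm_nonneg, of "x - y" z]
        mult_left_mono[OF m_ge nm_nonneg, of "y - z" x] by linarith
    finally show ?thesis using True by simp
  next
    case False
    have "(x - z) * y = z * (x - y) + x * (y - z)"
      by (simp add: algebra_simps)
    hence "nm (x - z) * nm y \<le> nm z * nm (x - y) + nm x * nm (y - z)"
      by (metis nm_mult nm_triangle)
    also have "\<dots> \<le> ?m z * nm (x - y) + ?m x * nm (y - z)"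
      by (intro add_mono mult_right_mono nm_le_m nm_nonneg)
    finally show ?thesis using False by (simp add: mult.commute)
  qed
  have m_le: "?m x \<le> ?m y + nm (x - y)" for x y
    using nm_triangle[of y "x - y"] nm_nonneg[of "x - y"] by auto
  have dist_le: "nm (x - z) \<le> ?m x + ?m z" for x z
    using nm_triangle[of x "- z"] nm_le_m[of x] nm_le_m[of z] by (simp del: max.bounded_iff)
  show ?thesis
  proof
    show "0 \<le> sph_dist nm x y" for x y
      by (cases x; cases y) (auto simp: nm_nonneg)
    show "sph_dist nm x y = sph_dist nm y x" for x y
      by (cases x; cases y) (auto simp: nm_minus_commute mult.commute)
    show "sph_dist nm x y = 0 \<longleftrightarrow> x = y" for x y
    proof -
      have "?m a \<noteq> 0" for a using m_pos[of a] by linarith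
      thus ?thesis
        by (cases x; cases y) (auto simp: nm_eq_0_iff inf simp del: sph_dist.simps(2,3))
    qed
    show "sph_dist nm x z \<le> sph_dist nm x y + sph_dist nm y z" for x y z
    proof (cases x; cases y; cases z)
      fix a b c assume [simp]: "x = Fin a" "y = Fin b" "z = Fin c"
      have "nm (a - c) / (?m a * ?m c) = nm (a - c) * ?m b / (?m a * ?m b * ?m c)"
        using m_pos[of b] by (simp del: max_less_iff_conj)
      also have "\<dots> \<le> (nm (a - b) * ?m c + nm (b - c) * ?m a) / (?m a * ?m b * ?m c)"
        by (intro divide_right_mono key) (use m_pos in \<open>simp add: less_imp_le\<close>)
      also have "\<dots> = nm (a - b) / (?m a * ?m b) + nm (b - c) / (?m b * ?m c)"
        using m_pos[of a] m_pos[of b] m_pos[of c]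
        by (simp add: field_simps del: max_less_iff_conj)
      finally show ?thesis by simp
    next
      fix a b assume [simp]: "x = Fin a" "y = Fin b" "z = Infty"
      have "1 / ?m a \<le> nm (a - b) / (?m a * ?m b) + 1 / ?m b"
        using m_le[of b a] m_pos[of a] m_pos[of b]
        by (simp add: field_simps nm_minus_commute[of b] del: max_less_iff_conj max.bounded_iff)
      thus ?thesis by (simp only: \<open>x = _\<close> \<open>y = _\<close> \<open>z = _\<close> inf sph_dist.simps(1))
    next
      fix b c assume [simp]: "x = Infty" "y = Fin b" "z = Fin c"
      have "1 / ?m c \<le> 1 / ?m b + nm (b - c) / (?m b * ?m c)"
        using m_le[of b c] m_pos[of b] m_pos[of c]
        by (simp add: field_simps del: max_less_iff_conj max.bounded_iff)
      thus ?thesis by (simp only: \<open>x = _\<close> \<open>y = _\<close> \<open>z = _\<close> inf sph_dist.simps(1))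
    next
      fix a c assume [simp]: "x = Fin a" "y = Infty" "z = Fin c"
      have "nm (a - c) / (?m a * ?m c) \<le> 1 / ?m a + 1 / ?m c"
        using dist_le[of a c] m_pos[of a] m_pos[of c]
        by (simp add: field_simps del: max_less_iff_conj max.bounded_iff)
      thus ?thesis by (simp only: \<open>x = _\<close> \<open>y = _\<close> \<open>z = _\<close> inf sph_dist.simps(1))
    qed (auto simp: nm_nonneg)
  qed
qed


section \<open>Rational maps\<close>

text \<open>
  A rational map is given in lowest terms by its numerator and its denominator.
\<close>

type_synonym 'c ratfun = "'c poly \<times> 'c poly"

definition ratfun_over :: "'c::field set \<Rightarrow> 'c ratfun \<Rightarrow> bool" where
  "ratfun_over K \<phi> \<longleftrightarrow> poly_over K (fst \<phi>) \<and> poly_over K (snd \<phi>) \<and> snd \<phi> \<noteq> 0 \<and>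
     coprime (fst \<phi>) (snd \<phi>)"

definition rat_degree :: "'c::field ratfun \<Rightarrow> nat" where
  "rat_degree \<phi> = max (degree (fst \<phi>)) (degree (snd \<phi>))"

text \<open>
  The coordinate $w = 1/z$ at infinity: with $d = \deg\phi$, the polynomials
  $w^d f(1/w)$ and $w^d g(1/w)$ are numerator and denominator of $\phi(1/w)$.
\<close>

definition chart_infty :: "'c::field ratfun \<Rightarrow> 'c ratfun" where
  "chart_infty \<phi> =
     (monom 1 (rat_degree \<phi> - degree (fst \<phi>)) * reflect_poly (fst \<phi>),
      monom 1 (rat_degree \<phi> - degree (snd \<phi>)) * reflect_poly (snd \<phi>))"

definition rat_eval_fin :: "'c::field ratfun \<Rightarrow> 'c \<Rightarrow> 'c proj_pt" where
  "rat_eval_fin \<phi> z = (if poly (snd \<phi>) z = 0 then Infty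
     else Fin (poly (fst \<phi>) z / poly (snd \<phi>) z))"

fun rat_map :: "'c::field ratfun \<Rightarrow> 'c proj_pt \<Rightarrow> 'c proj_pt" where
  "rat_map \<phi> (Fin z) = rat_eval_fin \<phi> z"
| "rat_map \<phi> Infty = rat_eval_fin (chart_infty \<phi>) 0"

definition rat_deriv :: "'c::field ratfun \<Rightarrow> 'c \<Rightarrow> 'c" where
  "rat_deriv \<phi> z =
     (poly (pderiv (fst \<phi>)) z * poly (snd \<phi>) z - poly (fst \<phi>) z * poly (pderiv (snd \<phi>)) z)
       / (poly (snd \<phi>) z)\<^sup>2"

text \<open>
  A point is critical if the derivative vanishes there in local coordinates; at a pole the
  coordinate in the target is changed, i.e. $1/\phi$ is differentiated.
\<close>

definition critical_fin :: "'c::field ratfun \<Rightarrow> 'c \<Rightarrow> bool" where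
  "critical_fin \<phi> z \<longleftrightarrow>
     (if poly (snd \<phi>) z \<noteq> 0 then rat_deriv \<phi> z = 0
      else rat_deriv (snd \<phi>, fst \<phi>) z = 0)"

fun critical_point :: "'c::field ratfun \<Rightarrow> 'c proj_pt \<Rightarrow> bool" where
  "critical_point \<phi> (Fin z) = critical_fin \<phi> z"
| "critical_point \<phi> Infty = critical_fin (chart_infty \<phi>) 0"


section \<open>Fatou and Julia sets, sub-hyperbolicity\<close>

definition equicontinuous_family ::
  "('a \<Rightarrow> 'a \<Rightarrow> real) \<Rightarrow> 'a set \<Rightarrow> (nat \<Rightarrow> 'a \<Rightarrow> 'a) \<Rightarrow> bool" where
  "equicontinuous_family d U F \<longleftrightarrow>
     (\<forall>x\<in>U. \<forall>\<epsilon>>0. \<exists>\<delta>>0. \<forall>y\<in>U. d x y < \<delta> \<longrightarrow> (\<forall>n. d (F n x) (F n y) < \<epsilon>))"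

definition fatou_set :: "('c::field \<Rightarrow> real) \<Rightarrow> 'c ratfun \<Rightarrow> 'c set \<Rightarrow> 'c proj_pt set" where
  "fatou_set nm \<phi> L = {x \<in> proj_line L.
     \<exists>U. openin (proj_top nm L) U \<and> x \<in> U \<and>
       equicontinuous_family (sph_dist nm) U (\<lambda>n. rat_map \<phi> ^^ n)}"

definition julia_set :: "('c::field \<Rightarrow> real) \<Rightarrow> 'c ratfun \<Rightarrow> 'c set \<Rightarrow> 'c proj_pt set" where
  "julia_set nm \<phi> L = proj_line L - fatou_set nm \<phi> L"

definition eventually_periodic :: "('a \<Rightarrow> 'a) \<Rightarrow> 'a \<Rightarrow> bool" where
  "eventually_periodic T x \<longleftrightarrow> (\<exists>m n. n \<ge> 1 \<and> (T ^^ (m + n)) x = (T ^^ m) x)"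

definition sub_hyperbolic :: "('c::field \<Rightarrow> real) \<Rightarrow> 'c ratfun \<Rightarrow> bool" where
  "sub_hyperbolic nm \<phi> \<longleftrightarrow>
     (\<forall>x. critical_point \<phi> x \<and> x \<in> julia_set nm \<phi> UNIV \<longrightarrow> eventually_periodic (rat_map \<phi>) x)"

definition Crit_star :: "('c::field \<Rightarrow> real) \<Rightarrow> 'c ratfun \<Rightarrow> 'c set \<Rightarrow> 'c proj_pt set" where
  "Crit_star nm \<phi> K = {x \<in> julia_set nm \<phi> UNIV \<inter> proj_line K. critical_point \<phi> x}"

definition grand_orbit :: "'c::field ratfun \<Rightarrow> 'c set \<Rightarrow> 'c proj_pt \<Rightarrow> 'c proj_pt set" where
  "grand_orbit \<phi> K x =
     {y \<in> proj_line K. \<exists>m n. (rat_map \<phi> ^^ m) y = (rat_map \<phi> ^^ n) x}"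

definition I_set :: "('c::field \<Rightarrow> real) \<Rightarrow> 'c ratfun \<Rightarrow> 'c set \<Rightarrow> 'c proj_pt set" where
  "I_set nm \<phi> K = julia_set nm \<phi> K - (\<Union>x\<in>Crit_star nm \<phi> K. grand_orbit \<phi> K x)"


section \<open>Countable state Markov shifts\<close>

definition zero_one_matrix :: "'s set \<Rightarrow> ('s \<Rightarrow> 's \<Rightarrow> nat) \<Rightarrow> bool" where
  "zero_one_matrix S A \<longleftrightarrow> (\<forall>a\<in>S. \<forall>b\<in>S. A a b \<in> {0, 1})"

definition markov_space :: "'s set \<Rightarrow> ('s \<Rightarrow> 's \<Rightarrow> nat) \<Rightarrow> (nat \<Rightarrow> 's) set" where
  "markov_space S A = {a. \<forall>i. a i \<in> S \<and> A (a i) (a (Suc i)) = 1}"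

definition markov_top :: "'s set \<Rightarrow> ('s \<Rightarrow> 's \<Rightarrow> nat) \<Rightarrow> (nat \<Rightarrow> 's) topology" where
  "markov_top S A =
     subtopology (product_topology (\<lambda>_. discrete_topology S) UNIV) (markov_space S A)"

definition left_shift :: "(nat \<Rightarrow> 's) \<Rightarrow> nat \<Rightarrow> 's" where
  "left_shift a = (\<lambda>i. a (Suc i))"

definition conjugate_via ::
  "'a topology \<Rightarrow> 'a set \<Rightarrow> ('a \<Rightarrow> 'a) \<Rightarrow> 'b topology \<Rightarrow> ('b \<Rightarrow> 'b) \<Rightarrow> ('a \<Rightarrow> 'b) \<Rightarrow> bool" where
  "conjugate_via X I T Y S h \<longleftrightarrow>
     homeomorphic_map (subtopology X I) (subtopology Y (h ` I)) h \<and>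
     (\<forall>x\<in>I. h (T x) = S (h x))"

end

theory Submission
  imports Defs
begin

text \<open>
  The argument takes place in $\mathbb{P}^1_K$, which is a compact ultrametric space; the Julia set
  over $\mathbb{C}_p$ enters only because it contains $J_K$. Away from critical points, \<open>\<phi>\<close> is
  locally a similarity between balls. A ball about a point of $J_K$ cannot have all its iterates
  small, since \<open>\<phi>\<^sup>n\<close> would then be similarities of bounded ratio on it; this forces expansion
  along every orbit, and compactness makes it uniform away from the finite set \<open>Z\<close> of forward
  orbits of critical points in $J_K$. Near \<open>Z\<close> distances are measured relative to the distance
  to \<open>Z\<close>, with weights that absorb the factor \<open>\<bar>m\<bar>\<close> lost at a critical point of local
  degree \<open>m\<close>; this is possible because critical points in $J_K$ are not periodic. Pulling small
  balls back along orbits yields a countable Markov partition of \<open>J\<^sub>K - Z\<close>, and itineraries code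
  the points whose orbits avoid \<open>Z\<close>. The remaining points form a countable set outside $I_K$,
  on which \<open>h\<close> need not respect the dynamics: each of them gets its own isolated fixed sequence.
\<close>

section \<open>Similarities of ultrametric balls\<close>

text \<open>A point \<open>x\<close> carries two numbers: a radius \<open>g x\<close> within which
  \<open>T\<close> is a similarity, and the ratio \<open>lamn n x\<close> of the n-th iterate. If an
  orbit in \<open>J\<close> avoids \<open>Z\<close>, then
  \<open>lamn n x * g x \<le> g ((T ^^ n) x)\<close> cannot hold for all \<open>n\<close>, since
  \<open>x\<close> would be a Fatou point; so \<open>g ((T ^^ k) x) \<le> lamn k x * g x\<close> for
  some \<open>k \<ge> 1\<close>. The obstacle is to bound \<open>k\<close>, because
  \<open>J - Z\<close> need not be compact: at a critical point every similarity radius shrinks to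
  \<open>0\<close>. Hence \<open>g\<close> is a multiple of the distance to \<open>Z\<close> near
  \<open>Z\<close>, and the multiples are chosen to make \<open>k = 1\<close> work there. Once
  \<open>k \<le> N\<close> throughout, an orbit loses at most the fixed factor \<open>c ^ N\<close>
  of scale in any number of steps, and this bound is what makes the supremum of the pulled-back
  radii finite. Since \<open>g\<close> tends to \<open>0\<close> at \<open>Z\<close>, pieces may
  accumulate there, whence a countable rather than finite alphabet.

  Wild ramification is covered: a local degree \<open>m\<close> divisible by \<open>p\<close> is
  still nonzero in characteristic \<open>0\<close>, so the factor \<open>\<bar>m\<bar>\<close> is
  small but positive.\<close>

locale ultrametric_space = Metric_space M d for M :: "'a set" and d +
  assumes ultrametric: "x \<in> M \<Longrightarrow> y \<in> M \<Longrightarrow> z \<in> M \<Longrightarrow> d x z \<le> max (d x y) (d y z)"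
begin

lemma mball_eq: "y \<in> mball x r \<Longrightarrow> mball y r = mball x r"
proof -
  assume "y \<in> mball x r"
  hence y: "x \<in> M" "y \<in> M" "d x y < r" by auto
  have "d y z < r \<longleftrightarrow> d x z < r" if "z \<in> M" for z
    using ultrametric[of x y z] ultrametric[of y x z] that y commute[of x y] by auto
  thus ?thesis using y by auto
qed

lemma dist_eq: "x \<in> M \<Longrightarrow> y \<in> M \<Longrightarrow> z \<in> M \<Longrightarrow> d x y < d z x \<Longrightarrow> d z y = d z x"
  using ultrametric[of z x y] ultrametric[of z y x] commute[of x y] by linarith

text \<open>Balls of equal radius are equal or disjoint, so the complement of a ball is a union of
  balls of radius \<open>r\<close>. Closedness makes the cylinder sets of the coding closed and the
  balls of the field compact.\<close>

lemma closedin_mball: "closedin mtopology (mball x r)"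
proof -
  have "\<exists>s>0. mball y s \<subseteq> M - mball x r" if y: "y \<in> M - mball x r" for y
  proof (cases "r > 0")
    case True
    have "z \<notin> mball x r" if "z \<in> mball y r" for z
      using mball_eq[OF that] mball_eq[of z x r] y True by auto
    thus ?thesis using True by (intro exI[of _ r]) auto
  next
    case False
    hence "mball x r = {}" using mball_eq_empty by auto
    thus ?thesis by (intro exI[of _ 1]) auto
  qed
  thus ?thesis
    by (auto simp: closedin_def openin_mtopology)
qed

text \<open>The image clause is required besides the distance clause: it makes images of balls open,
  and it supplies the preimages from which points with a prescribed itinerary are built.\<close>

definition scales :: "('a \<Rightarrow> 'a) \<Rightarrow> 'a \<Rightarrow> real \<Rightarrow> real \<Rightarrow> bool" where
  "scales f x r l \<longleftrightarrow> x \<in> M \<and> f x \<in> M \<and> r > 0 \<and> l > 0 \<and>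
     (\<forall>y\<in>mball x r. \<forall>z\<in>mball x r. d (f y) (f z) = l * d y z) \<and>
     f ` mball x r = mball (f x) (l * r)"

lemma scales_dist: "scales f x r l \<Longrightarrow> y \<in> mball x r \<Longrightarrow> z \<in> mball x r \<Longrightarrow> d (f y) (f z) = l * d y z"
  by (auto simp: scales_def)

lemma scales_image: "scales f x r l \<Longrightarrow> f ` mball x r = mball (f x) (l * r)"
  by (auto simp: scales_def)

lemma scales_pos: "scales f x r l \<Longrightarrow> r > 0" "scales f x r l \<Longrightarrow> l > 0"
  by (auto simp: scales_def)

lemma scales_sub:
  assumes "scales f x r l" "y \<in> mball x r" "0 < s" "s \<le> r"
  shows "scales f y s l"
proof -
  have x: "x \<in> M" "f x \<in> M" "l > 0" "r > 0" and y: "y \<in> M" "d x y < r"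
    using assms by (auto simp: scales_def)
  have sub: "mball y s \<subseteq> mball x r"
    using mball_eq[OF assms(2)] mball_subset_concentric[OF assms(4), of y] by auto
  have fy: "f y \<in> mball (f x) (l * r)" using assms(1,2) by (auto simp: scales_def)
  have b: "mball (f y) (l * r) = mball (f x) (l * r)" by (rule mball_eq[OF fy])
  have "f ` mball y s = mball (f y) (l * s)"
  proof
    show "f ` mball y s \<subseteq> mball (f y) (l * s)"
    proof
      fix w assume "w \<in> f ` mball y s"
      then obtain z where z: "z \<in> mball y s" "w = f z" by auto
      have "f z \<in> M" using assms(1) sub z by (fastforce simp: scales_def)
      moreover have "d (f y) (f z) = l * d y z" using scales_dist[OF assms(1,2)] sub z by auto
      ultimately show "w \<in> mball (f y) (l * s)" using fy z x by auto
    qed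
    show "mball (f y) (l * s) \<subseteq> f ` mball y s"
    proof
      fix w assume w: "w \<in> mball (f y) (l * s)"
      have "l * s \<le> l * r" using x assms(4) by simp
      hence "w \<in> mball (f y) (l * r)" using w mball_subset_concentric by blast
      hence "w \<in> f ` mball x r" using b assms(1) by (auto simp: scales_def)
      then obtain z where z: "z \<in> mball x r" "w = f z" by auto
      have "d (f y) (f z) = l * d y z" using scales_dist[OF assms(1,2)] z by auto
      hence "l * d y z < l * s" using w z by auto
      thus "w \<in> f ` mball y s" using z x y by auto
    qed
  qed
  thus ?thesis using assms sub x y fy unfolding scales_def by (auto simp: subset_iff)
qed

lemma scales_comp:
  assumes "scales f x r l" "scales h (f x) (l * r) k"
  shows "scales (h \<circ> f) x r (k * l)"
proof -
  have im: "f ` mball x r = mball (f x) (l * r)" using assms(1) by (rule scales_image)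
  have "(h \<circ> f) ` mball x r = mball (h (f x)) (k * (l * r))"
    using scales_image[OF assms(2)] im by (metis image_comp)
  moreover have "d (h (f y)) (h (f z)) = k * (l * d y z)"
    if "y \<in> mball x r" "z \<in> mball x r" for y z
    using scales_dist[OF assms(1) that] scales_dist[OF assms(2), of "f y" "f z"] im that
    by (metis image_eqI)
  ultimately show ?thesis using assms unfolding scales_def by (auto simp: mult.assoc)
qed

lemma finite_ball_cover:
  assumes "compactin mtopology Q" and "\<And>x. x \<in> Q \<Longrightarrow> r x > 0"
  obtains X where "finite X" "X \<subseteq> Q" "Q \<subseteq> (\<Union>x\<in>X. mball x (r x))"
proof -
  have "Q \<subseteq> M" using assms(1) compactin_subset_topspace by fastforce
  hence "\<exists>\<F>. finite \<F> \<and> \<F> \<subseteq> (\<lambda>x. mball x (r x)) ` Q \<and> Q \<subseteq> \<Union>\<F>"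
    by (intro compactinD[OF assms(1)]) (use assms(2) in auto)
  then obtain \<F> where \<F>: "finite \<F>" "\<F> \<subseteq> (\<lambda>x. mball x (r x)) ` Q" "Q \<subseteq> \<Union>\<F>" by blast
  then obtain X where X: "finite X" "X \<subseteq> Q" "\<F> = (\<lambda>x. mball x (r x)) ` X"
    by (metis finite_subset_image)
  show thesis by (rule that[OF X(1,2)]) (use \<F>(3) X(3) in blast)
qed

text \<open>A finite subcover leaves finitely many local constants, and as \<open>P\<close> persists
  for smaller constants their minimum serves everywhere.\<close>

lemma compact_uniform:
  assumes "compactin mtopology Q"
    and "\<And>x. x \<in> Q \<Longrightarrow> \<exists>r>0. \<exists>c>0. \<forall>y\<in>Q \<inter> mball x r. P y c"
    and "\<And>y c c'. P y c \<Longrightarrow> 0 < c' \<Longrightarrow> c' \<le> c \<Longrightarrow> P y c'"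
  shows "\<exists>c::real>0. \<forall>y\<in>Q. P y c"
proof -
  obtain r c where rc: "\<And>x. x \<in> Q \<Longrightarrow> r x > 0 \<and> c x > 0 \<and> (\<forall>y\<in>Q \<inter> mball x (r x). P y (c x))"
    using assms(2) by metis
  obtain X where X: "finite X" "X \<subseteq> Q" "Q \<subseteq> (\<Union>x\<in>X. mball x (r x))"
    using finite_ball_cover[OF assms(1)] rc by metis
  \<comment> \<open>The extra \<open>1\<close> keeps the minimum meaningful when \<open>Q\<close> is
    empty.\<close>
  define e where "e = Min (insert 1 (c ` X))"
  have "e > 0" using X rc by (auto simp: e_def)
  moreover have "P y e" if "y \<in> Q" for y
  proof -
    obtain x where x: "x \<in> X" "y \<in> mball x (r x)" using X(3) \<open>y \<in> Q\<close> by blast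
    have "e \<le> c x" using X x by (auto simp: e_def)
    thus ?thesis using assms(3) \<open>e > 0\<close> rc x X that by blast
  qed
  ultimately show ?thesis by blast
qed

text \<open>Provides minima: an ultrametric distance to a fixed point is locally constant wherever
  it is positive.\<close>

lemma finite_image_locally_constant:
  assumes "compactin mtopology Q"
    and "\<And>x. x \<in> Q \<Longrightarrow> \<exists>r>0. \<forall>y\<in>Q \<inter> mball x r. f y = f x"
  shows "finite (f ` Q)"
proof -
  obtain r where r: "\<And>x. x \<in> Q \<Longrightarrow> r x > 0 \<and> (\<forall>y\<in>Q \<inter> mball x (r x). f y = f x)"
    using assms(2) by metis
  obtain X where X: "finite X" "X \<subseteq> Q" "Q \<subseteq> (\<Union>x\<in>X. mball x (r x))"
    using finite_ball_cover[OF assms(1)] r by metis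
  have "f ` Q \<subseteq> f ` X"
  proof
    fix w assume "w \<in> f ` Q"
    then obtain y where y: "y \<in> Q" "w = f y" by blast
    then obtain x where x: "x \<in> X" "y \<in> mball x (r x)" using X(3) by blast
    hence "f y = f x" using r X(2) y(1) by blast
    thus "w \<in> f ` X" using x(1) y(2) by blast
  qed
  thus ?thesis using X(1) finite_subset by blast
qed

definition locally_lipschitz :: "('a \<Rightarrow> 'a) \<Rightarrow> bool" where
  "locally_lipschitz f \<longleftrightarrow>
     (\<forall>x\<in>M. \<exists>s>0. \<exists>L>0. \<forall>y\<in>mball x s. \<forall>z\<in>mball x s. d (f y) (f z) \<le> L * d y z)"

definition fatou :: "('a \<Rightarrow> 'a) \<Rightarrow> 'a set" where
  "fatou f = {x \<in> M. \<exists>U. openin mtopology U \<and> x \<in> U \<and> equicontinuous_family d U (\<lambda>n. f ^^ n)}"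

end

section \<open>Equicontinuity and critical points\<close>

text \<open>
  The assumption at critical points is modelled on \<open>y \<mapsto> y\<^sup>m\<close>, where \<open>e = th = \<bar>m\<bar>\<close>:
  on the ball of radius \<open>\<bar>m\<bar> \<bar>y\<bar>\<close> about \<open>y\<close> this is a similarity of ratio \<open>\<bar>m\<bar> \<bar>y\<bar>\<^sup>m\<^sup>-\<^sup>1\<close>.
\<close>

locale branched_system = ultrametric_space M d for M :: "'a set" and d +
  fixes T :: "'a \<Rightarrow> 'a" and C :: "'a set"
  assumes compact: "compact_space mtopology"
    and not_isolated: "x \<in> M \<Longrightarrow> e > 0 \<Longrightarrow> \<exists>y\<in>M. y \<noteq> x \<and> d x y < e"
    and maps_to: "x \<in> M \<Longrightarrow> T x \<in> M"
    and noncritical: "x \<in> M \<Longrightarrow> x \<notin> C \<Longrightarrow> \<exists>r l. scales T x r l"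
    and critical: "x \<in> M \<Longrightarrow> x \<in> C \<Longrightarrow>
      \<exists>r>0. \<exists>e>0. \<exists>th>0. e \<le> 1 \<and> th \<le> 1 \<and> (\<forall>y\<in>mball x r. y \<noteq> x \<longrightarrow>
        (\<exists>l. scales T y (e * d x y) l \<and> l * d x y = th * d (T x) (T y)))"
    and critical_contracts: "x \<in> M \<Longrightarrow> x \<in> C \<Longrightarrow> \<eta> > 0 \<Longrightarrow>
      \<exists>s>0. \<forall>y\<in>mball x s. \<forall>z\<in>mball x s. d (T y) (T z) \<le> \<eta> * d y z"
    and critical_preperiodic: "x \<in> C \<Longrightarrow> x \<in> M - fatou T \<Longrightarrow> eventually_periodic T x"
begin

definition J where "J = M - fatou T"

lemma iter_in: "x \<in> M \<Longrightarrow> (T ^^ n) x \<in> M"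
  by (induction n) (auto simp: maps_to)

lemma J_sub: "J \<subseteq> M" by (auto simp: J_def)

lemma lipschitz_T: "locally_lipschitz T"
  unfolding locally_lipschitz_def
proof
  fix x assume x: "x \<in> M"
  show "\<exists>s>0. \<exists>L>0. \<forall>y\<in>mball x s. \<forall>z\<in>mball x s. d (T y) (T z) \<le> L * d y z"
  proof (cases "x \<in> C")
    case True
    thus ?thesis using critical_contracts[OF x True, of 1] by (metis zero_less_one)
  next
    case False
    then obtain r l where "scales T x r l" using noncritical x by blast
    thus ?thesis unfolding scales_def by (metis order_refl)
  qed
qed

lemma lipschitz_comp:
  assumes "locally_lipschitz f" "\<And>x. x \<in> M \<Longrightarrow> f x \<in> M" "locally_lipschitz h"
  shows "locally_lipschitz (h \<circ> f)"
  unfolding locally_lipschitz_def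
proof
  fix x assume x: "x \<in> M"
  obtain s L where s: "s > 0" "L > 0" "\<And>y z. y\<in>mball x s \<Longrightarrow> z\<in>mball x s \<Longrightarrow> d (f y) (f z) \<le> L * d y z"
    using assms(1) x unfolding locally_lipschitz_def by blast
  obtain t K where t: "t > 0" "K > 0"
    "\<And>y z. y\<in>mball (f x) t \<Longrightarrow> z\<in>mball (f x) t \<Longrightarrow> d (h y) (h z) \<le> K * d y z"
    using assms(2)[OF x] assms(3) unfolding locally_lipschitz_def by blast
  define u where "u = min s (t / L)"
  have u: "u > 0" "u \<le> s" "u \<le> t / L" using s t by (auto simp: u_def)
  have sub: "y \<in> mball x s" "f y \<in> mball (f x) t" if "y \<in> mball x u" for y
  proof -
    show y: "y \<in> mball x s" using that u by auto
    have "d (f x) (f y) \<le> L * d x y" using s(3)[of x y] y x s by auto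
    also have "\<dots> < L * (t / L)" using that u s by (intro mult_strict_left_mono) auto
    finally show "f y \<in> mball (f x) t" using that assms(2) s by auto
  qed
  have "d ((h \<circ> f) y) ((h \<circ> f) z) \<le> (K * L) * d y z" if "y \<in> mball x u" "z \<in> mball x u" for y z
  proof -
    have "d (h (f y)) (h (f z)) \<le> K * d (f y) (f z)" using t(3) sub that by blast
    also have "\<dots> \<le> K * (L * d y z)" using s(3)[of y z] sub that t by simp
    finally show ?thesis by simp
  qed
  thus "\<exists>s>0. \<exists>L>0. \<forall>y\<in>mball x s. \<forall>z\<in>mball x s. d ((h \<circ> f) y) ((h \<circ> f) z) \<le> L * d y z"
    using u s t by (intro exI[of _ u] conjI exI[of _ "K * L"]) auto
qed

lemma lipschitz_iter: "locally_lipschitz (T ^^ n)"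
proof (induction n)
  case 0
  show ?case by (auto simp: locally_lipschitz_def intro!: exI[of _ 1])
next
  case (Suc n)
  show ?case using lipschitz_comp[OF Suc iter_in lipschitz_T] by (simp add: comp_def)
qed

lemma lipschitz_continuous:
  assumes "locally_lipschitz f" "\<And>x. x \<in> M \<Longrightarrow> f x \<in> M"
  shows "continuous_map mtopology mtopology f"
proof -
  have "\<exists>\<delta>>0. \<forall>y. y \<in> M \<and> d x y < \<delta> \<longrightarrow> d (f x) (f y) < e" if x: "x \<in> M" and e: "e > 0" for x e
  proof -
    obtain s L where s: "s > 0" "L > 0" "\<And>y z. y\<in>mball x s \<Longrightarrow> z\<in>mball x s \<Longrightarrow> d (f y) (f z) \<le> L * d y z"
      using assms(1) x unfolding locally_lipschitz_def by blast
    have "d (f x) (f y) < e" if "y \<in> M" "d x y < min s (e / L)" for y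
    proof -
      have "d (f x) (f y) \<le> L * d x y" using s(3)[of x y] that x s by auto
      also have "\<dots> < L * (e / L)" using that s by (intro mult_strict_left_mono) auto
      finally show ?thesis using s by simp
    qed
    thus ?thesis using s e by (intro exI[of _ "min s (e / L)"]) auto
  qed
  thus ?thesis
    unfolding metric_continuous_map[OF Metric_space_axioms] using assms(2) by blast
qed

lemma continuous_T: "continuous_map mtopology mtopology T"
  using lipschitz_continuous[OF lipschitz_T maps_to] .

lemma continuous_iter: "continuous_map mtopology mtopology (T ^^ n)"
  using lipschitz_continuous[OF lipschitz_iter iter_in] .

lemma equicontinuousI:
  assumes "x \<in> M" "s > 0"
    and "\<And>n y z. y \<in> mball x s \<Longrightarrow> z \<in> mball x s \<Longrightarrow> d ((T ^^ n) y) ((T ^^ n) z) \<le> L * d y z"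
  shows "x \<in> fatou T"
proof -
  \<comment> \<open>\<open>L\<close> may fail to be positive, while the choice \<open>e / K\<close>
    below divides by the constant.\<close>
  define K where "K = max L 1"
  have K: "K > 0" "K \<ge> L" by (auto simp: K_def)
  have "equicontinuous_family d (mball x s) (\<lambda>n. T ^^ n)"
    unfolding equicontinuous_family_def
  proof (intro ballI allI impI)
    fix y and e :: real assume y: "y \<in> mball x s" and e: "e > 0"
    have "d ((T ^^ n) y) ((T ^^ n) z) < e" if z: "z \<in> mball x s" "d y z < e / K" for z n
    proof -
      have "d ((T ^^ n) y) ((T ^^ n) z) \<le> L * d y z" using assms(3) y z by blast
      also have "\<dots> \<le> K * d y z" using K by (intro mult_right_mono) auto
      also have "\<dots> < K * (e / K)" using z K by (intro mult_strict_left_mono) auto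
      finally show ?thesis using K by simp
    qed
    thus "\<exists>\<delta>>0. \<forall>z\<in>mball x s. d y z < \<delta> \<longrightarrow> (\<forall>n. d ((T ^^ n) y) ((T ^^ n) z) < e)"
      using e K by (intro exI[of _ "e / K"]) auto
  qed
  thus ?thesis using assms(1,2) unfolding fatou_def by (auto intro!: exI[of _ "mball x s"])
qed

section \<open>Invariance of the Fatou and Julia sets\<close>

lemma openin_fatou: "openin mtopology (fatou T)"
proof -
  have "fatou T = \<Union>{U. openin mtopology U \<and> equicontinuous_family d U (\<lambda>n. T ^^ n)}"
    unfolding fatou_def using openin_subset[of mtopology] by auto
  thus ?thesis by (auto intro!: openin_Union)
qed

lemma closedin_J: "closedin mtopology J"
  unfolding J_def using openin_fatou by blast

lemma fatou_preimage:
  assumes "x \<in> M" "T x \<in> fatou T"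
  shows "x \<in> fatou T"
proof -
  obtain U where U: "openin mtopology U" "T x \<in> U" "equicontinuous_family d U (\<lambda>n. T ^^ n)"
    using assms(2) unfolding fatou_def by blast
  define V where "V = {w \<in> M. T w \<in> U}"
  have V: "openin mtopology V"
    using openin_continuous_map_preimage[OF continuous_T U(1)] by (simp add: V_def)
  have "equicontinuous_family d V (\<lambda>n. T ^^ n)"
    unfolding equicontinuous_family_def
  proof (intro ballI allI impI)
    fix y and e :: real assume y: "y \<in> V" and e: "e > 0"
    obtain a where a: "a > 0" "\<And>z n. z \<in> U \<Longrightarrow> d (T y) z < a \<Longrightarrow> d ((T ^^ n) (T y)) ((T ^^ n) z) < e"
      using U(3) y e unfolding equicontinuous_family_def V_def by blast
    obtain b where b: "b > 0" "\<And>z. z \<in> M \<Longrightarrow> d y z < b \<Longrightarrow> d (T y) (T z) < a"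
      using metric_continuous_map[OF Metric_space_axioms, THEN iffD1, OF continuous_T,
          THEN conjunct2, rule_format, of y a] y a(1)
      unfolding V_def by auto
    \<comment> \<open>The term \<open>e\<close> in the minimum serves the zeroth iterate, which does
      not pass through \<open>T\<close>.\<close>
    have "d ((T ^^ n) y) ((T ^^ n) z) < e" if "z \<in> V" "d y z < min b e" for z n
    proof (cases n)
      case (Suc m)
      thus ?thesis using a(2)[of "T z" m] b(2)[of z] that by (auto simp: funpow_swap1 V_def)
    qed (use that in auto)
    thus "\<exists>\<delta>>0. \<forall>z\<in>V. d y z < \<delta> \<longrightarrow> (\<forall>n. d ((T ^^ n) y) ((T ^^ n) z) < e)"
      using b e by (intro exI[of _ "min b e"]) auto
  qed
  moreover have "x \<in> V" using assms(1) U(2) by (simp add: V_def)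
  ultimately show ?thesis using V assms(1) unfolding fatou_def by blast
qed

text \<open>Forward invariance needs a local inverse: the similarity makes the image of a ball open
  and turns small distances in the image into small distances in the source. Critical points admit
  no such ball.\<close>

lemma fatou_image:
  assumes "scales T x r l" "x \<in> fatou T"
  shows "T x \<in> fatou T"
proof -
  obtain U where U: "openin mtopology U" "x \<in> U" "equicontinuous_family d U (\<lambda>n. T ^^ n)"
    using assms(2) unfolding fatou_def by blast
  have x: "x \<in> M" using assms(1) by (auto simp: scales_def)
  obtain s0 where s0: "s0 > 0" "mball x s0 \<subseteq> U" using U openin_mtopology by metis
  define s where "s = min s0 r"
  have s: "s > 0" "s \<le> r" "mball x s \<subseteq> U"
    using s0 scales_pos[OF assms(1)] by (auto simp: s_def)
  have sc: "scales T x s l" using scales_sub[OF assms(1)] x s scales_pos[OF assms(1)] by auto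
  have l: "l > 0" using sc by (auto simp: scales_def)
  have "equicontinuous_family d (T ` mball x s) (\<lambda>n. T ^^ n)"
    unfolding equicontinuous_family_def
  proof (intro ballI allI impI)
    fix y' and e :: real assume "y' \<in> T ` mball x s" and e: "e > 0"
    then obtain y where y: "y \<in> mball x s" "y' = T y" by auto
    obtain a where a: "a > 0" "\<And>z n. z \<in> U \<Longrightarrow> d y z < a \<Longrightarrow> d ((T ^^ n) y) ((T ^^ n) z) < e"
      using U(3) y s(3) e unfolding equicontinuous_family_def by blast
    have "d ((T ^^ n) y') ((T ^^ n) z') < e" if z: "z' \<in> T ` mball x s" "d y' z' < l * a" for z' n
    proof -
      obtain z where z': "z \<in> mball x s" "z' = T z" using z by auto
      have "l * d y z < l * a" using z y z' scales_dist[OF sc, of y z] by auto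
      thus ?thesis using a(2)[of z "Suc n"] s(3) z' l y by (auto simp: funpow_swap1)
    qed
    thus "\<exists>\<delta>>0. \<forall>z\<in>T ` mball x s. d y' z < \<delta> \<longrightarrow> (\<forall>n. d ((T ^^ n) y') ((T ^^ n) z) < e)"
      using a l by (intro exI[of _ "l * a"]) auto
  qed
  moreover have "openin mtopology (T ` mball x s)" using scales_image[OF sc] by simp
  ultimately show ?thesis using x s maps_to unfolding fatou_def by blast
qed

lemma J_image: "x \<in> J \<Longrightarrow> T x \<in> J"
  using fatou_preimage maps_to by (auto simp: J_def)

lemma J_iter: "x \<in> J \<Longrightarrow> (T ^^ n) x \<in> J"
  by (induction n) (auto simp: J_image)

lemma J_preimage: "scales T x r l \<Longrightarrow> y \<in> mball x r \<Longrightarrow> T y \<in> J \<Longrightarrow> y \<in> J"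
  using fatou_image[of y r l] scales_sub[of T x r l y r] by (auto simp: J_def scales_def)

lemma compact_J: "compactin mtopology J"
  using closedin_compact_space[OF compact closedin_J] .

section \<open>Local ratios and their products along orbits\<close>

lemma scales_unique:
  assumes "scales f x r l" "scales f x s k"
  shows "l = k"
proof -
  have "x \<in> M" "min r s > 0" using assms by (auto simp: scales_def)
  \<comment> \<open>A ratio can only be read off from two distinct points; this is where the absence
    of isolated points enters.\<close>
  then obtain y where y: "y \<in> M" "y \<noteq> x" "d x y < min r s" using not_isolated by blast
  have "d (f x) (f y) = l * d x y" "d (f x) (f y) = k * d x y"
    using scales_dist[OF assms(1), of x y] scales_dist[OF assms(2), of x y] y assms
    by (auto simp: scales_def)
  moreover have "d x y \<noteq> 0" using y \<open>x \<in> M\<close> by auto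
  ultimately show ?thesis by simp
qed

text \<open>The metric derivative of \<open>T\<close>. By \<open>scales_unique\<close> it does not
  depend on the ball; where \<open>T\<close> is no local similarity the value carries no
  meaning.\<close>

definition lam :: "'a \<Rightarrow> real" where "lam x = (THE l. \<exists>r. scales T x r l)"

lemma lam_eq: "scales T x r l \<Longrightarrow> lam x = l"
proof -
  assume sc: "scales T x r l"
  show ?thesis unfolding lam_def
  proof (rule the_equality)
    show "k = l" if "\<exists>r. scales T x r k" for k using that scales_unique[OF sc] by blast
  qed (use sc in blast)
qed

lemma lam_ball: "scales T x r l \<Longrightarrow> y \<in> mball x r \<Longrightarrow> lam y = l"
  by (rule lam_eq, rule scales_sub[where s = r]) (auto dest: scales_pos(1))

definition lamn :: "nat \<Rightarrow> 'a \<Rightarrow> real" where "lamn n x = (\<Prod>i<n. lam ((T ^^ i) x))"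

lemma lamn_0 [simp]: "lamn 0 x = 1"
  by (simp add: lamn_def)

lemma lamn_Suc: "lamn (Suc n) x = lamn n x * lam ((T ^^ n) x)"
  by (simp add: lamn_def)

lemma lamn_Suc_left: "lamn (Suc n) x = lam x * lamn n (T x)"
proof (induction n)
  case (Suc n)
  thus ?case by (simp add: lamn_Suc funpow_swap1)
qed (simp add: lamn_def)

lemma lamn_add: "lamn (m + n) x = lamn m x * lamn n ((T ^^ m) x)"
proof (induction n)
  case (Suc n)
  have "(T ^^ (m + n)) x = (T ^^ n) ((T ^^ m) x)"
    by (simp add: add.commute[of m n] funpow_add)
  thus ?case using Suc by (simp add: lamn_Suc)
qed simp

lemma lamn_pos:
  assumes "\<And>i. i < n \<Longrightarrow> \<exists>r l. scales T ((T ^^ i) x) r l"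
  shows "lamn n x > 0"
  unfolding lamn_def
proof (rule prod_pos)
  fix i assume "i \<in> {..<n}"
  then obtain r l where "scales T ((T ^^ i) x) r l" using assms by blast
  thus "lam ((T ^^ i) x) > 0" using lam_eq scales_pos(2) by metis
qed

text \<open>
  If the ball of radius \<open>b\<close> about \<open>x\<close> never outgrows the scale on which \<open>T\<close> is a similarity,
  then all iterates are similarities on it with bounded ratios.
\<close>

lemma bounded_scaling_fatou:
  assumes x: "x \<in> M" and b: "b > 0"
    and sc: "\<And>n. scales T ((T ^^ n) x) (r n) (lam ((T ^^ n) x))"
    and le: "\<And>n. lamn n x * b \<le> r n" and G: "\<And>n. r n \<le> G"
  shows "x \<in> fatou T"
proof (rule equicontinuousI[OF x b])
  fix n y z assume y: "y \<in> mball x b" and z: "z \<in> mball x b"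
  have pos: "lamn n x > 0" for n using lamn_pos sc by blast
  have *: "d ((T ^^ n) v) ((T ^^ n) w) = lamn n x * d v w"
    if "v \<in> mball x b" "w \<in> mball x b" for v w n
    using that
  proof (induction n arbitrary: v w)
    case (Suc n)
    have xb: "x \<in> mball x b" using x b by simp
    have in_ball: "(T ^^ n) u \<in> mball ((T ^^ n) x) (r n)" if u: "u \<in> mball x b" for u
    proof -
      have "d ((T ^^ n) x) ((T ^^ n) u) = lamn n x * d x u" using Suc.IH xb u by blast
      also have "\<dots> < lamn n x * b" using u pos by (intro mult_strict_left_mono) auto
      finally show ?thesis using le[of n] x u iter_in by auto
    qed
    have "d (T ((T ^^ n) v)) (T ((T ^^ n) w)) = lam ((T ^^ n) x) * d ((T ^^ n) v) ((T ^^ n) w)"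
      by (rule scales_dist[OF sc in_ball in_ball]) (use Suc.prems in auto)
    thus ?case using Suc by (simp add: lamn_Suc)
  qed simp
  have "lamn n x * b \<le> G" using le G order_trans by blast
  hence "lamn n x \<le> G / b" using b by (simp add: field_simps)
  thus "d ((T ^^ n) y) ((T ^^ n) z) \<le> (G / b) * d y z"
    unfolding *[OF y z] by (rule mult_right_mono) simp
qed

text \<open>Only finitely many similarities are composed, so the radius may shrink at each step. It
  is not controlled as \<open>n\<close> grows; the uniform statements come from compactness
  later.\<close>

lemma scales_iter:
  assumes "x \<in> M" "\<And>i. i < n \<Longrightarrow> \<exists>r l. scales T ((T ^^ i) x) r l"
  shows "\<exists>s. scales (T ^^ n) x s (lamn n x) \<and> (\<forall>y\<in>mball x s. lamn n y = lamn n x)"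
  using assms(2)
proof (induction n)
  case 0
  have "scales (T ^^ 0) x 1 (lamn 0 x)" using assms(1) by (auto simp: scales_def)
  thus ?case by (metis lamn_0)
next
  case (Suc n)
  obtain s where s: "scales (T ^^ n) x s (lamn n x)" "\<forall>y\<in>mball x s. lamn n y = lamn n x"
    using Suc by auto
  obtain r l where rl: "scales T ((T ^^ n) x) r l" using Suc.prems by blast
  have l: "lam ((T ^^ n) x) = l" using lam_eq[OF rl] .
  have pos: "lamn n x > 0" "s > 0" "r > 0" using s(1) rl scales_pos by blast+
  \<comment> \<open>A ball of radius \<open>r / lamn n x\<close> about \<open>x\<close> is mapped by
    the n-th iterate to one of radius \<open>r\<close>, on which \<open>T\<close> is a
    similarity.\<close>
  define t where "t = min s (r / lamn n x)"
  have "r / lamn n x > 0" by (rule divide_pos_pos[OF pos(3) pos(1)])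
  hence t1: "t > 0"
    unfolding t_def using pos(2) by simp
  have t2: "t \<le> s"
    unfolding t_def by simp
  have t4: "t \<le> r / lamn n x"
    unfolding t_def by (rule min.cobounded2)
  note t = t1 t2 t4
  have t3: "lamn n x * t \<le> r" using mult_left_mono[OF t(3), of "lamn n x"] pos by simp
  have sc: "scales (T ^^ n) x t (lamn n x)"
    using scales_sub[OF s(1) _ t(1,2)] assms(1) pos by simp
  have "scales T ((T ^^ n) x) (lamn n x * t) l"
    using scales_sub[OF rl _ _ t3] iter_in assms(1) t pos by simp
  hence "scales (T ^^ Suc n) x t (lamn (Suc n) x)"
    using scales_comp[OF sc] by (simp add: lamn_Suc l mult.commute)
  moreover have "lamn (Suc n) y = lamn (Suc n) x" if y: "y \<in> mball x t" for y
  proof -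
    have "(T ^^ n) y \<in> mball ((T ^^ n) x) (lamn n x * t)"
      using scales_image[OF sc] y by blast
    hence "(T ^^ n) y \<in> mball ((T ^^ n) x) r" using t3 by auto
    hence "lam ((T ^^ n) y) = l" using lam_ball[OF rl] by blast
    moreover have "lamn n y = lamn n x" using s(2) y t(2) by auto
    ultimately show ?thesis by (simp add: lamn_Suc l)
  qed
  ultimately show ?case by blast
qed

section \<open>Critical points in the Julia set and their forward orbits\<close>

lemma critical_not_scales:
  assumes "x \<in> C" shows "\<not> scales T x r l"
proof
  assume sc: "scales T x r l"
  hence x: "x \<in> M" "l > 0" "r > 0" by (auto simp: scales_def)
  \<comment> \<open>A critical point contracts below every ratio; half of the supposed one suffices
    for a contradiction.\<close>
  obtain s where s: "s > 0" "\<forall>y\<in>mball x s. \<forall>z\<in>mball x s. d (T y) (T z) \<le> l / 2 * d y z"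
    using critical_contracts[OF x(1) assms, of "l / 2"] x by auto
  obtain y where y: "y \<in> M" "y \<noteq> x" "d x y < min r s"
    using not_isolated[OF x(1), of "min r s"] s x by auto
  have "d (T x) (T y) = l * d x y" using scales_dist[OF sc, of x y] y x by auto
  moreover have "d (T x) (T y) \<le> l / 2 * d x y" using s y x by auto
  moreover have "d x y > 0" using x y by simp
  ultimately have "l * d x y \<le> l / 2 * d x y" "l * d x y > 0" using x by auto
  thus False by simp
qed

text \<open>One format for both kinds of points, because \<open>Z\<close> contains noncritical
  points as well. Away from \<open>C\<close> nothing is lost and \<open>e = th = 1\<close>
  works.\<close>

lemma local_form:
  assumes x: "x \<in> M"
  shows "\<exists>r>0. \<exists>e>0. \<exists>th>0. e \<le> 1 \<and> th \<le> 1 \<and> (x \<notin> C \<longrightarrow> th = 1) \<and> (\<forall>y\<in>mball x r. y \<noteq> x \<longrightarrow>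
        (\<exists>l. scales T y (e * d x y) l \<and> l * d x y = th * d (T x) (T y)))"
proof (cases "x \<in> C")
  case True
  thus ?thesis using critical[OF x True] by blast
next
  case False
  then obtain r l where sc: "scales T x r l" using noncritical x by blast
  have "scales T y (1 * d x y) l \<and> l * d x y = 1 * d (T x) (T y)"
    if y: "y \<in> mball x r" "y \<noteq> x" for y
    using scales_sub[OF sc y(1), of "d x y"] scales_dist[OF sc, of x y] y scales_pos[OF sc] by auto
  hence "\<forall>y\<in>mball x r. y \<noteq> x \<longrightarrow> (\<exists>l. scales T y (1 * d x y) l \<and> l * d x y = 1 * d (T x) (T y))"
    by blast
  thus ?thesis using scales_pos(1)[OF sc] zero_less_one order_refl by metis
qed

text \<open>Infinitely many critical points would accumulate at some point of \<open>J\<close>, but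
  by \<open>local_form\<close> a punctured ball about that point consists of points where
  \<open>T\<close> is a similarity.\<close>

lemma finite_critical: "finite (C \<inter> J)"
proof (rule ccontr)
  assume "infinite (C \<inter> J)"
  then obtain x where x: "x \<in> J" "x \<in> mtopology derived_set_of (C \<inter> J)"
    using compact_J unfolding compactin_eq_Bolzano_Weierstrass by blast
  hence xM: "x \<in> M" using J_sub by auto
  obtain r where r: "r > 0" "\<And>y. y \<in> mball x r \<Longrightarrow> y \<noteq> x \<Longrightarrow> y \<notin> C"
    using local_form[OF xM] critical_not_scales by metis
  have "\<exists>y\<in>C \<inter> J. y \<noteq> x \<and> y \<in> mball x r"
    using x(2) r(1) unfolding metric_derived_set_of by blast
  then obtain y where "y \<noteq> x" "y \<in> C" "y \<in> mball x r" by blast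
  thus False using r(2) by blast
qed

text \<open>A superattracting cycle: the arbitrarily strong contraction at \<open>c\<close> beats
  the Lipschitz constant of the other \<open>q - 1\<close> steps, so \<open>T ^^ q\<close> maps a
  ball about \<open>c\<close> into itself without expanding. Every iterate is a power of
  \<open>T ^^ q\<close> followed by one of finitely many Lipschitz maps.\<close>

lemma periodic_critical_fatou:
  assumes c: "c \<in> M" "c \<in> C" and q: "q \<ge> 1" "(T ^^ q) c = c"
  shows "c \<in> fatou T"
proof -
  have "\<exists>s>0. \<exists>L>0. \<forall>y\<in>mball c s. \<forall>z\<in>mball c s. d ((T ^^ i) y) ((T ^^ i) z) \<le> L * d y z" for i
    using lipschitz_iter[of i] c unfolding locally_lipschitz_def by blast
  then obtain s L where sL: "\<And>i. s i > (0::real)" "\<And>i. L i > (0::real)"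
    "\<And>i y z. y \<in> mball c (s i) \<Longrightarrow> z \<in> mball c (s i) \<Longrightarrow> d ((T ^^ i) y) ((T ^^ i) z) \<le> L i * d y z"
    by metis
  obtain q' where q': "q = Suc q'" using q by (cases q) auto
  obtain s1 K where K: "s1 > 0" "K > 0"
    "\<And>y z. y \<in> mball (T c) s1 \<Longrightarrow> z \<in> mball (T c) s1 \<Longrightarrow> d ((T ^^ q') y) ((T ^^ q') z) \<le> K * d y z"
    using lipschitz_iter[of q'] maps_to[OF c(1)] unfolding locally_lipschitz_def by blast
  \<comment> \<open>The contraction factor \<open>1 / K'\<close> at \<open>c\<close> cancels the
    Lipschitz constant of \<open>T ^^ q'\<close>; being at most \<open>1\<close>, it also keeps the
    image of the ball within radius \<open>s1\<close> of \<open>T c\<close>.\<close>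
  define K' where "K' = max K 1"
  have K': "K' \<ge> 1" "K' \<ge> K" by (auto simp: K'_def)
  obtain s2 where s2: "s2 > 0" "\<And>y z. y\<in>mball c s2 \<Longrightarrow> z\<in>mball c s2 \<Longrightarrow> d (T y) (T z) \<le> 1 / K' * d y z"
    using critical_contracts[OF c, of "1 / K'"] K' by auto
  define t where "t = Min ({s1, s2} \<union> s ` {..<q})"
  have t: "0 < t" "t \<le> s1" "t \<le> s2" "\<And>i. i < q \<Longrightarrow> t \<le> s i"
    unfolding t_def using K(1) s2(1) sL(1) by (auto simp del: Min_insert intro!: Min_le)
  define B where "B = mball c t"
  have cB: "c \<in> B" using c t by (simp add: B_def)
  have qL: "d ((T ^^ q) y) ((T ^^ q) z) \<le> d y z" if "y \<in> B" "z \<in> B" for y z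
  proof -
    have T_in: "T u \<in> mball (T c) s1" if u: "u \<in> B" for u
    proof -
      have "d (T c) (T u) \<le> 1 / K' * d c u" using s2(2)[of c u] u cB t by (auto simp: B_def)
      also have "\<dots> \<le> 1 * d c u" using K' by (intro mult_right_mono) auto
      also have "\<dots> < s1" using u t by (auto simp: B_def)
      finally show ?thesis using u c maps_to by (auto simp: B_def)
    qed
    have "d ((T ^^ q') (T y)) ((T ^^ q') (T z)) \<le> K * d (T y) (T z)"
      using K(3) T_in that by blast
    also have "\<dots> \<le> K' * (1 / K' * d y z)"
      using s2(2)[of y z] that t K K' by (intro mult_mono) (auto simp: B_def)
    also have "\<dots> = d y z" using K' by simp
    finally show ?thesis by (simp add: q' funpow_swap1)
  qed
  have qB: "(T ^^ q) y \<in> B" if y: "y \<in> B" for y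
    using qL[OF cB y] q(2) y iter_in by (auto simp: B_def)
  have iter: "((T ^^ q) ^^ k) y \<in> B \<and> ((T ^^ q) ^^ k) z \<in> B
      \<and> d (((T ^^ q) ^^ k) y) (((T ^^ q) ^^ k) z) \<le> d y z" if "y \<in> B" "z \<in> B" for y z k
    using that
  proof (induction k)
    case (Suc k)
    thus ?case using qB qL[of "((T ^^ q) ^^ k) y" "((T ^^ q) ^^ k) z"] by (simp add: order_trans)
  qed simp
  define L' where "L' = Max (L ` {..<q})"
  have L': "L i \<le> L'" if "i < q" for i using that by (auto simp: L'_def)
  show ?thesis
  proof (rule equicontinuousI[OF c(1) t(1)])
    fix n y z assume yz: "y \<in> mball c t" "z \<in> mball c t"
    \<comment> \<open>Split \<open>n = i + q * k\<close>: the powers of \<open>T ^^ q\<close> stay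
      in \<open>B\<close> and do not expand, and the remaining \<open>i < q\<close> steps cost at
      most \<open>L'\<close>.\<close>
    define i k where "i = n mod q" "k = n div q"
    have i: "i < q" using q by (simp add: i_k_def)
    have n: "(T ^^ n) u = (T ^^ i) (((T ^^ q) ^^ k) u)" for u
    proof -
      have "n = i + q * k" by (simp add: i_k_def)
      thus ?thesis by (simp add: funpow_add funpow_mult)
    qed
    have it: "((T ^^ q) ^^ k) y \<in> B" "((T ^^ q) ^^ k) z \<in> B"
      "d (((T ^^ q) ^^ k) y) (((T ^^ q) ^^ k) z) \<le> d y z"
      using iter[of y z k] yz by (auto simp: B_def)
    have "B \<subseteq> mball c (s i)" using t(4)[OF i] by (auto simp: B_def)
    hence "d ((T ^^ n) y) ((T ^^ n) z) \<le> L i * d (((T ^^ q) ^^ k) y) (((T ^^ q) ^^ k) z)"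
      unfolding n using it by (intro sL(3)) auto
    also have "\<dots> \<le> L' * d y z"
      using it(3) L'[OF i] sL(2)[of i] by (intro mult_mono) auto
    finally show "d ((T ^^ n) y) ((T ^^ n) z) \<le> L' * d y z" .
  qed
qed

lemma critical_not_periodic: "c \<in> C \<inter> J \<Longrightarrow> (T ^^ Suc n) c \<noteq> c"
proof
  assume "c \<in> C \<inter> J" "(T ^^ Suc n) c = c"
  hence "c \<in> fatou T" using J_sub by (intro periodic_critical_fatou[of c "Suc n"]) auto
  thus False using \<open>c \<in> C \<inter> J\<close> by (simp add: J_def)
qed

lemma finite_orbit:
  assumes "eventually_periodic f x"
  shows "finite (range (\<lambda>n. (f ^^ n) x))"
proof -
  obtain m n where mn: "n \<ge> 1" "(f ^^ (m + n)) x = (f ^^ m) x"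
    using assms unfolding eventually_periodic_def by blast
  have "(f ^^ k) x \<in> (\<lambda>n. (f ^^ n) x) ` {..<m + n}" for k
  proof (induction k rule: less_induct)
    case (less k)
    show ?case
    proof (cases "k < m + n")
      case False
      have "(f ^^ k) x = (f ^^ (k - (m + n) + (m + n))) x" using False by simp
      also have "\<dots> = (f ^^ (k - (m + n))) ((f ^^ (m + n)) x)"
        by (simp only: funpow_add[of "k - (m + n)"] comp_def)
      also have "\<dots> = (f ^^ (k - (m + n) + m)) x" by (simp only: mn(2)) (simp only: funpow_add comp_def)
      also have "k - (m + n) + m = k - n" using False by simp
      finally show ?thesis using less[of "k - n"] mn False by simp
    qed auto
  qed
  hence "range (\<lambda>n. (f ^^ n) x) \<subseteq> (\<lambda>n. (f ^^ n) x) ` {..<m + n}" by blast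
  thus ?thesis by (rule finite_subset) simp
qed

definition Z :: "'a set" where "Z = (\<Union>c\<in>C \<inter> J. range (\<lambda>n. (T ^^ n) c))"

lemma finite_Z: "finite Z"
  unfolding Z_def using finite_critical critical_preperiodic
  by (intro finite_UN_I finite_orbit) (simp_all add: J_def)

lemma Z_sub: "Z \<subseteq> J"
  unfolding Z_def using J_iter by auto

lemma critical_Z: "C \<inter> J \<subseteq> Z"
proof
  fix c assume "c \<in> C \<inter> J"
  moreover have "c = (T ^^ 0) c" by simp
  ultimately show "c \<in> Z" unfolding Z_def by blast
qed

lemma Z_image: "z \<in> Z \<Longrightarrow> T z \<in> Z"
proof -
  assume "z \<in> Z"
  then obtain c n where "c \<in> C \<inter> J" "z = (T ^^ n) c" unfolding Z_def by blast
  moreover from this have "T z = (T ^^ Suc n) c" by simp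
  ultimately show ?thesis unfolding Z_def by blast
qed

lemma Z_iter: "z \<in> Z \<Longrightarrow> (T ^^ n) z \<in> Z"
  by (induction n) (auto simp: Z_image)

definition depth :: "'a \<Rightarrow> nat" where "depth z = card {c \<in> C \<inter> J. \<exists>i. (T ^^ i) z = c}"

lemma depth_noncritical: "z \<notin> C \<Longrightarrow> depth (T z) = depth z"
proof -
  assume z: "z \<notin> C"
  have "(\<exists>i. (T ^^ i) z = c) \<longleftrightarrow> (\<exists>i. (T ^^ i) (T z) = c)" if "c \<in> C" for c
  proof
    assume "\<exists>i. (T ^^ i) z = c"
    then obtain i where i: "(T ^^ i) z = c" by blast
    thus "\<exists>i. (T ^^ i) (T z) = c" using z that by (cases i) (auto simp: funpow_swap1)
  next
    assume "\<exists>i. (T ^^ i) (T z) = c"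
    then obtain i where i: "(T ^^ i) (T z) = c" by blast
    hence "(T ^^ Suc i) z = c" by (simp add: funpow_swap1)
    thus "\<exists>i. (T ^^ i) z = c" by blast
  qed
  thus ?thesis unfolding depth_def by (intro arg_cong[of _ _ card]) auto
qed

lemma depth_critical: "z \<in> C \<inter> J \<Longrightarrow> depth z = Suc (depth (T z))"
proof -
  assume z: "z \<in> C \<inter> J"
  have "{c \<in> C \<inter> J. \<exists>i. (T ^^ i) z = c} = insert z {c \<in> C \<inter> J. \<exists>i. (T ^^ i) (T z) = c}" (is "?A = insert z ?B")
  proof (intro set_eqI iffI)
    fix c assume "c \<in> ?A"
    then obtain i where i: "(T ^^ i) z = c" "c \<in> C \<inter> J" by blast
    thus "c \<in> insert z ?B" by (cases i) (auto simp: funpow_swap1)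
  next
    fix c assume "c \<in> insert z ?B"
    moreover have "c \<in> ?A" if "c = z" using that z by (auto intro: exI[of _ 0])
    moreover have "c \<in> ?A" if "c \<in> ?B"
    proof -
      obtain i where i: "(T ^^ i) (T z) = c" using \<open>c \<in> ?B\<close> by blast
      hence "(T ^^ Suc i) z = c" by (simp add: funpow_swap1)
      thus ?thesis using that by blast
    qed
    ultimately show "c \<in> ?A" by blast
  qed
  \<comment> \<open>A return to \<open>z\<close> would make it a periodic critical point, which lies
    in the Fatou set.\<close>
  moreover have "z \<notin> ?B"
  proof
    assume "z \<in> ?B"
    then obtain i where "(T ^^ i) (T z) = z" by blast
    thus False using critical_not_periodic[OF z, of i] by (simp add: funpow_swap1)
  qed
  moreover have "finite ?B" by (rule finite_subset[OF _ finite_critical]) blast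
  ultimately show ?thesis unfolding depth_def by simp
qed

lemma depth_le: "depth z \<le> card (C \<inter> J)"
  unfolding depth_def by (rule card_mono[OF finite_critical]) blast

section \<open>Expansion relative to a scale function\<close>

lemma Z_in_M: "z \<in> Z \<Longrightarrow> z \<in> M"
  using Z_sub J_sub by blast

text \<open>Finiteness of \<open>Z\<close> turns local constants into common ones; shrinking
  \<open>th\<close> weakens the equality for the ratio to an inequality. Noncritical points must
  keep the factor \<open>1\<close>, since losses along a cycle of \<open>Z\<close> would accumulate.
  Distinct points of \<open>Z\<close> are at distance at least \<open>R\<close>, so their
  \<open>R\<close>-balls are disjoint.\<close>

lemma uniform_local_form:
  "\<exists>R>0. \<exists>e>0. \<exists>th>0. e \<le> 1 \<and> th \<le> 1 \<and> (\<forall>z\<in>Z. \<forall>w\<in>Z. z \<noteq> w \<longrightarrow> R \<le> d z w) \<and>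
     (\<forall>z\<in>Z. \<forall>y\<in>mball z R. y \<noteq> z \<longrightarrow>
        (\<exists>l. scales T y (e * d z y) l \<and> (if z \<in> C then th else 1) * d (T z) (T y) \<le> l * d z y))"
proof -
  have "\<forall>x\<in>M. \<exists>r e th. r > 0 \<and> e > 0 \<and> th > 0 \<and> e \<le> 1 \<and> th \<le> 1 \<and> (x \<notin> C \<longrightarrow> th = 1) \<and>
     (\<forall>y\<in>mball x r. y \<noteq> x \<longrightarrow> (\<exists>l. scales T y (e * d x y) l \<and> l * d x y = th * d (T x) (T y)))"
    using local_form by blast
  then obtain r e t where *: "\<And>x. x \<in> M \<Longrightarrow> r x > 0 \<and> e x > 0 \<and> t x > 0 \<and> e x \<le> 1 \<and> t x \<le> 1 \<and>
     (x \<notin> C \<longrightarrow> t x = 1) \<and> (\<forall>y\<in>mball x (r x). y \<noteq> x \<longrightarrow>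
        (\<exists>l. scales T y (e x * d x y) l \<and> l * d x y = t x * d (T x) (T y)))"
    by metis
  define D where "D = (\<lambda>(z, w). d z w) ` {(z, w) \<in> Z \<times> Z. z \<noteq> w}"
  have D: "finite D" "\<And>x. x \<in> D \<Longrightarrow> x > 0"
  proof -
    have "finite {(z, w) \<in> Z \<times> Z. z \<noteq> w}"
      by (rule finite_subset[of _ "Z \<times> Z"]) (auto simp: finite_Z)
    thus "finite D" by (simp add: D_def)
  qed (use Z_in_M in \<open>auto simp: D_def\<close>)
  define R where "R = Min ({1} \<union> r ` Z \<union> D)"
  define e0 where "e0 = Min ({1} \<union> e ` Z)"
  define t0 where "t0 = Min ({1} \<union> t ` Z)"
  have fin: "finite ({1} \<union> r ` Z \<union> D)" "finite ({1} \<union> e ` Z)" "finite ({1} \<union> t ` Z)"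
    using finite_Z D by auto
  have pos: "R > 0" "e0 > 0" "t0 > 0"
  proof -
    show "R > 0" unfolding R_def using D(2) * Z_in_M by (subst Min_gr_iff[OF fin(1)]) auto
    show "e0 > 0" unfolding e0_def using * Z_in_M by (subst Min_gr_iff[OF fin(2)]) auto
    show "t0 > 0" unfolding t0_def using * Z_in_M by (subst Min_gr_iff[OF fin(3)]) auto
  qed
  have le: "e0 \<le> 1" "t0 \<le> 1" unfolding e0_def t0_def by (rule Min_le[OF fin(2)], simp, rule Min_le[OF fin(3)], simp)
  have leZ: "R \<le> r z" "e0 \<le> e z" "t0 \<le> t z" if "z \<in> Z" for z
  proof -
    show "R \<le> r z" unfolding R_def using that by (intro Min_le[OF fin(1)]) simp
    show "e0 \<le> e z" unfolding e0_def using that by (intro Min_le[OF fin(2)]) simp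
    show "t0 \<le> t z" unfolding t0_def using that by (intro Min_le[OF fin(3)]) simp
  qed
  have leD: "R \<le> d z w" if "z \<in> Z" "w \<in> Z" "z \<noteq> w" for z w
    unfolding R_def by (rule Min_le[OF fin(1)]) (use that in \<open>auto simp: D_def\<close>)
  have "\<exists>l. scales T y (e0 * d z y) l \<and> (if z \<in> C then t0 else 1) * d (T z) (T y) \<le> l * d z y"
    if z: "z \<in> Z" and y: "y \<in> mball z R" "y \<noteq> z" for z y
  proof -
    have zM: "z \<in> M" using z Z_in_M by blast
    have "y \<in> mball z (r z)" using y leZ(1)[OF z] by auto
    then obtain l where l: "scales T y (e z * d z y) l" "l * d z y = t z * d (T z) (T y)"
      using *[OF zM] y(2) by blast
    have dpos: "d z y > 0" "y \<in> M" using zM y by auto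
    have "scales T y (e0 * d z y) l"
    proof (rule scales_sub[OF l(1)])
      show "y \<in> mball y (e z * d z y)" using dpos *[OF zM] by simp
      show "0 < e0 * d z y" "e0 * d z y \<le> e z * d z y" using dpos pos leZ[OF z] by auto
    qed
    moreover have "(if z \<in> C then t0 else 1) \<le> t z" using *[OF zM] leZ[OF z] by auto
    hence "(if z \<in> C then t0 else 1) * d (T z) (T y) \<le> l * d z y"
      unfolding l(2) by (rule mult_right_mono) simp
    ultimately show ?thesis by blast
  qed
  thus ?thesis using pos le leD by blast
qed

lemma compact_away: "compactin mtopology (J - (\<Union>z\<in>Z. mball z r))"
proof (rule closedin_compact_space[OF compact])
  have "openin mtopology (\<Union>z\<in>Z. mball z r)" by blast
  thus "closedin mtopology (J - (\<Union>z\<in>Z. mball z r))"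
    using closedin_J by (rule closedin_diff[rotated])
qed

lemma scales_away:
  assumes "x \<in> J" "x \<notin> Z" shows "\<exists>r l. scales T x r l"
proof -
  have "x \<notin> C" using assms critical_Z by blast
  thus ?thesis using noncritical J_sub assms by blast
qed

text \<open>By the last clause the balls of radius \<open>g\<close> about points of
  \<open>J - Z\<close> coincide as soon as they share a point of \<open>J\<close>, so they partition
  \<open>J - Z\<close>. The upper bound \<open>G\<close> is what
  \<open>bounded_scaling_fatou\<close> asks for.\<close>

definition scale_function :: "('a \<Rightarrow> real) \<Rightarrow> real \<Rightarrow> bool" where
  "scale_function g G \<longleftrightarrow> (\<forall>x\<in>J - Z. 0 < g x \<and> g x \<le> G \<and> scales T x (g x) (lam x) \<and>
     (\<forall>y\<in>J \<inter> mball x (g x). y \<notin> Z \<and> g y = g x))"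

lemma scale_functionD:
  assumes "scale_function g G" "x \<in> J - Z"
  shows "g x > 0" "g x \<le> G" "scales T x (g x) (lam x)"
    "\<And>y. y \<in> J \<Longrightarrow> y \<in> mball x (g x) \<Longrightarrow> y \<notin> Z \<and> g y = g x"
  using assms unfolding scale_function_def by blast+

text \<open>Near \<open>Z\<close> the scale is a weighted distance to \<open>Z\<close>, elsewhere a
  constant. The weights prevent any loss in a step that starts near \<open>Z\<close>; off
  \<open>Z\<close> compactness limits the loss of a step to a factor \<open>c\<close>. The last
  clause handles orbits that enter \<open>Z\<close>, where the Fatou argument does not
  apply.\<close>

lemma base_scale:
  "\<exists>g G R c. scale_function g G \<and> R > 0 \<and> c > 0 \<and> c \<le> 1 \<and>
     (\<forall>z\<in>Z. \<forall>x\<in>J \<inter> mball z R. x \<noteq> z \<longrightarrow> g (T x) \<le> lam x * g x) \<and>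
     (\<forall>x\<in>J - Z. T x \<notin> Z \<longrightarrow> c * g (T x) \<le> lam x * g x) \<and>
     (\<forall>z\<in>Z. \<forall>y\<in>mball z R. y \<noteq> z \<longrightarrow> g y \<le> d z y)"
proof -
  obtain R e th where R: "R > 0" and e: "e > 0" "e \<le> 1" and th: "th > 0" "th \<le> 1"
    and sep: "\<And>z w. z \<in> Z \<Longrightarrow> w \<in> Z \<Longrightarrow> z \<noteq> w \<Longrightarrow> R \<le> d z w"
    and form: "\<And>z y. z \<in> Z \<Longrightarrow> y \<in> mball z R \<Longrightarrow> y \<noteq> z \<Longrightarrow>
        \<exists>l. scales T y (e * d z y) l \<and> (if z \<in> C then th else 1) * d (T z) (T y) \<le> l * d z y"
    using uniform_local_form by metis
  txt \<open>
    A critical point costs the factor \<open>th\<close>, but lowers \<open>depth\<close> by one as it is never visited again.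
  \<close>
  define K where "K = card (C \<inter> J)"
  define eps where "eps z = e * th ^ (K - depth z)" for z
  have eps: "eps z > 0" "eps z \<le> e" "eps z \<le> 1" "eps z \<ge> e * th ^ K" for z
  proof -
    show "eps z > 0" using e th by (simp add: eps_def)
    have "th ^ (K - depth z) \<le> 1" using th by (intro power_le_one) auto
    thus "eps z \<le> e" using e by (simp add: eps_def mult_left_le)
    thus "eps z \<le> 1" using e by simp
    have "th ^ K \<le> th ^ (K - depth z)" using th by (intro power_decreasing) auto
    thus "eps z \<ge> e * th ^ K" using e by (simp add: eps_def)
  qed
  have eps_T: "eps (T z) \<le> (if z \<in> C then th else 1) * eps z" if z: "z \<in> Z" for z
  proof (cases "z \<in> C")
    case True
    hence zC: "z \<in> C \<inter> J" using z Z_sub by auto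
    have "K - depth (T z) = Suc (K - depth z)"
      using depth_critical[OF zC] depth_le[of z] unfolding K_def by simp
    thus ?thesis using True by (simp add: eps_def)
  qed (simp add: eps_def depth_noncritical)
  have uniq: "z = w" if "z \<in> Z" "w \<in> Z" "x \<in> mball z R" "x \<in> mball w R" for x z w
  proof (rule ccontr)
    assume ne: "z \<noteq> w"
    have "mball z R = mball w R" using mball_eq[OF that(3)] mball_eq[OF that(4)] by simp
    hence "w \<in> mball z R" using that(2) Z_in_M R by auto
    thus False using sep[OF that(1,2) ne] by auto
  qed
  define near where "near x = (THE z. z \<in> Z \<and> x \<in> mball z R)" for x
  have near: "near x = z" if "z \<in> Z" "x \<in> mball z R" for x z
    unfolding near_def using that uniq by blast
  define Q where "Q = J - (\<Union>z\<in>Z. mball z R)"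
  have in_ball: "z \<in> mball z R" if "z \<in> Z" for z using that Z_in_M R by auto
  have Q_sub: "Q \<subseteq> J - Z" using in_ball unfolding Q_def by blast
  have "\<exists>c>0. \<forall>y\<in>Q. \<exists>l. scales T y c l"
  proof (rule compact_uniform)
    show "compactin mtopology Q" unfolding Q_def by (rule compact_away)
    show "\<exists>r>0. \<exists>c>0. \<forall>y\<in>Q \<inter> mball x r. \<exists>l. scales T y c l" if x: "x \<in> Q" for x
    proof -
      obtain r l where rl: "scales T x r l" using scales_away x Q_sub by blast
      have "scales T y r l" if "y \<in> mball x r" for y
        using scales_sub[OF rl that] scales_pos[OF rl] by blast
      thus ?thesis using scales_pos(1)[OF rl] by blast
    qed
    show "\<exists>l. scales T y c' l" if c: "\<exists>l. scales T y c l" "0 < c'" "c' \<le> c" for y c c'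
    proof -
      obtain l where l: "scales T y c l" using c(1) by blast
      have "y \<in> mball y c" using l by (auto simp: scales_def)
      thus ?thesis using scales_sub[OF l _ c(2,3)] by blast
    qed
  qed
  then obtain r1 where r1: "r1 > 0" "\<And>y. y \<in> Q \<Longrightarrow> \<exists>l. scales T y r1 l" by blast
  \<comment> \<open>The bound \<open>r1\<close> gives similarity, and the bound \<open>R\<close>
    keeps balls about points of \<open>Q\<close> disjoint from the \<open>R\<close>-balls about
    \<open>Z\<close>.\<close>
  define g0 where "g0 = min r1 R"
  have g0: "g0 > 0" "g0 \<le> r1" "g0 \<le> R" using r1 R by (auto simp: g0_def)
  define g where "g x = (if \<exists>z\<in>Z. x \<in> mball z R then eps (near x) * d (near x) x else g0)" for x
  have g_near: "g x = eps z * d z x" if "z \<in> Z" "x \<in> mball z R" for x z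
    using that near[OF that] by (auto simp: g_def)
  have g_far: "g x = g0" if "x \<in> Q" for x using that by (auto simp: g_def Q_def)
  have cases: thesis if x: "x \<in> J - Z"
    and "\<And>z. z \<in> Z \<Longrightarrow> x \<in> mball z R \<Longrightarrow> x \<noteq> z \<Longrightarrow> thesis" "x \<in> Q \<Longrightarrow> thesis" for x thesis
    using that by (auto simp: Q_def)
  have g_pos: "g x > 0" "g x \<le> R" if x: "x \<in> J - Z" for x
  proof -
    have "g x > 0 \<and> g x \<le> R"
    proof (rule cases[OF x])
      fix z assume z: "z \<in> Z" "x \<in> mball z R" "x \<noteq> z"
      hence "d z x > 0" "d z x \<le> R" by auto
      moreover from this have "eps z * d z x \<le> 1 * d z x" using eps by (intro mult_right_mono) auto
      ultimately have "eps z * d z x \<le> R" by linarith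
      thus ?thesis using g_near[OF z(1,2)] eps(1)[of z] \<open>d z x > 0\<close> by simp
    next
      assume "x \<in> Q" thus ?thesis using g_far g0 by auto
    qed
    thus "g x > 0" "g x \<le> R" by auto
  qed
  have g_scales: "scales T x (g x) (lam x)" if x: "x \<in> J - Z" for x
  proof -
    have xM: "x \<in> M" using x J_sub by auto
    have "\<exists>l. scales T x (g x) l"
    proof (rule cases[OF x])
      fix z assume z: "z \<in> Z" "x \<in> mball z R" "x \<noteq> z"
      then obtain l where l: "scales T x (e * d z x) l" using form by blast
      have "x \<in> mball x (e * d z x)" using scales_pos(1)[OF l] xM by simp
      moreover have "g x \<le> e * d z x"
        unfolding g_near[OF z(1,2)] using eps(2)[of z] by (intro mult_right_mono) auto
      ultimately show ?thesis using scales_sub[OF l] g_pos(1)[OF x] by blast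
    next
      assume xQ: "x \<in> Q"
      then obtain l where l: "scales T x r1 l" using r1 by blast
      have "x \<in> mball x r1" using r1 xM by simp
      thus ?thesis using scales_sub[OF l] g0 g_far[OF xQ] by metis
    qed
    thus ?thesis using lam_eq by metis
  qed
  have g_const: "y \<notin> Z \<and> g y = g x" if x: "x \<in> J - Z" and y: "y \<in> mball x (g x)" for x y
  proof (rule cases[OF x])
    fix z assume z: "z \<in> Z" "x \<in> mball z R" "x \<noteq> z"
    have M: "x \<in> M" "y \<in> M" "z \<in> M" using y z by auto
    have "g x \<le> 1 * d z x" unfolding g_near[OF z(1,2)] using eps(3)[of z] by (intro mult_right_mono) auto
    \<comment> \<open>The triangle \<open>x\<close>, \<open>y\<close>, \<open>z\<close> is
      isosceles, so \<open>y\<close> has the same distance to \<open>z\<close> and thus the same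
      scale.\<close>
    hence "d x y < d z x" using y by auto
    hence eq: "d z y = d z x" using dist_eq M by blast
    hence yR: "y \<in> mball z R" using z M by auto
    have "y \<noteq> z" using eq z M by auto
    hence "y \<notin> Z" using uniq[OF z(1) _ yR] in_ball by blast
    thus ?thesis using g_near[OF z(1) yR] g_near[OF z(1,2)] eq by simp
  next
    assume xQ: "x \<in> Q"
    have yg: "y \<in> mball x R" using y g_far[OF xQ] g0 by auto
    have "y \<notin> mball z R" if "z \<in> Z" for z
    proof
      assume "y \<in> mball z R"
      hence "mball x R = mball z R" using mball_eq[OF yg] mball_eq[of y z R] by simp
      moreover have "x \<in> mball x R" using yg R by auto
      ultimately show False using xQ that by (auto simp: Q_def)
    qed
    thus ?thesis using in_ball g_far[OF xQ] unfolding g_def by auto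
  qed
  \<comment> \<open>The formula for \<open>g\<close> near \<open>Z\<close> must apply at
    \<open>T x\<close> as well, with \<open>T z\<close> as the near point; this forces the smaller
    radius \<open>R'\<close> for \<open>x\<close>.\<close>
  have "\<exists>s>0. \<forall>x\<in>mball z s. T x \<in> mball (T z) R" if z: "z \<in> Z" for z
  proof -
    have zM: "z \<in> M" using z Z_in_M by blast
    obtain s where "s > 0" "\<And>x. x \<in> M \<and> d z x < s \<Longrightarrow> d (T z) (T x) < R"
      using metric_continuous_map[OF Metric_space_axioms, THEN iffD1, OF continuous_T,
          THEN conjunct2, rule_format, OF zM R] by blast
    thus ?thesis using zM maps_to by (intro exI[of _ s]) auto
  qed
  then obtain s where s: "\<And>z. z \<in> Z \<Longrightarrow> s z > 0"
    "\<And>z x. z \<in> Z \<Longrightarrow> x \<in> mball z (s z) \<Longrightarrow> T x \<in> mball (T z) R" by metis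
  define R' where "R' = Min ({R} \<union> s ` Z)"
  have fin: "finite ({R} \<union> s ` Z)" using finite_Z by simp
  have R': "R' > 0" "R' \<le> R" "\<And>z. z \<in> Z \<Longrightarrow> R' \<le> s z"
  proof -
    show "R' > 0" unfolding R'_def using R s(1) by (subst Min_gr_iff[OF fin]) auto
    show "R' \<le> R" unfolding R'_def by (intro Min_le[OF fin]) simp
    show "R' \<le> s z" if "z \<in> Z" for z
      unfolding R'_def using that by (intro Min_le[OF fin]) simp
  qed
  have g_T: "g (T x) \<le> lam x * g x" if z: "z \<in> Z" and x: "x \<in> mball z R'" "x \<noteq> z" for x z
  proof -
    have xR: "x \<in> mball z R" "x \<in> mball z (s z)" using x R' z by (auto intro: less_le_trans)
    obtain l where l: "scales T x (e * d z x) l" "(if z \<in> C then th else 1) * d (T z) (T x) \<le> l * d z x"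
      using form[OF z xR(1) x(2)] by blast
    have TxR: "T x \<in> mball (T z) R" using s(2)[OF z xR(2)] .
    have "g (T x) = eps (T z) * d (T z) (T x)" using g_near[OF Z_image[OF z] TxR] .
    also have "\<dots> \<le> (if z \<in> C then th else 1) * eps z * d (T z) (T x)"
      using eps_T[OF z] by (intro mult_right_mono) auto
    also have "\<dots> = eps z * ((if z \<in> C then th else 1) * d (T z) (T x))" by simp
    also have "\<dots> \<le> eps z * (l * d z x)" using l(2) eps(1)[of z] by (intro mult_left_mono) auto
    also have "\<dots> = lam x * g x" using lam_eq[OF l(1)] g_near[OF z xR(1)] by simp
    finally show ?thesis .
  qed
  define Q' where "Q' = J - (\<Union>z\<in>Z. mball z R')"
  have Q'_sub: "Q' \<subseteq> J - Z" using R'(1) Z_in_M by (auto simp: Q'_def)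
  have "\<exists>a>0. \<forall>y\<in>Q'. a \<le> lam y"
  proof (rule compact_uniform)
    show "compactin mtopology Q'" unfolding Q'_def by (rule compact_away)
    show "\<exists>r>0. \<exists>c>0. \<forall>y\<in>Q' \<inter> mball x r. c \<le> lam y" if x: "x \<in> Q'" for x
    proof -
      obtain r l where rl: "scales T x r l" using scales_away x Q'_sub by blast
      show ?thesis using lam_ball[OF rl] scales_pos[OF rl] by (metis Int_iff order_refl)
    qed
  qed auto
  then obtain a where a: "a > 0" "\<And>y. y \<in> Q' \<Longrightarrow> a \<le> lam y" by blast
  define b where "b = min g0 (e * th ^ K * R')"
  have b: "b > 0" using g0 e th R' by (simp add: b_def)
  have g_low: "b \<le> g x" if x: "x \<in> Q'" for x
  proof -
    have "x \<in> J - Z" using x Q'_sub by blast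
    thus ?thesis
    proof (rule cases)
      fix z assume z: "z \<in> Z" "x \<in> mball z R" "x \<noteq> z"
      have "R' \<le> d z x" using x z by (force simp: Q'_def)
      hence "e * th ^ K * R' \<le> eps z * d z x"
        using eps(4)[of z] eps(1)[of z] R' by (intro mult_mono) auto
      thus ?thesis using g_near[OF z(1,2)] by (simp add: b_def)
    qed (simp add: b_def g_far)
  qed
  \<comment> \<open>Off the \<open>R'\<close>-balls one has \<open>lam x * g x \<ge> a * b\<close>,
    while \<open>g (T x) \<le> R\<close>. The minimum with \<open>1\<close> covers the points near
    \<open>Z\<close>, where nothing is lost.\<close>
  define c where "c = min 1 (a * b / R)"
  have c: "c > 0" "c \<le> 1" "c * R \<le> a * b"
  proof -
    have "c * R \<le> (a * b / R) * R" using R by (intro mult_right_mono) (auto simp: c_def)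
    thus "c * R \<le> a * b" using R by simp
  qed (use a b R in \<open>auto simp: c_def\<close>)
  have g_T': "c * g (T x) \<le> lam x * g x" if x: "x \<in> J - Z" "T x \<notin> Z" for x
  proof (cases "x \<in> Q'")
    case True
    have Tx: "T x \<in> J - Z" using x J_image by auto
    have "c * g (T x) \<le> c * R" using c g_pos(2)[OF Tx] by simp
    also have "\<dots> \<le> a * b" by (rule c(3))
    also have "\<dots> \<le> lam x * g x"
      using a b g_low[OF True] a(2)[OF True] by (intro mult_mono) auto
    finally show ?thesis .
  next
    case False
    then obtain z where z: "z \<in> Z" "x \<in> mball z R'" using x by (auto simp: Q'_def)
    have Tx: "T x \<in> J - Z" using x J_image by auto
    have "c * g (T x) \<le> 1 * g (T x)" using c g_pos(1)[OF Tx] by (intro mult_right_mono) auto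
    also have "1 * g (T x) \<le> lam x * g x" using g_T[OF z] z(1) x(1) by auto
    finally show ?thesis .
  qed
  have g_le: "g y \<le> d z y" if z: "z \<in> Z" and y: "y \<in> mball z R'" "y \<noteq> z" for y z
  proof -
    have "y \<in> mball z R" using y R' by auto
    hence "g y = eps z * d z y" using g_near z by blast
    also have "\<dots> \<le> 1 * d z y" using eps(3)[of z] by (intro mult_right_mono) auto
    finally show ?thesis by simp
  qed
  have "scale_function g R"
    unfolding scale_function_def using g_pos g_scales g_const by blast
  moreover have "\<forall>z\<in>Z. \<forall>x\<in>J \<inter> mball z R'. x \<noteq> z \<longrightarrow> g (T x) \<le> lam x * g x"
    using g_T by blast
  moreover have "\<forall>x\<in>J - Z. T x \<notin> Z \<longrightarrow> c * g (T x) \<le> lam x * g x"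
    using g_T' by blast
  moreover have "\<forall>z\<in>Z. \<forall>y\<in>mball z R'. y \<noteq> z \<longrightarrow> g y \<le> d z y"
    using g_le by blast
  ultimately show ?thesis using R'(1) c(1,2) by blast
qed

lemma scales_along:
  assumes "x \<in> J" "(T ^^ n) x \<notin> Z" "i \<le> n"
  shows "(T ^^ i) x \<in> J - Z"
proof -
  have "(T ^^ n) x = (T ^^ (n - i)) ((T ^^ i) x)"
    using assms(3) by (metis comp_apply funpow_add le_add_diff_inverse2)
  thus ?thesis using assms Z_iter J_iter by auto
qed

lemma iterate_near:
  assumes x: "x \<in> M" and sc: "\<And>i. i < k \<Longrightarrow> \<exists>r l. scales T ((T ^^ i) x) r l" and b: "b > 0"
  obtains r where "r > 0" "\<And>y. y \<in> mball x r \<Longrightarrow> lamn k y = lamn k x \<and>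
    d ((T ^^ k) x) ((T ^^ k) y) = lamn k x * d x y \<and> (T ^^ k) y \<in> mball ((T ^^ k) x) b"
proof -
  obtain s where s: "scales (T ^^ k) x s (lamn k x)" "\<forall>y\<in>mball x s. lamn k y = lamn k x"
    using scales_iter[OF x sc] by blast
  have l: "lamn k x > 0" "s > 0" using scales_pos[OF s(1)] by auto
  define r where "r = min s (b / lamn k x)"
  have r: "r > 0" "r \<le> s" "r \<le> b / lamn k x" using l b by (simp_all add: r_def)
  show thesis
  proof (rule that[OF r(1)])
    fix y assume y: "y \<in> mball x r"
    hence ys: "y \<in> mball x s" using r(2) by auto
    have dy: "d ((T ^^ k) x) ((T ^^ k) y) = lamn k x * d x y"
      using scales_dist[OF s(1) _ ys, of x] x l(2) by simp
    have "lamn k x * d x y < lamn k x * (b / lamn k x)"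
      using y r(3) l by (intro mult_strict_left_mono) auto
    hence "d ((T ^^ k) x) ((T ^^ k) y) < b" using dy l by simp
    moreover have "(T ^^ k) x \<in> M" "(T ^^ k) y \<in> M" using x y iter_in by auto
    moreover have "lamn k y = lamn k x" using s(2) ys by blast
    ultimately show "lamn k y = lamn k x \<and> d ((T ^^ k) x) ((T ^^ k) y) = lamn k x * d x y \<and>
        (T ^^ k) y \<in> mball ((T ^^ k) x) b"
      using dy by simp
  qed
qed

text \<open>From every point of \<open>J - Z\<close> no scale is lost at some time \<open>k\<close>
  between \<open>1\<close> and a uniform \<open>N\<close>, unless the orbit is in \<open>Z\<close>
  at that time. Cutting an orbit segment at such times leaves a final piece of fewer than
  \<open>N\<close> steps (or none), and only this piece costs a factor.\<close>

lemma expansion_bound: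
  "\<exists>g G c. scale_function g G \<and> c > 0 \<and> c \<le> 1 \<and>
     (\<forall>x\<in>J. \<forall>n. (T ^^ n) x \<notin> Z \<longrightarrow> c * g ((T ^^ n) x) \<le> lamn n x * g x)"
proof -
  from base_scale obtain g G R c where *: "scale_function g G" and R: "R > 0" and c: "c > 0" "c \<le> 1"
    and near: "\<forall>z\<in>Z. \<forall>x\<in>J \<inter> mball z R. x \<noteq> z \<longrightarrow> g (T x) \<le> lam x * g x"
    and step: "\<forall>x\<in>J - Z. T x \<notin> Z \<longrightarrow> c * g (T x) \<le> lam x * g x"
    and g_le: "\<forall>z\<in>Z. \<forall>y\<in>mball z R. y \<noteq> z \<longrightarrow> g y \<le> d z y"
    by (elim exE conjE) (rule that)
  note g = scale_functionD[OF *]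
  have lam_pos: "lam x > 0" if "x \<in> J - Z" for x using g(3)[OF that] by (rule scales_pos(2))
  define Q where "Q = J - (\<Union>z\<in>Z. mball z R)"
  have Q_sub: "Q \<subseteq> J - Z" using R Z_in_M by (auto simp: Q_def)
  \<comment> \<open>Bounding the time \<open>k\<close> by \<open>1 / a\<close> turns an upper bound
    for times into a lower bound for constants, the form in which \<open>compact_uniform\<close>
    applies.\<close>
  define P where "P y a \<longleftrightarrow> (\<exists>k\<ge>1. real k \<le> 1 / a \<and>
    ((T ^^ k) y \<notin> Z \<longrightarrow> g ((T ^^ k) y) \<le> lamn k y * g y))" for y and a :: real
  have "\<exists>a>0. \<forall>y\<in>Q. P y a"
  proof (rule compact_uniform)
    show "compactin mtopology Q" unfolding Q_def by (rule compact_away)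
    show "P y b" if "P y a" "0 < b" "b \<le> a" for y a b
    proof -
      have "1 / a \<le> 1 / b" using that(2,3) by (simp add: frac_le)
      thus ?thesis using that(1) unfolding P_def by (meson order_trans)
    qed
    fix x assume "x \<in> Q"
    hence x: "x \<in> J - Z" "x \<in> M" using Q_sub J_sub by auto
    have PI: "P y (1 / real k)" if "k \<ge> 1" "(T ^^ k) y \<notin> Z \<Longrightarrow> g ((T ^^ k) y) \<le> lamn k y * g y" for y k
      unfolding P_def using that by (intro exI[of _ k]) auto
    have "\<exists>k\<ge>1. \<exists>r>0. \<forall>y\<in>J \<inter> mball x r. (T ^^ k) y \<notin> Z \<longrightarrow> g ((T ^^ k) y) \<le> lamn k y * g y"
    proof (cases "\<exists>n. (T ^^ n) x \<in> Z")
      case True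
      \<comment> \<open>At the first entrance into \<open>Z\<close>, a nearby point \<open>y\<close>
        lands at distance \<open>lamn k x * d x y\<close> from \<open>z\<close>. This distance
        bounds \<open>g\<close> there, and \<open>d x y < g x = g y\<close>.\<close>
      define k where "k = (LEAST n. (T ^^ n) x \<in> Z)"
      define z where "z = (T ^^ k) x"
      have z: "z \<in> Z" unfolding k_def z_def using True by (rule LeastI_ex)
      have k: "k \<ge> 1" using z x unfolding z_def by (cases k) auto
      have "(T ^^ i) x \<in> J - Z" if "i < k" for i
        using not_less_Least[of i "\<lambda>n. (T ^^ n) x \<in> Z"] that J_iter x by (auto simp: k_def)
      hence *: "\<exists>r l. scales T ((T ^^ i) x) r l" if "i < k" for i using g(3) that by blast
      then obtain r where r: "r > 0" "\<And>y. y \<in> mball x r \<Longrightarrow> lamn k y = lamn k x \<and>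
          d z ((T ^^ k) y) = lamn k x * d x y \<and> (T ^^ k) y \<in> mball z R"
        using iterate_near[OF x(2) _ R, of k] unfolding z_def by metis
      have lx: "lamn k x \<ge> 0" using r by (intro less_imp_le lamn_pos *) simp
      have "g ((T ^^ k) y) \<le> lamn k y * g y"
        if y: "y \<in> J" "y \<in> mball x (min r (g x))" "(T ^^ k) y \<notin> Z" for y
      proof -
        have yr: "y \<in> mball x r" "y \<in> mball x (g x)" using y(2) by auto
        have "g ((T ^^ k) y) \<le> lamn k x * d x y" using g_le[rule_format, OF z] r(2)[OF yr(1)] y(3) z by metis
        also have "\<dots> \<le> lamn k x * g x" using lx yr(2) by (intro mult_left_mono) auto
        finally show ?thesis using r(2)[OF yr(1)] g(4)[OF x(1) y(1) yr(2)] by simp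
      qed
      moreover have "min r (g x) > 0" using r(1) g(1)[OF x(1)] by simp
      ultimately show ?thesis using k by blast
    next
      case False
      \<comment> \<open>If this failed for every \<open>k\<close>, the ball of radius
        \<open>g x\<close> would never outgrow the scale and \<open>x\<close> would be a Fatou
        point. Local constancy of \<open>g\<close> and \<open>lamn\<close> then carries the same
        \<open>k\<close> to nearby points.\<close>
      have "\<exists>k\<ge>1. g ((T ^^ k) x) \<le> lamn k x * g x"
      proof (rule ccontr)
        assume contra: "\<not> ?thesis"
        have in_JZ: "(T ^^ n) x \<in> J - Z" for n using False J_iter x by auto
        have "x \<in> fatou T"
        proof (rule bounded_scaling_fatou[where b = "g x" and r = "\<lambda>n. g ((T ^^ n) x)" and G = G])
          show "lamn n x * g x \<le> g ((T ^^ n) x)" for n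
          proof (cases "n \<ge> 1")
            case True
            thus ?thesis using contra by (meson less_imp_le not_le)
          next
            case False
            thus ?thesis by (simp add: not_le)
          qed
          show "x \<in> M" "g x > 0" using x g(1) by blast+
          show "scales T ((T ^^ n) x) (g ((T ^^ n) x)) (lam ((T ^^ n) x))" "g ((T ^^ n) x) \<le> G" for n
            using g(2,3)[OF in_JZ] by blast+
        qed
        thus False using x by (simp add: J_def)
      qed
      then obtain k where k: "k \<ge> 1" "g ((T ^^ k) x) \<le> lamn k x * g x" by blast
      have in_JZ: "(T ^^ n) x \<in> J - Z" for n using False J_iter x by auto
      have "\<exists>r l. scales T ((T ^^ i) x) r l" for i using g(3) in_JZ by blast
      moreover have "g ((T ^^ k) x) > 0" using g(1) in_JZ by blast
      ultimately obtain r where r: "r > 0" "\<And>y. y \<in> mball x r \<Longrightarrow> lamn k y = lamn k x \<and>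
          d ((T ^^ k) x) ((T ^^ k) y) = lamn k x * d x y \<and> (T ^^ k) y \<in> mball ((T ^^ k) x) (g ((T ^^ k) x))"
        using iterate_near[OF x(2), of k] by metis
      have "g ((T ^^ k) y) \<le> lamn k y * g y" if y: "y \<in> J" "y \<in> mball x (min r (g x))" for y
      proof -
        have yr: "y \<in> mball x r" "y \<in> mball x (g x)" using y(2) by auto
        have "g ((T ^^ k) y) = g ((T ^^ k) x)" using g(4) in_JZ J_iter y(1) r(2)[OF yr(1)] by blast
        thus ?thesis using k(2) r(2)[OF yr(1)] g(4)[OF x(1) y(1) yr(2)] by simp
      qed
      moreover have "min r (g x) > 0" using r(1) g(1)[OF x(1)] by simp
      ultimately show ?thesis using k(1) by blast
    qed
    then obtain k r where kr: "k \<ge> 1" "r > 0"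
      "\<And>y. y \<in> J \<inter> mball x r \<Longrightarrow> (T ^^ k) y \<notin> Z \<Longrightarrow> g ((T ^^ k) y) \<le> lamn k y * g y" by metis
    have "\<forall>y\<in>Q \<inter> mball x r. P y (1 / real k)" using PI kr Q_sub by blast
    moreover have "1 / real k > 0" using kr(1) by simp
    ultimately show "\<exists>r>0. \<exists>a>0. \<forall>y\<in>Q \<inter> mball x r. P y a" using kr(2) by blast
  qed
  then obtain a where a: "a > 0" "\<And>y. y \<in> Q \<Longrightarrow> P y a" by blast
  define N where "N = nat \<lceil>1 / a\<rceil>"
  have N: "\<exists>k\<ge>1. k \<le> N \<and> ((T ^^ k) y \<notin> Z \<longrightarrow> g ((T ^^ k) y) \<le> lamn k y * g y)" if "y \<in> Q" for y
  proof -
    obtain k where k: "k \<ge> 1" "real k \<le> 1 / a"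
      "(T ^^ k) y \<notin> Z \<longrightarrow> g ((T ^^ k) y) \<le> lamn k y * g y"
      using a(2)[OF \<open>y \<in> Q\<close>] unfolding P_def by blast
    have "k \<le> N" using k(2) unfolding N_def by linarith
    thus ?thesis using k by blast
  qed
  have lamn_nonneg: "lamn n x \<ge> 0" if "x \<in> J" "(T ^^ n) x \<notin> Z" for n x
  proof -
    have "lam ((T ^^ i) x) > 0" if "i < n" for i
      using lam_pos scales_along[OF \<open>x \<in> J\<close> \<open>(T ^^ n) x \<notin> Z\<close>, of i] that by simp
    thus ?thesis unfolding lamn_def by (intro prod_nonneg) (auto intro: less_imp_le)
  qed
  have cn: "c ^ n * g ((T ^^ n) x) \<le> lamn n x * g x" if "x \<in> J" "(T ^^ n) x \<notin> Z" for n x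
    using that
  proof (induction n arbitrary: x)
    case (Suc n)
    have x: "x \<in> J - Z" "T x \<in> J - Z"
      using scales_along[OF Suc.prems, of 0] scales_along[OF Suc.prems, of 1] by auto
    have Tn: "(T ^^ n) (T x) \<notin> Z" using Suc.prems by (simp add: funpow_swap1)
    have "c ^ Suc n * g ((T ^^ Suc n) x) = c * (c ^ n * g ((T ^^ n) (T x)))" by (simp add: funpow_swap1)
    also have "\<dots> \<le> c * (lamn n (T x) * g (T x))"
      using Suc.IH[of "T x"] x Tn c by (intro mult_left_mono) auto
    also have "\<dots> = lamn n (T x) * (c * g (T x))" by simp
    also have "\<dots> \<le> lamn n (T x) * (lam x * g x)"
      using step[rule_format, of x] x lamn_nonneg[of "T x" n] Tn by (intro mult_left_mono) auto
    also have "\<dots> = lamn (Suc n) x * g x" by (simp add: lamn_Suc_left)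
    finally show ?case .
  qed simp
  have cN: "c ^ N * g ((T ^^ n) x) \<le> lamn n x * g x" if "x \<in> J" "(T ^^ n) x \<notin> Z" for n x
    using that
  proof (induction n arbitrary: x rule: less_induct)
    case (less n)
    have x: "x \<in> J - Z" "(T ^^ n) x \<in> J - Z"
      using scales_along[OF less.prems, of 0] scales_along[OF less.prems, of n] by auto
    have gn: "g ((T ^^ n) x) > 0" using g(1) x(2) by blast
    \<comment> \<open>Near \<open>Z\<close> the time \<open>k = 1\<close> works; on \<open>Q\<close>
      there is a time \<open>k \<le> N\<close>, and if it exceeds \<open>n\<close> then
      \<open>n < N\<close>.\<close>
    have "n < N \<or> n = 0 \<or> (\<exists>k\<ge>1. k \<le> n \<and> g ((T ^^ k) x) \<le> lamn k x * g x)"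
    proof (cases "x \<in> Q")
      case True
      then obtain k where "k \<ge> 1" "k \<le> N" "(T ^^ k) x \<notin> Z \<longrightarrow> g ((T ^^ k) x) \<le> lamn k x * g x"
        using N by blast
      thus ?thesis using scales_along[OF less.prems, of k] by (meson DiffD2 le_less_trans not_le)
    next
      case False
      then obtain z where z: "z \<in> Z" "x \<in> mball z R" using x by (auto simp: Q_def)
      have "x \<in> J \<inter> mball z R" "x \<noteq> z" using z x(1) by blast+
      hence "g (T x) \<le> lam x * g x" using near z(1) by blast
      hence T1: "g ((T ^^ 1) x) \<le> lamn 1 x * g x" by (simp add: lamn_def)
      show ?thesis
      proof (cases "n = 0")
        case False
        hence "1 \<le> n" by simp
        thus ?thesis using T1 by blast
      qed simp
    qed
    then consider "n < N \<or> n = 0" | k where "k \<ge> 1" "k \<le> n" "g ((T ^^ k) x) \<le> lamn k x * g x" by blast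
    thus ?case
    proof cases
      case 1
      hence "c ^ N \<le> c ^ n" using c by (intro power_decreasing) auto
      hence "c ^ N * g ((T ^^ n) x) \<le> c ^ n * g ((T ^^ n) x)" using gn by (intro mult_right_mono) auto
      thus ?thesis using cn[OF less.prems] by linarith
    next
      case 2
      define y where "y = (T ^^ k) x"
      have y: "y \<in> J" unfolding y_def using J_iter less.prems by blast
      have n: "(T ^^ n) x = (T ^^ (n - k)) y"
        unfolding y_def using 2(2) by (metis add.commute comp_apply funpow_add le_add_diff_inverse)
      have "c ^ N * g ((T ^^ n) x) \<le> lamn (n - k) y * g y"
        unfolding n using less.IH[of "n - k" y] 2(1,2) y less.prems(2) n by simp
      also have "\<dots> \<le> lamn (n - k) y * (lamn k x * g x)"
        using 2(3) lamn_nonneg[OF y] less.prems(2) n by (intro mult_left_mono) (auto simp: y_def)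
      also have "\<dots> = lamn n x * g x"
        using lamn_add[of k "n - k" x] 2(2) by (simp add: y_def)
      finally show ?thesis .
    qed
  qed
  have "c ^ N > 0" "c ^ N \<le> 1" using c by (auto intro: power_le_one)
  moreover have "\<forall>x\<in>J. \<forall>n. (T ^^ n) x \<notin> Z \<longrightarrow> c ^ N * g ((T ^^ n) x) \<le> lamn n x * g x"
    using cN by blast
  ultimately show ?thesis using * by blast
qed

section \<open>The Markov partition\<close>

text \<open>
  The balls of radius \<open>c * g\<close> about \<open>(T ^^ n) x\<close> are pulled back to \<open>x\<close> and \<open>\<delta> x\<close> is the supremum
  of the resulting radii. Since the orbit of \<open>T x\<close> is part of that of \<open>x\<close>, the inequality
  \<open>\<delta> (T x) \<le> lam x * \<delta> x\<close>, which is the Markov property of the balls of radius \<open>\<delta>\<close>, is automatic.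
\<close>

lemma partition_scale:
  "\<exists>\<delta> G. scale_function \<delta> G \<and> (\<forall>x\<in>J - Z. T x \<notin> Z \<longrightarrow> \<delta> (T x) \<le> lam x * \<delta> x)"
proof -
  from expansion_bound obtain g G c where g: "scale_function g G" and c: "c > 0" "c \<le> 1"
    and bound: "\<forall>x\<in>J. \<forall>n. (T ^^ n) x \<notin> Z \<longrightarrow> c * g ((T ^^ n) x) \<le> lamn n x * g x"
    by (elim exE conjE) (rule that)
  note g = scale_functionD[OF g]
  define rad where "rad n x = c * g ((T ^^ n) x) / lamn n x" for n x
  have lp: "lam x > 0" if "x \<in> J - Z" for x using g(3)[OF that] by (rule scales_pos(2))
  have lnp: "lamn n x > 0" if "x \<in> J" "(T ^^ n) x \<notin> Z" for n x
  proof -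
    have "\<exists>r l. scales T ((T ^^ i) x) r l" if "i < n" for i
      using g(3)[OF scales_along[OF \<open>x \<in> J\<close> \<open>(T ^^ n) x \<notin> Z\<close>, of i]] that by auto
    thus ?thesis by (rule lamn_pos)
  qed
  \<comment> \<open>The bound by \<open>g x\<close>, uniform in \<open>n\<close>, is
    \<open>expansion_bound\<close> rewritten; it keeps the supremum finite and all pulled-back balls
    inside the ball where \<open>T\<close> is a similarity.\<close>
  have rad_pos: "rad n x > 0" and rad_le: "rad n x \<le> g x" if "x \<in> J" "(T ^^ n) x \<notin> Z" for n x
  proof -
    have "g ((T ^^ n) x) > 0" using g(1) scales_along[OF that, of n] by simp
    thus "rad n x > 0" unfolding rad_def using c(1) lnp[OF that] by simp
    have "c * g ((T ^^ n) x) \<le> lamn n x * g x" using bound that by blast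
    thus "rad n x \<le> g x" unfolding rad_def using lnp[OF that] by (simp add: field_simps)
  qed
  have rad_Suc: "rad n (T x) = lam x * rad (Suc n) x" if "x \<in> J - Z" for n x
    using lp[OF that] by (simp add: rad_def lamn_Suc_left funpow_swap1)
  \<comment> \<open>\<open>T\<close> sends the ball of radius \<open>rad (Suc n) x\<close> to the
    ball of radius \<open>rad n (T x)\<close>, so constancy of the radii is inherited along the
    orbit.\<close>
  have const: "(T ^^ n) y \<notin> Z \<and> rad n y = rad n x"
    if "x \<in> J" "(T ^^ n) x \<notin> Z" "y \<in> J" "y \<in> mball x (rad n x)" for n x y
    using that
  proof (induction n arbitrary: x y)
    case 0
    have "y \<in> mball x (g x)" using 0 rad_le[of x 0] by auto
    thus ?case using g(4)[of x y] 0 by (simp add: rad_def)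
  next
    case (Suc n)
    have x: "x \<in> J - Z" "T x \<in> J - Z"
      using scales_along[OF Suc.prems(1,2), of 0] scales_along[OF Suc.prems(1,2), of 1] by auto
    have yg: "y \<in> mball x (g x)" using Suc.prems(4) rad_le[OF Suc.prems(1,2)] by auto
    have xg: "x \<in> mball x (g x)" using yg g(1)[OF x(1)] by auto
    have ly: "lam y = lam x" using lam_ball[OF g(3)[OF x(1)] yg] .
    have yZ: "y \<in> J - Z" using g(4)[OF x(1) Suc.prems(3) yg] Suc.prems(3) by blast
    have "d (T x) (T y) = lam x * d x y" using scales_dist[OF g(3)[OF x(1)] xg yg] .
    also have "\<dots> < lam x * rad (Suc n) x"
      using Suc.prems(4) lp[OF x(1)] by (intro mult_strict_left_mono) auto
    finally have "T y \<in> mball (T x) (rad n (T x))"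
      using rad_Suc[OF x(1)] Suc.prems J_sub maps_to by auto
    hence IH: "(T ^^ n) (T y) \<notin> Z \<and> rad n (T y) = rad n (T x)"
      using Suc.prems x J_image by (intro Suc.IH) (auto simp: funpow_swap1)
    have "lam x * rad (Suc n) y = lam x * rad (Suc n) x"
      using IH rad_Suc[OF x(1), of n] rad_Suc[OF yZ, of n] ly by simp
    thus ?case using IH lp[OF x(1)] by (simp add: funpow_swap1)
  qed
  define A where "A x = {n. (T ^^ n) x \<notin> Z}" for x
  define \<delta> where "\<delta> x = (SUP n\<in>A x. rad n x)" for x
  have bdd: "bdd_above ((\<lambda>n. rad n x) ` A x)" if "x \<in> J" for x
    using rad_le[OF that] by (intro bdd_aboveI[of _ "g x"]) (auto simp: A_def)
  have A0: "0 \<in> A x" if "x \<in> J - Z" for x using that by (simp add: A_def)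
  have upper: "rad n x \<le> \<delta> x" if "x \<in> J" "n \<in> A x" for n x
    unfolding \<delta>_def by (rule cSUP_upper[OF that(2) bdd[OF that(1)]])
  have least: "\<delta> x \<le> b" if "x \<in> J - Z" "\<And>n. n \<in> A x \<Longrightarrow> rad n x \<le> b" for x b
    unfolding \<delta>_def using A0[OF that(1)] that(2) by (intro cSUP_least) auto
  have \<delta>_le: "\<delta> x \<le> g x" if "x \<in> J - Z" for x
    using that rad_le by (intro least) (auto simp: A_def)
  have \<delta>_pos: "\<delta> x > 0" if "x \<in> J - Z" for x
    using upper[of x 0] rad_pos[of x 0] that A0[OF that] by simp
  have mono: "\<delta> x \<le> \<delta> y" if x: "x \<in> J - Z" and y: "y \<in> J" "y \<in> mball x (\<delta> x)" for x y
  proof -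
    \<comment> \<open>Some \<open>rad n x\<close> exceeds \<open>d x y\<close>. By
      \<open>const\<close>, it and all larger radii of \<open>x\<close> are also radii of
      \<open>y\<close>, and these alone determine the supremum at \<open>x\<close>.\<close>
    have "d x y < (SUP n\<in>A x. rad n x)" using y by (simp add: \<delta>_def)
    then obtain n where n: "n \<in> A x" "d x y < rad n x"
      using less_cSUP_iff[of "A x" "\<lambda>n. rad n x"] bdd[of x] A0[OF x] x by blast
    have *: "rad m x \<le> \<delta> y" if m: "m \<in> A x" "rad n x \<le> rad m x" for m
    proof -
      have "y \<in> mball x (rad m x)" using n m y by auto
      hence "(T ^^ m) y \<notin> Z \<and> rad m y = rad m x" using const[of x m y] x y m by (auto simp: A_def)
      thus ?thesis using upper[OF y(1), of m] by (simp add: A_def)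
    qed
    show ?thesis
    proof (rule least[OF x])
      fix m assume "m \<in> A x"
      thus "rad m x \<le> \<delta> y" using *[OF n(1)] *[of m] by linarith
    qed
  qed
  have \<delta>_const: "y \<notin> Z \<and> \<delta> y = \<delta> x" if x: "x \<in> J - Z" and y: "y \<in> J" "y \<in> mball x (\<delta> x)" for x y
  proof -
    have "y \<in> mball x (g x)" using y \<delta>_le[OF x] by auto
    hence yZ: "y \<notin> Z" using g(4)[OF x y(1)] by blast
    have "x \<in> mball y (\<delta> y)" using mono[OF x y] y by (auto simp: commute)
    hence "\<delta> y \<le> \<delta> x" using mono[of y x] x y yZ by blast
    thus ?thesis using mono[OF x y] yZ by simp
  qed
  have \<delta>_T: "\<delta> (T x) \<le> lam x * \<delta> x" if x: "x \<in> J - Z" "T x \<notin> Z" for x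
  proof (rule least)
    show "T x \<in> J - Z" using x J_image by blast
    fix n assume "n \<in> A (T x)"
    hence "Suc n \<in> A x" by (simp add: A_def funpow_swap1)
    hence "lam x * rad (Suc n) x \<le> lam x * \<delta> x"
      using upper[of x "Suc n"] x lp[of x] by (intro mult_left_mono) auto
    thus "rad n (T x) \<le> lam x * \<delta> x" using rad_Suc[OF x(1)] by simp
  qed
  have \<delta>_scales: "scales T x (\<delta> x) (lam x)" if x: "x \<in> J - Z" for x
    using scales_sub[OF g(3)[OF x] _ \<delta>_pos[OF x] \<delta>_le[OF x]] x J_sub g(1)[OF x] by auto
  have \<delta>_G: "\<delta> x \<le> G" if x: "x \<in> J - Z" for x using \<delta>_le[OF x] g(2)[OF x] by linarith
  have "scale_function \<delta> G"
    unfolding scale_function_def using \<delta>_pos \<delta>_G \<delta>_scales \<delta>_const by blast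
  thus ?thesis using \<delta>_T by blast
qed

text \<open>An infinite fibre would accumulate at one of its points \<open>x\<close>, but near
  \<open>x\<close> the local form makes \<open>d (T x) (T y)\<close> positive for
  \<open>y \<noteq> x\<close>.\<close>

lemma finite_fibre: "finite {x \<in> M. T x = w}"
proof (rule ccontr)
  let ?S = "{x \<in> M. T x = w}"
  assume inf: "infinite ?S"
  then obtain x0 where "x0 \<in> M" "T x0 = w" using not_finite_existsD by blast
  hence w: "w \<in> M" using maps_to by blast
  hence "closedin mtopology {w}" by (intro closedin_Hausdorff_sing_eq[THEN iffD2] Hausdorff_space_mtopology) simp
  hence "closedin mtopology ?S" using closedin_continuous_map_preimage[OF continuous_T, of "{w}"] by simp
  hence "compactin mtopology ?S" using closedin_compact_space[OF compact] by blast
  then obtain x where x: "x \<in> M" "T x = w" "x \<in> mtopology derived_set_of ?S"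
    using inf unfolding compactin_eq_Bolzano_Weierstrass by blast
  from local_form[OF x(1)] obtain r th where r: "r > 0"
    "\<And>y. y \<in> mball x r \<Longrightarrow> y \<noteq> x \<Longrightarrow> \<exists>s l. scales T y s l \<and> l * d x y = th * d (T x) (T y)" by metis
  have "\<exists>y\<in>?S. y \<noteq> x \<and> y \<in> mball x r"
    using x(3) r(1) unfolding metric_derived_set_of by blast
  then obtain y where y: "y \<noteq> x" "T y = w" "y \<in> mball x r" by blast
  then obtain s l where sl: "scales T y s l" "l * d x y = th * d (T x) (T y)" using r(2) by blast
  have "l * d x y = 0" using sl(2) x(2) y(2) w by simp
  thus False using scales_pos(2)[OF sl(1)] x(1) y by auto
qed

section \<open>Exceptional points and coding by itineraries\<close>

definition E :: "'a set" where "E = {x \<in> J. \<exists>n. (T ^^ n) x \<in> Z}"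

lemma countable_E: "countable E"
proof -
  have "countable {x \<in> M. (T ^^ n) x \<in> Z}" for n
  proof (induction n)
    case 0
    show ?case using finite_Z by (auto intro!: countable_finite)
  next
    case (Suc n)
    have "{x \<in> M. (T ^^ Suc n) x \<in> Z} \<subseteq> (\<Union>w\<in>{x \<in> M. (T ^^ n) x \<in> Z}. {x \<in> M. T x = w})"
      using maps_to by (auto simp: funpow_swap1)
    moreover have "countable \<dots>" using finite_fibre by (intro countable_UN Suc countable_finite)
    ultimately show ?case by (rule countable_subset)
  qed
  moreover have "E \<subseteq> (\<Union>n. {x \<in> M. (T ^^ n) x \<in> Z})" using J_sub by (auto simp: E_def)
  ultimately show ?thesis by (meson countable_UN countable_subset uncountable_def UNIV_I countableI_type)
qed

text \<open>Points sharing an itinerary forever coincide by expansion, and every admissible sequence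
  of pieces is realised by a nested intersection of closed sets. The point found there lies in
  \<open>J - E\<close> because the pieces contain no points of \<open>Z\<close>. On
  \<open>J - E\<close> finitely many symbols confine a point to a small ball, which gives continuity
  of the inverse.\<close>

theorem markov_coding:
  assumes I: "I \<subseteq> J - E"
  shows "\<exists>(S :: nat set) A h. zero_one_matrix S A \<and> bij_betw h J (markov_space S A) \<and>
    conjugate_via mtopology I T (markov_top S A) left_shift h"
proof -
  from partition_scale obtain \<delta> G where \<delta>: "scale_function \<delta> G"
    and \<delta>_T: "\<forall>x\<in>J - Z. T x \<notin> Z \<longrightarrow> \<delta> (T x) \<le> lam x * \<delta> x"
    by (elim exE conjE) (rule that)
  note \<delta> = scale_functionD[OF \<delta>]
  define B where "B x = mball x (\<delta> x)" for x
  define PP where "PP = B ` (J - Z)"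
  have self: "x \<in> B x" if "x \<in> J - Z" for x using that \<delta>(1) J_sub by (auto simp: B_def)
  have B_eq: "B y = B x" if "x \<in> J - Z" "y \<in> J" "y \<in> B x" for x y
    using \<delta>(4)[OF that(1,2)] that(3) mball_eq unfolding B_def by metis
  have B_Z: "y \<notin> Z" if "x \<in> J - Z" "y \<in> J" "y \<in> B x" for x y
    using \<delta>(4)[OF that(1,2)] that(3) unfolding B_def by blast
  have EJ: "(T ^^ n) x \<in> J - Z" if "x \<in> J - E" for x n
    using that J_iter by (auto simp: E_def)

  have "countable PP"
  proof -
    \<comment> \<open>Every piece contains a point of a sufficiently fine finite net of
      \<open>J\<close>, and that point determines the piece; so countably many net points account
      for all pieces.\<close>
    have "\<exists>K. finite K \<and> K \<subseteq> J \<and> J \<subseteq> (\<Union>x\<in>K. mball x (1 / Suc k))" for k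
      using compactin_imp_mtotally_bounded[OF compact_J] unfolding mtotally_bounded_def by simp
    then obtain F where F: "\<And>k. finite (F k)" "\<And>k. F k \<subseteq> J"
      "\<And>k. J \<subseteq> (\<Union>x\<in>F k. mball x (1 / Suc k))" by metis
    have "PP \<subseteq> B ` (\<Union>k. F k)"
    proof
      fix P assume "P \<in> PP"
      then obtain x where x: "x \<in> J - Z" "P = B x" by (auto simp: PP_def)
      obtain k where k: "1 / real (Suc k) < \<delta> x"
        using nat_approx_posE[OF \<delta>(1)[OF x(1)]] by blast
      obtain c where c: "c \<in> F k" "x \<in> mball c (1 / Suc k)" using F(3)[of k] x(1) by blast
      have "c \<in> B x" using c k by (auto simp: B_def commute)
      hence "B c = B x" using B_eq x(1) F(2) c(1) by blast
      thus "P \<in> B ` (\<Union>k. F k)" using x c by auto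
    qed
    thus ?thesis using F(1) by (meson countable_UN countable_finite countable_image countable_subset
          countableI_type)
  qed
  define code where "code x = to_nat_on PP (B x)" for x
  have code_eq: "B x = B y" if "x \<in> J - Z" "y \<in> J - Z" "code x = code y" for x y
    using that to_nat_on_inj[OF \<open>countable PP\<close>, of "B x" "B y"] unfolding code_def PP_def by blast
  define ecode where "ecode = to_nat_on E"
  have ecode_inj: "inj_on ecode E" unfolding ecode_def by (rule inj_on_to_nat_on[OF countable_E])

  txt \<open>Even symbols stand for the pieces of the partition, odd symbols for the points of \<open>E\<close>.\<close>
  define h where "h x = (if x \<in> E then (\<lambda>_. 2 * ecode x + 1) else (\<lambda>i. 2 * code ((T ^^ i) x)))" for x
  define S where "S = (\<lambda>x. 2 * code x) ` (J - Z) \<union> (\<lambda>x. 2 * ecode x + 1) ` E"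
  \<comment> \<open>One representative \<open>x\<close> suffices to allow a transition:
    \<open>T\<close> maps the piece of \<open>x\<close> onto a ball that contains the whole piece of
    \<open>T x\<close>, since \<open>\<delta> (T x) \<le> lam x * \<delta> x\<close>. An odd symbol
    is followed by itself only.\<close>
  define A :: "nat \<Rightarrow> nat \<Rightarrow> nat" where
    "A a b = (if odd a \<and> a = b \<or> (\<exists>x\<in>J - Z. T x \<notin> Z \<and> a = 2 * code x \<and> b = 2 * code (T x)) then 1 else 0)" for a b
  have h_E: "h x = (\<lambda>_. 2 * ecode x + 1)" if "x \<in> E" for x using that by (simp add: h_def)
  have h_nE: "h x i = 2 * code ((T ^^ i) x)" if "x \<in> J - E" for x i using that by (simp add: h_def)

  have pull: "\<exists>w\<in>J \<inter> B x. T w = y" if x: "x \<in> J - Z" "T x \<notin> Z" and y: "y \<in> J" "y \<in> B (T x)" for x y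
  proof -
    have "y \<in> mball (T x) (lam x * \<delta> x)" using y(2) bspec[OF \<delta>_T x(1)] x(2) by (auto simp: B_def)
    then obtain w where w: "w \<in> B x" "T w = y"
      using scales_image[OF \<delta>(3)[OF x(1)]] unfolding B_def by (metis imageE)
    thus ?thesis using J_preimage[OF \<delta>(3)[OF x(1)]] y(1) unfolding B_def by blast
  qed

  have separate: "\<exists>n. \<forall>y\<in>J - E. (\<forall>i\<le>n. B ((T ^^ i) y) = B ((T ^^ i) x)) \<longrightarrow> d x y < e"
    if x: "x \<in> J - E" and e: "e > 0" for x e
  proof -
    note JZ = EJ[OF x]
    have xM: "x \<in> M" using x J_sub by blast
    \<comment> \<open>Otherwise the ball of radius \<open>e\<close> about \<open>x\<close> would
      never outgrow the scale \<open>\<delta>\<close>, and \<open>x\<close> would be a Fatou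
      point.\<close>
    have "\<exists>n. lamn n x * e > \<delta> ((T ^^ n) x)"
    proof (rule ccontr)
      assume "\<not> ?thesis"
      hence "x \<in> fatou T"
        using \<delta>(2,3)[OF JZ] by (intro bounded_scaling_fatou[OF xM e, where r = "\<lambda>n. \<delta> ((T ^^ n) x)" and G = G])
          (auto simp: not_less)
      thus False using x by (simp add: J_def)
    qed
    then obtain n where n: "lamn n x * e > \<delta> ((T ^^ n) x)" by blast
    have lp: "lamn n x > 0" using \<delta>(3)[OF JZ] by (intro lamn_pos) blast
    have "d x y < e" if y: "y \<in> J - E" and same: "\<forall>i\<le>n. B ((T ^^ i) y) = B ((T ^^ i) x)" for y
    proof -
      have in_B: "(T ^^ i) y \<in> B ((T ^^ i) x)" if "i \<le> n" for i
        using self[OF EJ[OF y]] same that by blast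
      have "d ((T ^^ i) x) ((T ^^ i) y) = lamn i x * d x y" if "i \<le> n" for i
        using that
      proof (induction i)
        case (Suc i)
        have "d (T ((T ^^ i) x)) (T ((T ^^ i) y)) = lam ((T ^^ i) x) * d ((T ^^ i) x) ((T ^^ i) y)"
          using self[OF JZ, of i] in_B[of i] Suc.prems unfolding B_def by (intro scales_dist[OF \<delta>(3)[OF JZ]]) auto
        thus ?case using Suc by (simp add: lamn_Suc)
      qed simp
      hence "lamn n x * d x y < \<delta> ((T ^^ n) x)" using in_B[of n] by (auto simp: B_def)
      hence "lamn n x * d x y < lamn n x * e" using n by linarith
      thus ?thesis using lp by simp
    qed
    thus ?thesis by blast
  qed

  have "zero_one_matrix S A" by (auto simp: zero_one_matrix_def A_def)

  moreover have bij: "bij_betw h J (markov_space S A)"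
    unfolding bij_betw_def
  proof
    show "inj_on h J"
    proof (rule inj_onI)
      fix x y assume x: "x \<in> J" and y: "y \<in> J" and eq: "h x = h y"
      have odd: "odd (h w 0) \<longleftrightarrow> w \<in> E" if "w \<in> J" for w
        using h_E[of w] h_nE[of w 0] that by (cases "w \<in> E") auto
      show "x = y"
      proof (cases "x \<in> E")
        case True
        hence yE: "y \<in> E" using odd x y eq by metis
        have "h x 0 = h y 0" using eq by simp
        hence "ecode x = ecode y" using h_E True yE by simp
        thus ?thesis using ecode_inj True yE by (auto dest: inj_onD)
      next
        case False
        hence xE: "x \<in> J - E" "y \<in> J - E" using odd x y eq by (metis DiffI)+
        have "code ((T ^^ i) x) = code ((T ^^ i) y)" for i
          using fun_cong[OF eq, of i] xE by (simp add: h_nE)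
        hence same: "B ((T ^^ i) y) = B ((T ^^ i) x)" for i using code_eq EJ xE by metis
        have "d x y < e" if "e > 0" for e
          using separate[OF xE(1) that] same xE(2) by blast
        hence "\<not> d x y > 0" by blast
        moreover have "x \<in> M" "y \<in> M" using x y J_sub by auto
        ultimately show ?thesis by simp
      qed
    qed
    show "h ` J = markov_space S A"
    proof (intro equalityI subsetI)
      fix a assume "a \<in> h ` J"
      then obtain x where x: "x \<in> J" "a = h x" by blast
      show "a \<in> markov_space S A"
      proof (cases "x \<in> E")
        case True
        thus ?thesis using h_E[OF True] x by (auto simp: markov_space_def S_def A_def)
      next
        case False
        hence xE: "x \<in> J - E" using x by blast
        have "a i = 2 * code ((T ^^ i) x)" for i using h_nE[OF xE] x(2) by simp
        moreover have "(T ^^ i) x \<in> J - Z" "T ((T ^^ i) x) \<notin> Z" for i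
          using EJ[OF xE, of i] EJ[OF xE, of "Suc i"] by auto
        ultimately show ?thesis by (fastforce simp: markov_space_def S_def A_def)
      qed
    next
      fix a assume a: "a \<in> markov_space S A"
      hence aS: "a i \<in> S" and aA: "A (a i) (a (Suc i)) = 1" for i by (auto simp: markov_space_def)
      show "a \<in> h ` J"
      proof (cases "odd (a 0)")
        case True
        then obtain x where x: "x \<in> E" "a 0 = 2 * ecode x + 1" using aS[of 0] by (auto simp: S_def)
        have "a i = 2 * ecode x + 1" for i
        proof (induction i)
          case (Suc i)
          hence "odd (a i)" by simp
          hence "a (Suc i) = a i" using aA[of i] by (auto simp: A_def split: if_splits)
          thus ?case using Suc by simp
        qed (use x in simp)
        hence "a = h x" using h_E[OF x(1)] by auto
        thus ?thesis using x(1) by (auto simp: E_def)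
      next
        case False
        have even: "even (a i)" for i
        proof (induction i)
          case (Suc i)
          thus ?case using aA[of i] by (auto simp: A_def split: if_splits)
        qed (use False in simp)
        have "\<exists>x. x \<in> J - Z \<and> T x \<notin> Z \<and> a i = 2 * code x \<and> a (Suc i) = 2 * code (T x)" for i
          using aA[of i] even[of i] by (auto simp: A_def split: if_splits)
        then obtain x where x: "\<And>i. x i \<in> J - Z" "\<And>i. T (x i) \<notin> Z" "\<And>i. a i = 2 * code (x i)"
          "\<And>i. a (Suc i) = 2 * code (T (x i))" by metis
        \<comment> \<open>The representatives of consecutive transitions are chosen independently;
          \<open>T (x i)\<close> and \<open>x (Suc i)\<close> share only their piece.\<close>
        have Bx: "B (T (x i)) = B (x (Suc i))" for i
        proof (rule code_eq)
          show "T (x i) \<in> J - Z" "x (Suc i) \<in> J - Z" using x(1,2) J_image by blast+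
          show "code (T (x i)) = code (x (Suc i))" using x(3)[of "Suc i"] x(4)[of i] by simp
        qed
        \<comment> \<open>Finite words are realised from the last letter backwards: a point
          realising the tail lies in the piece of \<open>T (x i)\<close>, which is covered by the
          image of the piece of \<open>x i\<close>.\<close>
        have word: "\<exists>w\<in>J \<inter> B (x i). \<forall>j\<le>n. (T ^^ j) w \<in> B (x (i + j))" for n i
        proof (induction n arbitrary: i)
          case 0
          show ?case using x(1)[of i] self[OF x(1)[of i]] by auto
        next
          case (Suc n)
          obtain w where w: "w \<in> J \<inter> B (x (Suc i))" "\<And>j. j \<le> n \<Longrightarrow> (T ^^ j) w \<in> B (x (Suc i + j))"
            using Suc[of "Suc i"] by blast
          obtain v where v: "v \<in> J \<inter> B (x i)" "T v = w"
            using pull[OF x(1,2)[of i], of w] w(1) Bx[of i] by blast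
          have "(T ^^ j) v \<in> B (x (i + j))" if "j \<le> Suc n" for j
          proof (cases j)
            case (Suc k)
            have "(T ^^ j) v = (T ^^ k) w" using v(2) by (simp add: Suc funpow_swap1)
            thus ?thesis using w(2)[of k] that Suc by simp
          qed (use v in simp)
          thus ?case using v(1) by blast
        qed
        \<comment> \<open>Including \<open>J\<close> keeps the limit point in the Julia set. All
          sets are closed because balls are, so compactness passes from finite words to the infinite
          one.\<close>
        define Cn where "Cn n = \<Inter>(insert J ((\<lambda>j. {w \<in> M. (T ^^ j) w \<in> B (x j)}) ` {..n}))" for n
        have "\<Inter>(range Cn) \<noteq> {}"
        proof (rule compact_space_imp_nest[OF compact])
          fix n
          have "closedin mtopology {w \<in> M. (T ^^ j) w \<in> B (x j)}" for j
            using closedin_continuous_map_preimage[OF continuous_iter closedin_mball] by (simp add: B_def)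
          thus "closedin mtopology (Cn n)"
            unfolding Cn_def using closedin_J by (intro closedin_Inter) auto
          obtain w where "w \<in> J" "\<forall>j\<le>n. (T ^^ j) w \<in> B (x j)" using word[of 0 n] by auto
          hence "w \<in> Cn n" using J_sub by (auto simp: Cn_def)
          thus "Cn n \<noteq> {}" by blast
        next
          show "decseq Cn" by (auto simp: decseq_def Cn_def)
        qed
        then obtain w where w: "\<And>n. w \<in> Cn n" by blast
        have wJ: "w \<in> J" using w[of 0] by (simp add: Cn_def)
        have wB: "(T ^^ i) w \<in> B (x i)" for i using w[of i] by (simp add: Cn_def)
        have "w \<notin> E" using B_Z[OF x(1) J_iter[OF wJ] wB] by (auto simp: E_def)
        moreover have "code ((T ^^ i) w) = code (x i)" for i
          using B_eq[OF x(1) J_iter[OF wJ] wB] by (simp add: code_def)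
        ultimately have "h w = a" using h_nE[of w] wJ x(3) by auto
        thus ?thesis using wJ by blast
      qed
    qed
  qed

  moreover have "conjugate_via mtopology I T (markov_top S A) left_shift h"
    unfolding conjugate_via_def
  proof
    have I_M: "I \<subseteq> M" using I J_sub by blast
    have hI: "h ` I \<subseteq> markov_space S A" using bij I by (auto simp: bij_betw_def)
    have S_ms: "a i \<in> S" if "a \<in> markov_space S A" for a i using that by (simp add: markov_space_def)
    let ?X = "subtopology mtopology I"
    let ?Prod = "product_topology (\<lambda>_::nat. discrete_topology S) UNIV"
    have Y: "subtopology (markov_top S A) (h ` I) = subtopology ?Prod (h ` I)"
      unfolding markov_top_def subtopology_subtopology using hI by (simp add: Int_absorb1)
    have topX: "topspace ?X = I" using I_M by auto
    have topY: "topspace (subtopology ?Prod (h ` I)) = h ` I"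
      using hI S_ms by (auto simp: topspace_product_topology PiE_UNIV_domain)
    have nbhd: "openin mtopology {y \<in> M. (T ^^ i) y \<in> B ((T ^^ i) x)}" for i x
      using openin_continuous_map_preimage[OF continuous_iter openin_mball] by (simp add: B_def)
    have "homeomorphic_map ?X (subtopology ?Prod (h ` I)) h"
    proof (rule bijective_open_imp_homeomorphic_map)
      show "continuous_map ?X (subtopology ?Prod (h ` I)) h"
        unfolding continuous_map_in_subtopology continuous_map_componentwise_UNIV
      proof (intro conjI allI)
        fix i
        show "continuous_map ?X (discrete_topology S) (\<lambda>x. h x i)"
          unfolding continuous_map_def
        proof (intro conjI allI impI)
          show "(\<lambda>x. h x i) \<in> topspace ?X \<rightarrow> topspace (discrete_topology S)"
            using topX hI S_ms by auto
          fix U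
          \<comment> \<open>The i-th symbol depends only on the piece that contains the i-th
            iterate, and its preimage is open; so every coordinate of \<open>h\<close> is locally
            constant on \<open>I\<close>.\<close>
          let ?V = "\<Union>x\<in>{x \<in> I. h x i \<in> U}. {y \<in> M. (T ^^ i) y \<in> B ((T ^^ i) x)}"
          have "{x \<in> topspace ?X. h x i \<in> U} = ?V \<inter> I"
          proof (intro equalityI subsetI)
            fix x assume x: "x \<in> {x \<in> topspace ?X. h x i \<in> U}"
            hence "x \<in> I" using topX by blast
            moreover from this have "(T ^^ i) x \<in> B ((T ^^ i) x)" using self EJ I by blast
            ultimately show "x \<in> ?V \<inter> I" using x I_M by blast
          next
            fix y assume y: "y \<in> ?V \<inter> I"
            then obtain x where x: "x \<in> I" "h x i \<in> U" "(T ^^ i) y \<in> B ((T ^^ i) x)" by blast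
            have "y \<in> J - E" "x \<in> J - E" using x y I by auto
            hence "B ((T ^^ i) y) = B ((T ^^ i) x)" using B_eq EJ x(3) by blast
            hence "h y i = h x i" using h_nE \<open>y \<in> J - E\<close> \<open>x \<in> J - E\<close> by (simp add: code_def)
            thus "y \<in> {x \<in> topspace ?X. h x i \<in> U}" using x y topX by auto
          qed
          moreover have "openin mtopology ?V" using nbhd by (intro openin_Union) auto
          ultimately show "openin ?X {x \<in> topspace ?X. h x i \<in> U}"
            by (auto simp: openin_subtopology)
        qed
      qed (use topX in auto)
      show "open_map ?X (subtopology ?Prod (h ` I)) h"
        unfolding open_map_def
      proof (intro allI impI)
        fix U assume "openin ?X U"
        then obtain V where V: "openin mtopology V" "U = V \<inter> I" by (auto simp: openin_subtopology)
        show "openin (subtopology ?Prod (h ` I)) (h ` U)"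
        proof (subst openin_subopen, intro ballI)
          fix a assume "a \<in> h ` U"
          then obtain x where x: "x \<in> U" "a = h x" by blast
          have xE: "x \<in> J - E" using x V I by blast
          obtain e where e: "e > 0" "mball x e \<subseteq> V" using V x(1) openin_mtopology by (metis IntD1)
          obtain n where n: "\<And>y. y \<in> J - E \<Longrightarrow> \<forall>i\<le>n. B ((T ^^ i) y) = B ((T ^^ i) x) \<Longrightarrow> d x y < e"
            using separate[OF xE e(1)] by blast
          \<comment> \<open>The cylinder fixing the symbols \<open>0\<close> to \<open>n\<close> of
            \<open>a\<close>; by \<open>separate\<close> these confine a point of \<open>I\<close>
            to the ball of radius \<open>e\<close>.\<close>
          define W where "W = (\<Inter>j\<in>{..n}. {b \<in> topspace ?Prod. b j \<in> {a j}}) \<inter> topspace ?Prod"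
          have "openin ?Prod {b \<in> topspace ?Prod. b j \<in> {a j}}" for j
          proof (rule openin_continuous_map_preimage)
            show "continuous_map ?Prod (discrete_topology S) (\<lambda>b. b j)"
              by (rule continuous_map_product_projection) simp
            show "openin (discrete_topology S) {a j}"
              using S_ms hI x V(2) by auto
          qed
          hence W: "openin ?Prod W" unfolding W_def by (intro openin_INT) auto
          have "a \<in> topspace ?Prod"
            using hI x V(2) S_ms by (auto simp: topspace_product_topology PiE_UNIV_domain)
          hence "a \<in> W \<inter> h ` I" using x V(2) by (auto simp: W_def)
          moreover have "W \<inter> h ` I \<subseteq> h ` U"
          proof
            fix b assume b: "b \<in> W \<inter> h ` I"
            then obtain y where y: "y \<in> I" "b = h y" by blast
            hence yE: "y \<in> J - E" using I by blast
            have "B ((T ^^ i) y) = B ((T ^^ i) x)" if "i \<le> n" for i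
            proof (rule code_eq[OF EJ[OF yE] EJ[OF xE]])
              have "h y i = h x i" using b that y x by (auto simp: W_def)
              thus "code ((T ^^ i) y) = code ((T ^^ i) x)" using h_nE xE yE by simp
            qed
            hence "d x y < e" using n yE by blast
            hence "y \<in> mball x e" using xE yE J_sub by auto
            hence "y \<in> V" using e(2) by blast
            thus "b \<in> h ` U" using y V(2) by blast
          qed
          moreover have "openin (subtopology ?Prod (h ` I)) (W \<inter> h ` I)"
            using W by (auto simp: openin_subtopology)
          ultimately show "\<exists>W. openin (subtopology ?Prod (h ` I)) W \<and> a \<in> W \<and> W \<subseteq> h ` U" by blast
        qed
      qed
      show "h ` topspace ?X = topspace (subtopology ?Prod (h ` I))" using topX topY by simp
      show "inj_on h (topspace ?X)"
        using bij I topX inj_on_subset unfolding bij_betw_def by (metis Diff_subset subset_trans)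
    qed
    thus "homeomorphic_map ?X (subtopology (markov_top S A) (h ` I)) h" by (simp only: Y)
    show "\<forall>x\<in>I. h (T x) = left_shift (h x)"
    proof
      fix x assume "x \<in> I"
      hence x: "x \<in> J - E" using I by blast
      have "T x \<notin> E" using EJ[OF x, of "Suc _"] by (auto simp: E_def funpow_swap1)
      hence "T x \<in> J - E" using x J_image by blast
      thus "h (T x) = left_shift (h x)"
        using x h_nE by (auto simp: left_shift_def funpow_swap1)
    qed
  qed
  ultimately show ?thesis by blast
qed

end

section \<open>Local analysis over a locally compact field\<close>

context nonarch_absolute_value
begin

lemma nm_diff_le: "nm (x - y) \<le> max (nm x) (nm y)"
  using nm_ultrametric[of x "- y"] by simp

lemma nm_eq_of_less: "nm (x - y) < nm y \<Longrightarrow> nm x = nm y"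
  using nm_ultrametric[of "x - y" y] nm_ultrametric[of "y - x" x] nm_minus_commute[of x y] by auto

lemma nm_add_less: "nm x < b \<Longrightarrow> nm y < b \<Longrightarrow> nm (x + y) < b"
  using nm_ultrametric[of x y] by auto

lemma nm_power: "nm (x ^ n) = nm x ^ n"
  by (induction n) (auto simp: nm_mult)

lemma nm_of_nat_le: "nm (of_nat n) \<le> 1"
proof (induction n)
  case (Suc n)
  thus ?case using nm_ultrametric[of 1 "of_nat n"] by simp
qed simp

lemma nm_pos: "x \<noteq> 0 \<Longrightarrow> nm x > 0"
  using nm_nonneg[of x] nm_eq_0_iff[of x] by linarith

lemma nm_divide: "nm (x / y) = nm x / nm y"
proof (cases "y = 0")
  case False
  have "nm (x / y) * nm y = nm x" using False by (simp flip: nm_mult)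
  thus ?thesis using nm_pos[OF False] by (simp add: field_simps)
qed simp

lemma nm_power_diff:
  assumes "nm x \<le> t" "nm y \<le> t"
  shows "nm (x ^ Suc m - y ^ Suc m) \<le> t ^ m * nm (x - y)"
proof (induction m)
  case (Suc m)
  have t: "t \<ge> 0" using assms(1) nm_nonneg[of x] by linarith
  have eq: "x ^ Suc (Suc m) - y ^ Suc (Suc m) = x * (x ^ Suc m - y ^ Suc m) + (x - y) * y ^ Suc m"
    by (simp add: algebra_simps)
  have 1: "nm (x * (x ^ Suc m - y ^ Suc m)) \<le> t ^ Suc m * nm (x - y)"
  proof -
    have "nm x * nm (x ^ Suc m - y ^ Suc m) \<le> t * (t ^ m * nm (x - y))"
      using assms(1) Suc t by (intro mult_mono) (auto simp: nm_nonneg)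
    thus ?thesis by (simp add: nm_mult mult.assoc)
  qed
  have 2: "nm ((x - y) * y ^ Suc m) \<le> t ^ Suc m * nm (x - y)"
  proof -
    have "nm y ^ Suc m \<le> t ^ Suc m" using assms(2) by (intro power_mono) (auto simp: nm_nonneg)
    thus ?thesis using nm_nonneg[of "x - y"]
      by (simp only: nm_mult nm_power mult.commute[of "t ^ Suc m"] mult_left_mono)
  qed
  show ?case unfolding eq by (rule order_trans[OF nm_ultrametric max.boundedI[OF 1 2]])
qed simp

text \<open>The bound carries the factor \<open>t\<close> on the left so that no division by \<open>t\<close> occurs.\<close>

lemma nm_power_diff_linear:
  assumes v: "nm v = t" and x: "nm (x - v) \<le> s" and y: "nm (y - v) \<le> s" and s: "s \<le> t"
  shows "nm (x ^ Suc m - y ^ Suc m - of_nat (Suc m) * v ^ m * (x - y)) * t \<le> t ^ m * s * nm (x - y)"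
proof (induction m)
  case 0
  have "s \<ge> 0" using nm_nonneg[of "x - v"] x by linarith
  thus ?case by (simp add: nm_nonneg)
next
  case (Suc m)
  have s0: "s \<ge> 0" using nm_nonneg[of "x - v"] x by linarith
  hence t0: "t \<ge> 0" using s by linarith
  have xt: "nm x \<le> t" using nm_ultrametric[of "x - v" v] v x s by simp
  have yt: "nm y \<le> t" using nm_ultrametric[of "y - v" v] v y s by simp
  define d where "d = x ^ Suc m - y ^ Suc m - of_nat (Suc m) * v ^ m * (x - y)"
  have eq: "x ^ Suc (Suc m) - y ^ Suc (Suc m) - of_nat (Suc (Suc m)) * v ^ Suc m * (x - y)
      = x * d + of_nat (Suc m) * v ^ m * (x - y) * (x - v) + (x - y) * (y ^ Suc m - v ^ Suc m)"
    unfolding d_def by (simp add: algebra_simps)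
  have 1: "nm (x * d) * t \<le> t ^ Suc m * s * nm (x - y)"
  proof -
    have "nm x * (nm d * t) \<le> t * (t ^ m * s * nm (x - y))"
      using Suc xt t0 unfolding d_def by (intro mult_mono[OF xt]) (auto simp: nm_nonneg)
    thus ?thesis by (simp add: nm_mult mult_ac)
  qed
  have 2: "nm (of_nat (Suc m) * v ^ m * (x - y) * (x - v)) * t \<le> t ^ Suc m * s * nm (x - y)"
  proof -
    have "nm (of_nat (Suc m)) * (t ^ m * nm (x - y) * nm (x - v) * t)
        \<le> 1 * (t ^ m * nm (x - y) * s * t)"
      using nm_of_nat_le[of "Suc m"] x t0 s0
      by (intro mult_mono mult_right_mono mult_left_mono) (auto simp: nm_nonneg simp del: of_nat_Suc)
    thus ?thesis by (simp add: nm_mult nm_power v mult_ac del: of_nat_Suc)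
  qed
  have 3: "nm ((x - y) * (y ^ Suc m - v ^ Suc m)) * t \<le> t ^ Suc m * s * nm (x - y)"
  proof -
    have "nm (y ^ Suc m - v ^ Suc m) \<le> t ^ m * nm (y - v)"
      using nm_power_diff[of y t v m] yt v by simp
    also have "\<dots> \<le> t ^ m * s" using y t0 by (intro mult_left_mono) auto
    finally have "nm (x - y) * nm (y ^ Suc m - v ^ Suc m) * t \<le> nm (x - y) * (t ^ m * s) * t"
      using t0 by (intro mult_right_mono mult_left_mono) (auto simp: nm_nonneg)
    thus ?thesis by (simp add: nm_mult mult_ac)
  qed
  define b where "b = t ^ Suc m * s * nm (x - y)"
  define u1 where "u1 = x * d"
  define u2 where "u2 = of_nat (Suc m) * v ^ m * (x - y) * (x - v)"
  define u3 where "u3 = (x - y) * (y ^ Suc m - v ^ Suc m)"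
  have "nm (u1 + u2 + u3) \<le> max (max (nm u1) (nm u2)) (nm u3)"
    using nm_ultrametric[of "u1 + u2" u3] nm_ultrametric[of u1 u2] by linarith
  hence "nm (u1 + u2 + u3) * t \<le> max (max (nm u1) (nm u2)) (nm u3) * t"
    using t0 by (rule mult_right_mono)
  also have "\<dots> \<le> b" using 1 2 3 unfolding u1_def u2_def u3_def b_def by (auto simp: max_def)
  finally show ?case unfolding eq u1_def u2_def u3_def b_def .
qed

end

text \<open>The last assumption excludes the trivial absolute value; it is the source of nearby
  distinct points in the projective line.\<close>

locale local_field = nonarch_absolute_value nm for nm :: "'c::field_char_0 \<Rightarrow> real" +
  fixes K :: "'c set"
  assumes subfield: "subfield_set K"
    and compact_ball: "compactin (Metric_space.mtopology K (\<lambda>x y. nm (x - y))) {z \<in> K. nm z \<le> r}"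
    and discretely_small: "e > 0 \<Longrightarrow> \<exists>u\<in>K. u \<noteq> 0 \<and> nm u < e"
begin

lemma K_0 [simp]: "0 \<in> K" and K_1 [simp]: "1 \<in> K"
  and K_add: "x \<in> K \<Longrightarrow> y \<in> K \<Longrightarrow> x + y \<in> K"
  and K_mult: "x \<in> K \<Longrightarrow> y \<in> K \<Longrightarrow> x * y \<in> K"
  and K_minus: "x \<in> K \<Longrightarrow> - x \<in> K"
  and K_inverse: "x \<in> K \<Longrightarrow> inverse x \<in> K"
  using subfield by (auto simp: subfield_set_def)

lemma K_diff: "x \<in> K \<Longrightarrow> y \<in> K \<Longrightarrow> x - y \<in> K"
  using K_add[of x "- y"] K_minus[of y] by simp

lemma K_divide: "x \<in> K \<Longrightarrow> y \<in> K \<Longrightarrow> x / y \<in> K"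
  using K_mult[of x "inverse y"] K_inverse[of y] by (simp add: divide_inverse)

lemma K_power: "x \<in> K \<Longrightarrow> x ^ n \<in> K"
  by (induction n) (auto simp: K_mult)

lemma K_of_nat: "of_nat n \<in> K"
  by (induction n) (auto simp: K_add)

lemma K_poly: "poly_over K f \<Longrightarrow> x \<in> K \<Longrightarrow> poly f x \<in> K"
proof (induction f)
  case (pCons a f)
  have "a \<in> K" using pCons.prems(1) unfolding poly_over_def by (metis coeff_pCons_0)
  moreover have "poly_over K f" using pCons.prems(1) unfolding poly_over_def by (metis coeff_pCons_Suc)
  ultimately show ?case using pCons by (simp add: K_add K_mult)
qed simp

sublocale K: ultrametric_space K "\<lambda>x y. nm (x - y)"
proof -
  interpret U: Metric_space UNIV "\<lambda>x y. nm (x - y)" by (rule Metric_space_nm)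
  interpret Metric_space K "\<lambda>x y. nm (x - y)"
    by (rule U.subspace) simp
  show "ultrametric_space K (\<lambda>x y. nm (x - y))"
  proof
    show "nm (x - z) \<le> max (nm (x - y)) (nm (y - z))" for x y z
      using nm_ultrametric[of "x - y" "y - z"] by simp
  qed
qed

definition kball :: "'c \<Rightarrow> real \<Rightarrow> 'c set" where "kball a r = {z \<in> K. nm (z - a) < r}"

lemma kball_mball: "a \<in> K \<Longrightarrow> kball a r = K.mball a r"
  by (auto simp: kball_def nm_minus_commute)

lemma kball_eq: "a \<in> K \<Longrightarrow> y \<in> kball a r \<Longrightarrow> kball y r = kball a r"
  using K.mball_eq[of y a r] by (metis (full_types) K.in_mball kball_mball)

lemma compact_kball:
  assumes "a \<in> K" shows "compactin K.mtopology (kball a r)"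
proof (rule closed_compactin[OF compact_ball])
  show "kball a r \<subseteq> {z \<in> K. nm z \<le> max (nm a) r}"
  proof
    fix z assume "z \<in> kball a r"
    thus "z \<in> {z \<in> K. nm z \<le> max (nm a) r}"
      using nm_ultrametric[of "z - a" a] by (auto simp: kball_def)
  qed
  show "closedin K.mtopology (kball a r)" unfolding kball_mball[OF assms] by (rule K.closedin_mball)
qed

text \<open>
  A Hensel type lemma: a point of the ball whose image is nearest to a prescribed value exists by
  compactness, and a Newton step with the fixed slope \<open>D\<close> would come strictly nearer.
\<close>

lemma almost_linear:
  assumes a: "a \<in> K" and r: "r > 0" and D: "D \<in> K" "D \<noteq> 0"
    and \<psi>: "\<And>z. z \<in> kball a r \<Longrightarrow> \<psi> z \<in> K"
    and lin: "\<And>z w. z \<in> kball a r \<Longrightarrow> w \<in> kball a r \<Longrightarrow> z \<noteq> w \<Longrightarrow>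
      nm (\<psi> z - \<psi> w - D * (z - w)) < nm D * nm (z - w)"
  shows "\<And>z w. z \<in> kball a r \<Longrightarrow> w \<in> kball a r \<Longrightarrow> nm (\<psi> z - \<psi> w) = nm D * nm (z - w)"
    and "\<psi> ` kball a r = kball (\<psi> a) (nm D * r)"
proof -
  have D0: "nm D > 0" using D nm_pos by blast
  show *: "nm (\<psi> z - \<psi> w) = nm D * nm (z - w)" if "z \<in> kball a r" "w \<in> kball a r" for z w
  proof (cases "z = w")
    case False
    have "nm (\<psi> z - \<psi> w - D * (z - w)) < nm (D * (z - w))"
      using lin[OF that False] by (simp add: nm_mult)
    thus ?thesis using nm_eq_of_less by (metis nm_mult)
  qed simp
  have aB: "a \<in> kball a r" using a r by (simp add: kball_def)
  show "\<psi> ` kball a r = kball (\<psi> a) (nm D * r)"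
  proof (intro equalityI subsetI)
    fix w assume "w \<in> \<psi> ` kball a r"
    then obtain z where z: "z \<in> kball a r" "w = \<psi> z" by blast
    have "nm (w - \<psi> a) = nm D * nm (z - a)" using *[OF z(1) aB] z(2) by simp
    also have "\<dots> < nm D * r" using z(1) D0 by (simp add: kball_def)
    finally show "w \<in> kball (\<psi> a) (nm D * r)" using \<psi>[OF z(1)] z(2) by (simp add: kball_def)
  next
    fix w assume w: "w \<in> kball (\<psi> a) (nm D * r)"
    define f where "f z = nm (w - \<psi> z)" for z
    show "w \<in> \<psi> ` kball a r"
    proof (rule ccontr)
      assume contra: "w \<notin> \<psi> ` kball a r"
      \<comment> \<open>Where it is positive, \<open>f\<close> is locally constant. If
        \<open>w\<close> were not attained, \<open>f\<close> would take finitely many values on the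
        compact ball and so have a minimum.\<close>
      have "finite (f ` kball a r)"
      proof (rule K.finite_image_locally_constant[OF compact_kball[OF a]])
        fix x assume x: "x \<in> kball a r"
        have fx: "f x > 0" using contra x unfolding f_def by (intro nm_pos) auto
        have "f y = f x" if y: "y \<in> kball a r" "y \<in> K.mball x (f x / nm D)" for y
        proof -
          have "nm (\<psi> x - \<psi> y) = nm D * nm (x - y)" using * x y by blast
          also have "\<dots> < nm D * (f x / nm D)" using y(2) D0 by (intro mult_strict_left_mono) auto
          finally have "nm ((w - \<psi> y) - (w - \<psi> x)) < nm (w - \<psi> x)" using D0 by (simp add: f_def)
          thus ?thesis unfolding f_def by (rule nm_eq_of_less)
        qed
        thus "\<exists>s>0. \<forall>y\<in>kball a r \<inter> K.mball x s. f y = f x"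
          using fx D0 by (intro exI[of _ "f x / nm D"]) auto
      qed
      moreover have "f ` kball a r \<noteq> {}" using aB by blast
      ultimately have "Min (f ` kball a r) \<in> f ` kball a r" by (rule Min_in)
      then obtain z where z: "z \<in> kball a r" "f z = Min (f ` kball a r)" by auto
      have min: "f z \<le> f y" if "y \<in> kball a r" for y
        using z(2) that \<open>finite (f ` kball a r)\<close> by simp
      have wK: "w \<in> K" "\<psi> z \<in> K" "z \<in> K" using w \<psi> z by (auto simp: kball_def)
      define y where "y = z + (w - \<psi> z) / D"
      have ne: "w - \<psi> z \<noteq> 0" using contra z(1) by auto
      have yz: "nm (y - z) = f z / nm D" by (simp add: y_def f_def nm_divide)
      have "f z \<le> f a" using min aB by blast
      also have "f a < nm D * r" using w by (simp add: f_def kball_def)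
      finally have "nm (y - z) < r" unfolding yz using D0 by (simp add: field_simps)
      hence "nm ((y - z) + (z - a)) < r" using z(1) by (intro nm_add_less) (auto simp: kball_def)
      hence "nm (y - a) < r" by simp
      moreover have "y \<in> K" using wK D K_add K_diff K_divide by (simp add: y_def)
      ultimately have yB: "y \<in> kball a r" by (simp add: kball_def)
      have "y \<noteq> z" using ne D by (simp add: y_def)
      hence "nm (\<psi> y - \<psi> z - D * (y - z)) < nm D * nm (y - z)" using lin yB z(1) by blast
      moreover have "D * (y - z) = w - \<psi> z" using D by (simp add: y_def)
      ultimately have "f y < f z" using D0 by (simp add: yz f_def nm_minus_commute[of w])
      thus False using min[OF yB] by simp
    qed
  qed
qed

end

section \<open>Charts and normal forms of a map in charts\<close>

locale charted_space = local_field nm K + P: ultrametric_space M d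
  for nm :: "'c::field_char_0 \<Rightarrow> real" and K and M :: "'a set" and d
begin

text \<open>The factor \<open>\<kappa>\<close> records the distortion of the metric by the
  coordinate; for the spherical metric near \<open>Fin a\<close> it is
  \<open>1 / (max (nm a) 1)\<^sup>2\<close>.\<close>

definition chart :: "('c \<Rightarrow> 'a) \<Rightarrow> 'c \<Rightarrow> real \<Rightarrow> real \<Rightarrow> bool" where
  "chart i a \<kappa> R \<longleftrightarrow> a \<in> K \<and> R > 0 \<and> \<kappa> > 0 \<and> i a \<in> M \<and>
     (\<forall>z\<in>kball a R. \<forall>w\<in>kball a R. d (i z) (i w) = \<kappa> * nm (z - w)) \<and>
     i ` kball a R = P.mball (i a) (\<kappa> * R)"

lemma chart_dist: "chart i a \<kappa> R \<Longrightarrow> z \<in> kball a R \<Longrightarrow> w \<in> kball a R \<Longrightarrow> d (i z) (i w) = \<kappa> * nm (z - w)"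
  by (auto simp: chart_def)

lemma kball_self: "a \<in> K \<Longrightarrow> r > 0 \<Longrightarrow> a \<in> kball a r"
  by (simp add: kball_def)

lemma kball_mono: "a \<in> K \<Longrightarrow> y \<in> kball a R \<Longrightarrow> s \<le> R \<Longrightarrow> kball y s \<subseteq> kball a R"
  using kball_eq[of a y R] by (force simp: kball_def)

lemma chart_ball:
  assumes c: "chart i a \<kappa> R" and y: "y \<in> kball a R" and s: "0 < s" "s \<le> R"
  shows "i y \<in> M" and "i ` kball y s = P.mball (i y) (\<kappa> * s)"
proof -
  have cc: "a \<in> K" "R > 0" "\<kappa> > 0" "i ` kball a R = P.mball (i a) (\<kappa> * R)"
    using c by (auto simp: chart_def)
  have y_in: "i y \<in> P.mball (i a) (\<kappa> * R)" using cc(4) y by blast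
  thus yM: "i y \<in> M" by auto
  have sub: "kball y s \<subseteq> kball a R" by (rule kball_mono[OF cc(1) y s(2)])
  have yy: "y \<in> kball y s" using y s by (auto simp: kball_def)
  show "i ` kball y s = P.mball (i y) (\<kappa> * s)"
  proof (intro equalityI subsetI)
    fix w assume "w \<in> i ` kball y s"
    then obtain z where z: "z \<in> kball y s" "w = i z" by blast
    have "i z \<in> P.mball (i a) (\<kappa> * R)" using sub z(1) cc(4) by blast
    hence "i z \<in> M" by simp
    moreover have "d (i y) (i z) = \<kappa> * nm (y - z)" using chart_dist[OF c y] sub z(1) by blast
    moreover have "nm (y - z) < s" using z(1) by (simp add: kball_def nm_minus_commute)
    ultimately show "w \<in> P.mball (i y) (\<kappa> * s)" using yM z(2) cc(3) by simp
  next
    fix w assume w: "w \<in> P.mball (i y) (\<kappa> * s)"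
    have "\<kappa> * s \<le> \<kappa> * R" using cc(3) s(2) by simp
    hence "w \<in> P.mball (i y) (\<kappa> * R)" using w by auto
    hence "w \<in> i ` kball a R" using P.mball_eq[OF y_in] cc(4) by blast
    then obtain z where z: "z \<in> kball a R" "w = i z" by blast
    have "\<kappa> * nm (y - z) < \<kappa> * s" using chart_dist[OF c y z(1)] w z(2) by simp
    hence "z \<in> kball y s" using cc(3) z(1) by (simp add: kball_def nm_minus_commute)
    thus "w \<in> i ` kball y s" using z(2) by blast
  qed
qed

lemma chart_scales:
  assumes c: "chart i a \<kappa> R" and c': "chart j b \<mu> S"
    and y: "y \<in> kball a R" and s: "0 < s" "s \<le> R" and l: "l > 0" "l * s \<le> S"
    and im: "\<psi> ` kball y s = kball (\<psi> y) (l * s)"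
    and sim: "\<And>z w. z \<in> kball y s \<Longrightarrow> w \<in> kball y s \<Longrightarrow> nm (\<psi> z - \<psi> w) = l * nm (z - w)"
    and \<psi>y: "\<psi> y \<in> kball b S" and T: "\<And>z. z \<in> kball y s \<Longrightarrow> T (i z) = j (\<psi> z)"
  shows "P.scales T (i y) (\<kappa> * s) (\<mu> * l / \<kappa>)"
proof -
  have pos: "\<kappa> > 0" "\<mu> > 0" "a \<in> K" "b \<in> K" using c c' by (auto simp: chart_def)
  have yy: "y \<in> kball y s" using y s by (auto simp: kball_def)
  have sub: "kball y s \<subseteq> kball a R" by (rule kball_mono[OF pos(3) y s(2)])
  have sub': "kball (\<psi> y) (l * s) \<subseteq> kball b S" by (rule kball_mono[OF pos(4) \<psi>y l(2)])
  have B1: "i ` kball y s = P.mball (i y) (\<kappa> * s)" by (rule chart_ball(2)[OF c y s])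
  have B2: "j ` kball (\<psi> y) (l * s) = P.mball (j (\<psi> y)) (\<mu> * (l * s))"
    by (rule chart_ball(2)[OF c' \<psi>y]) (use l s in auto)
  have Ty: "T (i y) = j (\<psi> y)" by (rule T[OF yy])
  have "T ` P.mball (i y) (\<kappa> * s) = T ` i ` kball y s" by (simp only: B1)
  also have "\<dots> = j ` \<psi> ` kball y s" using T by (auto simp: image_image intro!: image_cong)
  also have "\<dots> = P.mball (T (i y)) (\<mu> * l / \<kappa> * (\<kappa> * s))"
    unfolding im B2 Ty using pos(1) by simp
  finally have image: "T ` P.mball (i y) (\<kappa> * s) = P.mball (T (i y)) (\<mu> * l / \<kappa> * (\<kappa> * s))" .
  have dist: "d (T u) (T v) = \<mu> * l / \<kappa> * d u v"
    if uv: "u \<in> P.mball (i y) (\<kappa> * s)" "v \<in> P.mball (i y) (\<kappa> * s)" for u v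
  proof -
    obtain z w where z: "z \<in> kball y s" "u = i z" and w: "w \<in> kball y s" "v = i w"
      using uv unfolding B1[symmetric] by blast
    have in_b: "\<psi> z \<in> kball b S" "\<psi> w \<in> kball b S" using z(1) w(1) im sub' by blast+
    have "d (T u) (T v) = \<mu> * nm (\<psi> z - \<psi> w)"
      using chart_dist[OF c' in_b] T z w by simp
    also have "\<dots> = \<mu> * l / \<kappa> * (\<kappa> * nm (z - w))" using sim[OF z(1) w(1)] pos(1) by simp
    also have "\<kappa> * nm (z - w) = d u v" using chart_dist[OF c subsetD[OF sub z(1)] subsetD[OF sub w(1)]] z(2) w(2) by simp
    finally show ?thesis .
  qed
  have "i y \<in> M" "j (\<psi> y) \<in> M" using chart_ball(1)[OF c y s] chart_ball(1)[OF c' \<psi>y, of S] c'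
    by (auto simp: chart_def)
  thus ?thesis unfolding P.scales_def using dist image pos l s Ty by simp
qed

end

text \<open>\<open>Suc k\<close> is the local degree at \<open>a\<close>. In place of a power
  series, the cofactor \<open>q\<close> is known only through its constant absolute value and a
  Lipschitz bound, which is enough for the estimates.\<close>

locale local_model = charted_space nm K M d
  for nm :: "'c::field_char_0 \<Rightarrow> real" and K and M :: "'a set" and d +
  fixes T :: "'a \<Rightarrow> 'a" and i a \<kappa> R j b \<mu> S q r L Q k \<psi>
  assumes chart1: "chart i a \<kappa> R" and chart2: "chart j b \<mu> S"
    and r: "0 < r" "r \<le> R" and L: "L \<ge> 0" and Q: "Q > 0"
    and qK: "z \<in> kball a r \<Longrightarrow> q z \<in> K" and qQ: "z \<in> kball a r \<Longrightarrow> nm (q z) = Q"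
    and qL: "z \<in> kball a r \<Longrightarrow> w \<in> kball a r \<Longrightarrow> nm (q z - q w) \<le> L * nm (z - w)"
    and \<psi>: "z \<in> kball a r \<Longrightarrow> \<psi> z = b + (z - a) ^ Suc k * q z"
    and \<psi>_in: "z \<in> kball a r \<Longrightarrow> \<psi> z \<in> kball b S"
    and T_\<psi>: "z \<in> kball a r \<Longrightarrow> T (i z) = j (\<psi> z)"
begin

lemma pos: "\<kappa> > 0" "\<mu> > 0" "R > 0" "S > 0" "a \<in> K" "b \<in> K"
  using chart1 chart2 by (auto simp: chart_def)

lemma kball_sub: "y \<in> kball a r \<Longrightarrow> s \<le> r \<Longrightarrow> kball y s \<subseteq> kball a r"
  by (rule kball_mono[OF pos(5)])

lemma kball_R: "kball a r \<subseteq> kball a R"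
  using r by (auto simp: kball_def)

lemma \<psi>_diff:
  assumes "z \<in> kball a r" "w \<in> kball a r"
  shows "\<psi> z - \<psi> w = ((z - a) ^ Suc k - (w - a) ^ Suc k) * q z + (w - a) ^ Suc k * (q z - q w)"
  using assms by (simp add: \<psi> algebra_simps)

lemma near_point:
  assumes "y \<in> P.mball (i a) (\<kappa> * s)" "0 < s" "s \<le> r"
  obtains y' where "y = i y'" "y' \<in> kball a s" "y' \<in> kball a r" "d (i a) y = \<kappa> * nm (y' - a)"
proof -
  have aR: "a \<in> kball a R" using pos by (intro kball_self)
  have "i ` kball a s = P.mball (i a) (\<kappa> * s)"
    using assms r by (intro chart_ball(2)[OF chart1 aR]) auto
  then obtain y' where y': "y = i y'" "y' \<in> kball a s" using assms by blast
  have "y' \<in> kball a r" using y' assms by (auto simp: kball_def)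
  moreover from this have "d (i a) y = \<kappa> * nm (y' - a)"
    using chart_dist[OF chart1 aR, of y'] kball_R y'(1) by (auto simp: nm_minus_commute)
  ultimately show thesis using that y' by blast
qed

lemma scales_noncritical:
  assumes k: "k = 0" shows "\<exists>r l. P.scales T (i a) r l"
proof -
  \<comment> \<open>Within \<open>Q / (L + 1)\<close> the variation of \<open>q\<close> stays below
    its size \<open>Q\<close>; within \<open>S / Q\<close> the image ball fits into the target
    chart. Adding \<open>1\<close> avoids division by zero.\<close>
  define s where "s = min r (min (Q / (L + 1)) (S / Q))"
  have s: "0 < s" "s \<le> r" "s \<le> Q / (L + 1)" "s \<le> S / Q"
    using r L Q pos by (auto simp: s_def)
  have sub: "kball a s \<subseteq> kball a r" using s by (auto simp: kball_def)
  have aa: "a \<in> kball a s" using pos s by (intro kball_self)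
  have aar: "a \<in> kball a r" using aa sub by blast
  have "q a \<in> K" "nm (q a) = Q" using aar by (rule qK, rule qQ)
  hence D: "q a \<in> K" "q a \<noteq> 0" "nm (q a) = Q" using Q by auto
  have lin: "nm (\<psi> z - \<psi> w - q a * (z - w)) < nm (q a) * nm (z - w)"
    if z: "z \<in> kball a s" and w: "w \<in> kball a s" and "z \<noteq> w" for z w
  proof -
    have zw: "nm (z - w) > 0" using nm_pos \<open>z \<noteq> w\<close> by simp
    have small: "L * nm (u - a) < Q" if "u \<in> kball a s" for u
    proof -
      have "L * nm (u - a) \<le> (L + 1) * nm (u - a)" by (intro mult_right_mono) (auto simp: nm_nonneg)
      also have "\<dots> < (L + 1) * (Q / (L + 1))"
        using that s(3) L by (intro mult_strict_left_mono) (auto simp: kball_def)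
      finally show ?thesis using L by simp
    qed
    have "\<psi> z - \<psi> w - q a * (z - w) = (z - w) * (q z - q a) + (w - a) * (q z - q w)"
      using z w sub k by (simp add: \<psi> subset_iff algebra_simps)
    moreover have "nm ((z - w) * (q z - q a)) < Q * nm (z - w)"
    proof -
      have "nm (q z - q a) < Q" using qL[of z a] small[OF z] z aa sub by force
      thus ?thesis using zw by (simp add: nm_mult)
    qed
    moreover have "nm ((w - a) * (q z - q w)) < Q * nm (z - w)"
    proof -
      have "nm (w - a) * nm (q z - q w) \<le> nm (w - a) * (L * nm (z - w))"
        using qL[of z w] z w sub by (intro mult_left_mono) (auto simp: nm_nonneg)
      also have "\<dots> = (L * nm (w - a)) * nm (z - w)" by simp
      also have "\<dots> < Q * nm (z - w)" using small[OF w] zw by (intro mult_strict_right_mono)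
      finally show ?thesis by (simp add: nm_mult)
    qed
    ultimately show ?thesis using nm_add_less D(3) by simp
  qed
  have \<psi>K: "\<psi> z \<in> K" if "z \<in> kball a s" for z using \<psi>_in[of z] that sub by (auto simp: kball_def)
  note al = almost_linear[OF pos(5) s(1) D(1,2) \<psi>K lin]
  have "P.scales T (i a) (\<kappa> * s) (\<mu> * nm (q a) / \<kappa>)"
  proof (rule chart_scales[OF chart1 chart2 _ s(1) _ _ _ al(2) al(1)])
    show "a \<in> kball a R" using pos by (intro kball_self)
    show "nm (q a) * s \<le> S" using s(4) Q D(3) by (simp add: field_simps)
    show "\<psi> a \<in> kball b S" using \<psi>_in aa sub by blast
    show "T (i z) = j (\<psi> z)" if "z \<in> kball a s" for z using T_\<psi> that sub by blast
  qed (use s r Q D in auto)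
  thus ?thesis by blast
qed

text \<open>At a point \<open>v \<noteq> a\<close> the slope
  \<open>of_nat (Suc k) * (v - a) ^ k * q v\<close> is nonzero in characteristic \<open>0\<close>.
  It dominates all errors on the ball of radius \<open>nm (of_nat (Suc k)) * nm (v - a)\<close>,
  where \<open>almost_linear\<close> applies; hence \<open>e\<close> and \<open>th\<close> are both
  \<open>nm (of_nat (Suc k))\<close>.\<close>

lemma scales_near_critical:
  "\<exists>\<rho>>0. \<exists>e>0. \<exists>th>0. e \<le> 1 \<and> th \<le> 1 \<and> (\<forall>y\<in>P.mball (i a) \<rho>. y \<noteq> i a \<longrightarrow>
     (\<exists>l. P.scales T y (e * d (i a) y) l \<and> l * d (i a) y = th * d (T (i a)) (T y)))"
proof -
  define e where "e = nm (of_nat (Suc k))"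
  have e: "e > 0" "e \<le> 1"
    unfolding e_def by (rule nm_pos) (simp_all only: of_nat_eq_0_iff nat.distinct nm_of_nat_le not_False_eq_True)
  \<comment> \<open>Ensures \<open>L * t < e * Q\<close> below: the increment of \<open>q\<close>
    must be dominated by the slope, which carries the factor \<open>e\<close>.\<close>
  define s where "s = min r (e * Q / (L + 1))"
  have s: "0 < s" "s \<le> r" "s \<le> e * Q / (L + 1)"
    using r L Q e by (auto simp: s_def)
  have "\<exists>l. P.scales T y (e * d (i a) y) l \<and> l * d (i a) y = e * d (T (i a)) (T y)"
    if y: "y \<in> P.mball (i a) (\<kappa> * s)" "y \<noteq> i a" for y
  proof -
    obtain v where v: "y = i v" "v \<in> kball a s" "v \<in> kball a r" "d (i a) y = \<kappa> * nm (v - a)"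
      using near_point[OF y(1) s(1,2)] by blast
    define t where "t = nm (v - a)"
    have t: "t > 0" unfolding t_def using y(2) v(1) by (intro nm_pos) auto
    have Lt: "L * t < e * Q"
    proof -
      have "L * t \<le> (L + 1) * t" using t by simp
      also have "\<dots> < (L + 1) * (e * Q / (L + 1))"
        using v(2) s(3) L unfolding t_def by (intro mult_strict_left_mono) (auto simp: kball_def)
      finally show ?thesis using L by simp
    qed
    have tr: "t < r" using v(3) by (simp add: t_def kball_def)
    have et: "0 < e * t" "e * t \<le> t" using e t by (auto simp: mult_le_cancel_right1)
    have sub: "kball v (e * t) \<subseteq> kball a r" using kball_sub[OF v(3)] et tr by simp
    have vK: "v \<in> K" using v(3) by (simp add: kball_def)
    define D where "D = of_nat (Suc k) * (v - a) ^ k * q v"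
    have nD: "nm D = e * t ^ k * Q"
      using v(3) unfolding D_def e_def t_def by (simp only: nm_mult nm_power qQ)
    have D: "D \<in> K" "D \<noteq> 0"
    proof -
      show "D \<in> K" unfolding D_def using vK pos v(3)
        by (intro K_mult K_of_nat K_power K_diff qK)
      show "D \<noteq> 0" using nD e t Q by auto
    qed
    have lin: "nm (\<psi> z - \<psi> w - D * (z - w)) < nm D * nm (z - w)"
      if z: "z \<in> kball v (e * t)" and w: "w \<in> kball v (e * t)" and "z \<noteq> w" for z w
    proof -
      have zw: "nm (z - w) > 0" using nm_pos \<open>z \<noteq> w\<close> by simp
      have zr: "z \<in> kball a r" "w \<in> kball a r" using z w sub by auto
      define u where "u = max (nm (z - v)) (nm (w - v))"
      have u: "nm (z - v) \<le> u" "nm (w - v) \<le> u" "u < e * t" "u \<ge> 0"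
        using z w by (auto simp: u_def kball_def nm_nonneg le_max_iff_disj)
      have ut: "u \<le> t" using u et by linarith
      \<comment> \<open>The deviation from the linear map splits into three parts: the nonlinearity
        of the power, the difference of \<open>q z\<close> and \<open>q v\<close> in the slope, and
        the increment of \<open>q\<close> from \<open>w\<close> to \<open>z\<close>.\<close>
      define p1 where "p1 = (z - a) ^ Suc k - (w - a) ^ Suc k - of_nat (Suc k) * (v - a) ^ k * (z - w)"
      have "nm p1 * t \<le> t ^ k * u * nm (z - w)"
        using nm_power_diff_linear[of "v - a" t "z - a" u "w - a" k] u ut
        unfolding p1_def t_def by simp
      also have "\<dots> < t ^ k * (e * t) * nm (z - w)"
        using u t zw by (intro mult_strict_right_mono mult_strict_left_mono) auto
      finally have "nm p1 * t < (e * t ^ k * nm (z - w)) * t" by (simp add: mult_ac)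
      hence p1: "nm p1 < e * t ^ k * nm (z - w)" using t by simp
      have 1: "nm (p1 * q z) < nm D * nm (z - w)"
        using mult_strict_right_mono[OF p1 Q] zr unfolding nD by (simp add: nm_mult qQ mult_ac)
      have 2: "nm (of_nat (Suc k) * (v - a) ^ k * (q z - q v) * (z - w)) < nm D * nm (z - w)"
      proof -
        have "nm (q z - q v) \<le> L * nm (z - v)" using qL zr v(3) by blast
        also have "\<dots> \<le> L * t" using u ut L by (intro mult_left_mono) auto
        also have "\<dots> < e * Q" by (rule Lt)
        also have "\<dots> \<le> Q" using e Q by simp
        finally have "e * t ^ k * nm (q z - q v) * nm (z - w) < e * t ^ k * Q * nm (z - w)"
          using e t zw by (intro mult_strict_right_mono mult_strict_left_mono) auto
        thus ?thesis unfolding nD unfolding e_def t_def by (simp only: nm_mult nm_power)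
      qed
      have 3: "nm ((w - a) ^ Suc k * (q z - q w)) < nm D * nm (z - w)"
      proof -
        have "nm (w - a) \<le> t"
          using nm_ultrametric[of "w - v" "v - a"] u ut by (simp add: t_def)
        hence "nm (w - a) ^ Suc k \<le> t ^ Suc k" by (intro power_mono) (auto simp: nm_nonneg)
        hence "nm (w - a) ^ Suc k * nm (q z - q w) \<le> t ^ Suc k * (L * nm (z - w))"
          using qL zr t by (intro mult_mono) (auto simp: nm_nonneg)
        also have "\<dots> = t ^ k * (L * t) * nm (z - w)" by simp
        also have "\<dots> < t ^ k * (e * Q) * nm (z - w)"
          using Lt t zw by (intro mult_strict_right_mono mult_strict_left_mono) auto
        finally show ?thesis unfolding nD by (simp only: nm_mult nm_power mult_ac)
      qed
      have "\<psi> z - \<psi> w - D * (z - w) = p1 * q z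
          + of_nat (Suc k) * (v - a) ^ k * (q z - q v) * (z - w) + (w - a) ^ Suc k * (q z - q w)"
        unfolding \<psi>_diff[OF zr] p1_def D_def by (simp only: algebra_simps)
      thus ?thesis using 1 2 3 nm_add_less by presburger
    qed
    have \<psi>K: "\<psi> z \<in> K" if "z \<in> kball v (e * t)" for z
      using \<psi>_in[of z] that sub by (auto simp: kball_def)
    note al = almost_linear[OF vK et(1) D \<psi>K lin]
    have \<psi>v: "nm (\<psi> v - b) = t ^ Suc k * Q"
      using v(3) by (simp only: \<psi> add_diff_cancel_left' nm_mult nm_power qQ t_def)
    have \<psi>S: "\<psi> v \<in> kball b S" using \<psi>_in v(3) by blast
    have sc: "P.scales T (i v) (\<kappa> * (e * t)) (\<mu> * nm D / \<kappa>)"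
    proof (rule chart_scales[OF chart1 chart2 _ et(1) _ _ _ al(2) al(1)])
      show "v \<in> kball a R" using v(3) kball_R by blast
      show "e * t \<le> R" using et tr r by linarith
      show "nm D > 0" using nm_pos D by blast
      \<comment> \<open>The radius of the image ball is at most \<open>nm (\<psi> v - b)\<close>,
        which is below \<open>S\<close> as \<open>\<psi> v\<close> lies in the target chart.\<close>
      have "nm D * (e * t) = e * e * (t ^ Suc k * Q)" unfolding nD by (simp add: mult_ac)
      also have "\<dots> \<le> 1 * (t ^ Suc k * Q)"
        using e t Q by (intro mult_right_mono mult_le_one) auto
      also have "\<dots> < S" using \<psi>S \<psi>v by (simp add: kball_def)
      finally show "nm D * (e * t) \<le> S" by simp
      show "T (i z) = j (\<psi> z)" if "z \<in> kball v (e * t)" for z using T_\<psi> that sub by blast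
    qed (use \<psi>S in auto)
    have dy: "d (i a) y = \<kappa> * t" using v(4) by (simp add: t_def)
    have aa: "a \<in> kball a r" using pos r by (intro kball_self)
    have "\<psi> a = b" using \<psi>[OF aa] by simp
    hence Ta: "T (i a) = j b" using T_\<psi>[OF aa] by simp
    have "d (T (i a)) (T y) = \<mu> * nm (b - \<psi> v)"
      unfolding Ta v(1) T_\<psi>[OF v(3)] using \<psi>S pos by (intro chart_dist[OF chart2] kball_self)
    also have "\<dots> = \<mu> * (t ^ Suc k * Q)" using \<psi>v by (simp add: nm_minus_commute)
    finally have dT: "d (T (i a)) (T y) = \<mu> * (t ^ Suc k * Q)" .
    have "e * d (i a) y = \<kappa> * (e * t)" by (simp add: dy)
    hence "P.scales T y (e * d (i a) y) (\<mu> * nm D / \<kappa>)" using sc v(1) by (simp only:)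
    moreover have "\<mu> * nm D / \<kappa> * d (i a) y = e * d (T (i a)) (T y)"
      unfolding dy dT nD using pos(1) by simp
    ultimately show ?thesis by blast
  qed
  thus ?thesis using e s pos(1) by (intro exI[of _ "\<kappa> * s"] conjI exI[of _ e]) auto
qed

text \<open>For \<open>k \<ge> 1\<close> both terms of \<open>\<psi>_diff\<close> gain a factor
  \<open>s\<close> on the ball of radius \<open>s \<le> 1\<close>. The factor
  \<open>\<kappa> / \<mu>\<close> in \<open>\<epsilon>\<close> translates between the charts and the
  metric.\<close>

lemma contracts_near_critical:
  assumes k: "k \<ge> 1" and \<eta>: "\<eta> > 0"
  shows "\<exists>\<rho>>0. \<forall>y\<in>P.mball (i a) \<rho>. \<forall>z\<in>P.mball (i a) \<rho>. d (T y) (T z) \<le> \<eta> * d y z"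
proof -
  define \<epsilon> where "\<epsilon> = \<eta> * \<kappa> / \<mu>"
  have \<epsilon>: "\<epsilon> > 0" using \<eta> pos by (simp add: \<epsilon>_def)
  define s where "s = min r (min 1 (\<epsilon> / (Q + L + 1)))"
  have s: "0 < s" "s \<le> r" "s \<le> 1" "s \<le> \<epsilon> / (Q + L + 1)"
    using r L Q \<epsilon> by (auto simp: s_def)
  have sQL: "s * Q \<le> \<epsilon>" "s * L \<le> \<epsilon>"
  proof -
    have "s * (Q + L + 1) \<le> \<epsilon>" using s(4) Q L by (simp add: field_simps)
    moreover have "s * Q \<le> s * (Q + L + 1)" "s * L \<le> s * (Q + L + 1)" using s Q L by auto
    ultimately show "s * Q \<le> \<epsilon>" "s * L \<le> \<epsilon>" by linarith+
  qed
  have "d (T y) (T z) \<le> \<eta> * d y z"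
    if y: "y \<in> P.mball (i a) (\<kappa> * s)" and z: "z \<in> P.mball (i a) (\<kappa> * s)" for y z
  proof -
    obtain v where v: "y = i v" "v \<in> kball a s" "v \<in> kball a r" using near_point[OF y s(1,2)] by blast
    obtain w where w: "z = i w" "w \<in> kball a s" "w \<in> kball a r" using near_point[OF z s(1,2)] by blast
    have vs: "nm (v - a) \<le> s" "nm (w - a) \<le> s" using v w by (auto simp: kball_def)
    have sk: "s ^ k \<le> s" using s k power_decreasing[of 1 k s] by simp
    have "nm (((v - a) ^ Suc k - (w - a) ^ Suc k) * q v) \<le> \<epsilon> * nm (v - w)"
    proof -
      have "nm ((v - a) ^ Suc k - (w - a) ^ Suc k) \<le> s ^ k * nm (v - w)"
        using nm_power_diff[OF vs, of k] by simp
      also have "\<dots> \<le> s * nm (v - w)" using sk by (intro mult_right_mono) (auto simp: nm_nonneg)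
      finally have "nm ((v - a) ^ Suc k - (w - a) ^ Suc k) * Q \<le> s * nm (v - w) * Q"
        using Q by (intro mult_right_mono) auto
      also have "\<dots> = s * Q * nm (v - w)" by simp
      also have "\<dots> \<le> \<epsilon> * nm (v - w)" using sQL by (intro mult_right_mono) (auto simp: nm_nonneg)
      finally show ?thesis using v(3) by (simp only: nm_mult qQ)
    qed
    moreover have "nm ((w - a) ^ Suc k * (q v - q w)) \<le> \<epsilon> * nm (v - w)"
    proof -
      have "nm (w - a) ^ Suc k \<le> s ^ Suc k" using vs by (intro power_mono) (auto simp: nm_nonneg)
      also have "\<dots> \<le> s" using s power_decreasing[of 1 "Suc k" s] by simp
      finally have "nm (w - a) ^ Suc k * nm (q v - q w) \<le> s * (L * nm (v - w))"
        using qL v(3) w(3) s by (intro mult_mono) (auto simp: nm_nonneg)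
      also have "\<dots> = s * L * nm (v - w)" by simp
      also have "\<dots> \<le> \<epsilon> * nm (v - w)" using sQL by (intro mult_right_mono) (auto simp: nm_nonneg)
      finally show ?thesis by (simp only: nm_mult nm_power)
    qed
    ultimately have "nm (\<psi> v - \<psi> w) \<le> \<epsilon> * nm (v - w)"
      unfolding \<psi>_diff[OF v(3) w(3)] by (intro order_trans[OF nm_ultrametric max.boundedI])
    hence "\<mu> * nm (\<psi> v - \<psi> w) \<le> \<mu> * (\<epsilon> * nm (v - w))" using pos by simp
    also have "\<dots> = \<eta> * (\<kappa> * nm (v - w))" using pos by (simp add: \<epsilon>_def)
    also have "\<kappa> * nm (v - w) = d y z"
      using chart_dist[OF chart1 subsetD[OF kball_R v(3)] subsetD[OF kball_R w(3)]] v(1) w(1) by simp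
    also have "\<mu> * nm (\<psi> v - \<psi> w) = d (T y) (T z)"
      using chart_dist[OF chart2 \<psi>_in \<psi>_in] T_\<psi> v w by auto
    finally show ?thesis .
  qed
  thus ?thesis using s pos by (intro exI[of _ "\<kappa> * s"]) auto
qed

end

section \<open>Compactness of balls in a finite extension\<close>

context nonarch_absolute_value
begin

text \<open>Stated for arbitrary sets, because the induction on generators passes through spans that
  need not be fields.\<close>

definition bolzano_weierstrass :: "'c set \<Rightarrow> bool" where
  "bolzano_weierstrass V \<longleftrightarrow> (\<forall>(\<sigma> :: nat \<Rightarrow> 'c) r. range \<sigma> \<subseteq> V \<and> (\<forall>n. nm (\<sigma> n) \<le> r) \<longrightarrow>
     (\<exists>l\<in>V. \<exists>f. strict_mono f \<and> (\<lambda>n::nat. nm (\<sigma> (f n) - l)) \<longlonglongrightarrow> 0))"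

lemma bolzano_weierstrassD:
  assumes "bolzano_weierstrass V" "\<And>n. \<sigma> n \<in> V" "\<And>n. nm (\<sigma> n) \<le> r"
  obtains l f where "l \<in> V" "strict_mono (f :: nat \<Rightarrow> nat)" "(\<lambda>n. nm (\<sigma> (f n) - l)) \<longlonglongrightarrow> 0"
  using assms unfolding bolzano_weierstrass_def by (metis image_subsetI)

text \<open>A sequence in \<open>V\<close> approaching \<open>b\<close> is bounded, and a limit of a
  subsequence in \<open>V\<close> would have to be \<open>b\<close>. The resulting positive distance
  bounds coefficients when \<open>b\<close> is adjoined.\<close>

lemma bolzano_weierstrass_closed:
  assumes V: "bolzano_weierstrass V" and b: "b \<notin> V"
  shows "\<exists>\<delta>>0. \<forall>v\<in>V. \<delta> \<le> nm (b - v)"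
proof (rule ccontr)
  assume "\<not> ?thesis"
  hence "\<exists>v\<in>V. nm (b - v) < 1 / Suc n" for n
    by (metis not_le of_nat_0_less_iff zero_less_Suc zero_less_divide_1_iff)
  then obtain v where v: "\<And>n. v n \<in> V" "\<And>n. nm (b - v n) < 1 / Suc n" by metis
  have bd: "nm (v n) \<le> max 1 (nm b)" for n
  proof -
    have "1 / real (Suc n) \<le> 1" by simp
    hence "nm (b - v n) \<le> 1" using v(2)[of n] by linarith
    thus ?thesis using nm_diff_le[of b "b - v n"] by auto
  qed
  obtain l f where l: "l \<in> V" "strict_mono f" "(\<lambda>n. nm (v (f n) - l)) \<longlonglongrightarrow> 0"
    by (rule bolzano_weierstrassD[OF V v(1) bd])
  have "(\<lambda>n. 1 / real (Suc n)) \<longlonglongrightarrow> 0" using LIMSEQ_inverse_real_of_nat by (simp add: inverse_eq_divide)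
  hence "(\<lambda>n. 1 / real (Suc (f n))) \<longlonglongrightarrow> 0" using LIMSEQ_subseq_LIMSEQ[OF _ l(2)] by (simp add: comp_def)
  hence "(\<lambda>n. 1 / real (Suc (f n)) + nm (v (f n) - l)) \<longlonglongrightarrow> 0 + 0" using l(3) by (intro tendsto_add)
  moreover have "nm (b - l) \<le> 1 / real (Suc (f n)) + nm (v (f n) - l)" for n
    using nm_triangle[of "b - v (f n)" "v (f n) - l"] v(2)[of "f n"] by simp
  ultimately have "nm (b - l) \<le> 0" using LIMSEQ_le_const[of _ "0 + 0::real"] by force
  hence "b = l" using nm_nonneg[of "b - l"] nm_eq_0_iff[of "b - l"] by simp
  thus False using b l(1) by simp
qed

text \<open>With \<open>\<delta>\<close> the distance bound from \<open>b\<close> to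
  \<open>V\<close>, scaling gives \<open>nm c * \<delta> \<le> nm (v + c * b)\<close>. So both
  components of a bounded sequence are bounded, and two successive passages to subsequences make
  them converge.\<close>

lemma bolzano_weierstrass_adjoin:
  assumes F: "subfield_set F" "bolzano_weierstrass F" and V: "bolzano_weierstrass V"
    and scale: "\<And>c v. c \<in> F \<Longrightarrow> v \<in> V \<Longrightarrow> c * v \<in> V" and b: "b \<notin> V"
  shows "bolzano_weierstrass {v + c * b |v c. v \<in> V \<and> c \<in> F}"
  unfolding bolzano_weierstrass_def
proof (intro allI impI)
  fix \<sigma> :: "nat \<Rightarrow> 'c" and r
  assume \<sigma>: "range \<sigma> \<subseteq> {v + c * b |v c. v \<in> V \<and> c \<in> F} \<and> (\<forall>n. nm (\<sigma> n) \<le> r)"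
  hence "\<exists>v c. v \<in> V \<and> c \<in> F \<and> \<sigma> n = v + c * b" for n by blast
  then obtain v c where vc: "\<And>n. v n \<in> V" "\<And>n. c n \<in> F" "\<And>n. \<sigma> n = v n + c n * b" by metis
  obtain \<delta> where \<delta>: "\<delta> > 0" "\<And>v. v \<in> V \<Longrightarrow> \<delta> \<le> nm (b - v)"
    using bolzano_weierstrass_closed[OF V b] by blast
  have r0: "r \<ge> 0" using \<sigma> nm_nonneg[of "\<sigma> 0"] order_trans by blast
  have cb: "nm (c n) \<le> r / \<delta>" for n
  proof (cases "c n = 0")
    case False
    have "- inverse (c n) \<in> F" using F(1) vc(2) by (simp add: subfield_set_def)
    hence "- inverse (c n) * v n \<in> V" using scale vc(1) by blast
    hence "nm (c n) * \<delta> \<le> nm (c n) * nm (b - (- inverse (c n) * v n))"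
      using \<delta>(2) nm_nonneg by (intro mult_left_mono)
    also have "\<dots> = nm (\<sigma> n)"
    proof -
      have "c n * (b - (- inverse (c n) * v n)) = \<sigma> n" unfolding vc(3) using False by (simp add: field_simps)
      thus ?thesis by (metis nm_mult)
    qed
    also have "\<dots> \<le> r" using \<sigma> by blast
    finally show ?thesis using \<delta>(1) by (simp add: field_simps)
  qed (use r0 \<delta> in simp)
  obtain c' f where c': "c' \<in> F" "strict_mono f" "(\<lambda>n. nm (c (f n) - c')) \<longlonglongrightarrow> 0"
    by (rule bolzano_weierstrassD[OF F(2) vc(2) cb])
  have bd: "nm (v (f n)) \<le> max r (r / \<delta> * nm b)" for n
  proof -
    have "nm (v (f n)) \<le> max (nm (\<sigma> (f n))) (nm (c (f n) * b))"
      using nm_diff_le[of "\<sigma> (f n)" "c (f n) * b"] vc(3)[of "f n"] by simp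
    moreover have "nm (c (f n) * b) \<le> r / \<delta> * nm b"
      unfolding nm_mult using cb by (intro mult_right_mono) (auto simp: nm_nonneg)
    moreover have "nm (\<sigma> (f n)) \<le> r" using \<sigma> by blast
    ultimately show ?thesis by linarith
  qed
  obtain v' g where v': "v' \<in> V" "strict_mono g" "(\<lambda>n. nm (v (f (g n)) - v')) \<longlonglongrightarrow> 0"
    by (rule bolzano_weierstrassD[OF V vc(1) bd])
  have "(\<lambda>n. nm (c (f (g n)) - c')) \<longlonglongrightarrow> 0"
    using LIMSEQ_subseq_LIMSEQ[OF c'(3) v'(2)] by (simp add: comp_def)
  hence "(\<lambda>n. nm (v (f (g n)) - v') + nm (c (f (g n)) - c') * nm b) \<longlonglongrightarrow> 0 + 0 * nm b"
    using v'(3) by (intro tendsto_add tendsto_mult tendsto_const)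
  hence lim: "(\<lambda>n. nm (v (f (g n)) - v') + nm (c (f (g n)) - c') * nm b) \<longlonglongrightarrow> 0" by simp
  have "nm (\<sigma> (f (g n)) - (v' + c' * b)) \<le> nm (v (f (g n)) - v') + nm (c (f (g n)) - c') * nm b" for n
  proof -
    have "\<sigma> (f (g n)) - (v' + c' * b) = (v (f (g n)) - v') + (c (f (g n)) - c') * b"
      by (simp add: vc(3) algebra_simps)
    thus ?thesis using nm_triangle by (metis nm_mult)
  qed
  hence "(\<lambda>n. nm (\<sigma> (f (g n)) - (v' + c' * b))) \<longlonglongrightarrow> 0"
    by (intro Lim_null_comparison[OF _ lim]) (simp add: nm_nonneg)
  moreover have "strict_mono (f \<circ> g)" using c'(2) v'(2) by (rule strict_mono_o)
  ultimately show "\<exists>l\<in>{v + c * b |v c. v \<in> V \<and> c \<in> F}. \<exists>f. strict_mono f \<and> (\<lambda>n. nm (\<sigma> (f n) - l)) \<longlonglongrightarrow> 0"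
    using v'(1) c'(1) by (intro bexI[of _ "v' + c' * b"] exI[of _ "f \<circ> g"]) (auto simp: comp_def)
qed

text \<open>\<open>B\<close> may be linearly dependent: a generator already in the span adds
  nothing, and any other one is adjoined.\<close>

lemma bolzano_weierstrass_span:
  assumes F: "subfield_set F" "bolzano_weierstrass F" and "finite B"
  shows "bolzano_weierstrass {\<Sum>b\<in>B. c b * b |c. \<forall>b\<in>B. c b \<in> F}"
  using assms(3)
proof (induction B rule: finite_induct)
  case empty
  show ?case
    unfolding bolzano_weierstrass_def
  proof (intro allI impI)
    fix \<sigma> :: "nat \<Rightarrow> 'c" and r
    assume "range \<sigma> \<subseteq> {\<Sum>b\<in>{}. c b * b |c. \<forall>b\<in>{}. c b \<in> F} \<and> (\<forall>n. nm (\<sigma> n) \<le> r)"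
    hence "\<sigma> n = 0" for n by (auto simp: image_subset_iff)
    hence "(\<lambda>n. nm (\<sigma> (id n) - 0)) \<longlonglongrightarrow> 0" by simp
    moreover have "strict_mono (id :: nat \<Rightarrow> nat)" by (simp add: strict_mono_def)
    ultimately show "\<exists>l\<in>{\<Sum>b\<in>{}. c b * b |c. \<forall>b\<in>{}. c b \<in> F}. \<exists>f. strict_mono f \<and>
        (\<lambda>n. nm (\<sigma> (f n) - l)) \<longlonglongrightarrow> 0"
      by (intro bexI[of _ 0]) auto
  qed
next
  case (insert b B)
  let ?V = "{\<Sum>b\<in>B. c b * b |c. \<forall>b\<in>B. c b \<in> F}"
  have scale: "c * v \<in> ?V" if cF: "c \<in> F" and v: "v \<in> ?V" for c v
  proof -
    obtain e where e: "v = (\<Sum>b\<in>B. e b * b)" "\<forall>b\<in>B. e b \<in> F" using v by blast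
    have "c * v = (\<Sum>b\<in>B. (c * e b) * b)" by (simp add: e(1) sum_distrib_left mult.assoc)
    moreover have "\<forall>b\<in>B. c * e b \<in> F" using e(2) cF F(1) by (simp add: subfield_set_def)
    ultimately show ?thesis by (intro CollectI exI[of _ "\<lambda>b. c * e b"]) simp
  qed
  have add: "v + w \<in> ?V" if vw: "v \<in> ?V" "w \<in> ?V" for v w
  proof -
    obtain e e' where e: "v = (\<Sum>b\<in>B. e b * b)" "\<forall>b\<in>B. e b \<in> F"
      "w = (\<Sum>b\<in>B. e' b * b)" "\<forall>b\<in>B. e' b \<in> F" using vw by blast
    have "v + w = (\<Sum>b\<in>B. (e b + e' b) * b)" by (simp add: e sum.distrib distrib_right)
    moreover have "\<forall>b\<in>B. e b + e' b \<in> F" using e F(1) by (simp add: subfield_set_def)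
    ultimately show ?thesis by (intro CollectI exI[of _ "\<lambda>b. e b + e' b"]) simp
  qed
  have split: "{\<Sum>b\<in>insert b B. c b * b |c. \<forall>b\<in>insert b B. c b \<in> F} = {v + c * b |v c. v \<in> ?V \<and> c \<in> F}"
    (is "?L = ?R")
  proof (intro equalityI subsetI)
    fix x assume "x \<in> ?L"
    then obtain e where e: "x = (\<Sum>b\<in>insert b B. e b * b)" "\<forall>b\<in>insert b B. e b \<in> F" by blast
    have "x = (\<Sum>b\<in>B. e b * b) + e b * b" using e(1) insert.hyps by (simp add: add.commute)
    thus "x \<in> ?R" using e(2) by blast
  next
    fix x assume "x \<in> ?R"
    then obtain e c where e: "x = (\<Sum>b\<in>B. e b * b) + c * b" "\<forall>b\<in>B. e b \<in> F" "c \<in> F" by blast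
    define e' where "e' = e(b := c)"
    have e': "e' b = c" "\<And>b'. b' \<in> B \<Longrightarrow> e' b' = e b'" using insert.hyps(2) by (auto simp: e'_def)
    have "(\<Sum>b\<in>insert b B. e' b * b) = e' b * b + (\<Sum>b\<in>B. e' b * b)"
      by (rule sum.insert[OF insert.hyps])
    also have "(\<Sum>b\<in>B. e' b * b) = (\<Sum>b\<in>B. e b * b)" using e'(2) by (intro sum.cong) auto
    finally have "x = (\<Sum>b\<in>insert b B. e' b * b)" using e(1) e'(1) by (simp add: add.commute)
    moreover have "\<forall>b'\<in>insert b B. e' b' \<in> F" using e e' by simp
    ultimately show "x \<in> ?L" by (intro CollectI exI[of _ e'] conjI)
  qed
  show ?case
  proof (cases "b \<in> ?V")
    case True
    have "{v + c * b |v c. v \<in> ?V \<and> c \<in> F} = ?V"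
    proof (intro equalityI subsetI)
      fix x assume "x \<in> {v + c * b |v c. v \<in> ?V \<and> c \<in> F}"
      then obtain v c where "x = v + c * b" "v \<in> ?V" "c \<in> F" by blast
      thus "x \<in> ?V" using add scale True by presburger
    next
      fix x assume "x \<in> ?V"
      moreover have "x = x + 0 * b" by simp
      moreover have "0 \<in> F" using F(1) by (simp add: subfield_set_def)
      ultimately show "x \<in> {v + c * b |v c. v \<in> ?V \<and> c \<in> F}" by blast
    qed
    thus ?thesis unfolding split using insert.IH by simp
  next
    case False
    show ?thesis unfolding split by (rule bolzano_weierstrass_adjoin[OF F insert.IH scale False])
  qed
qed

lemma bolzano_weierstrass_compact:
  assumes V: "bolzano_weierstrass V"
  shows "compactin (Metric_space.mtopology V (\<lambda>x y. nm (x - y))) {z \<in> V. nm z \<le> r}"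
proof -
  interpret U: Metric_space UNIV "\<lambda>x y. nm (x - y)" by (rule Metric_space_nm)
  interpret M: Metric_space V "\<lambda>x y. nm (x - y)" by (rule U.subspace) simp
  show ?thesis
    unfolding M.compactin_sequentially
  proof (intro conjI allI impI)
    fix \<sigma> :: "nat \<Rightarrow> 'c" assume \<sigma>: "range \<sigma> \<subseteq> {z \<in> V. nm z \<le> r}"
    then obtain l f where l: "l \<in> V" "strict_mono f" "(\<lambda>n. nm (\<sigma> (f n) - l)) \<longlonglongrightarrow> 0"
      by (elim bolzano_weierstrassD[OF V, of \<sigma> r, rotated -1]) auto
    have "nm l \<le> r"
    proof (rule ccontr)
      assume "\<not> nm l \<le> r"
      moreover have "r \<ge> 0" using \<sigma> nm_nonneg[of "\<sigma> 0"] order_trans by blast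
      ultimately have "nm l > 0" by linarith
      hence "\<forall>\<^sub>F n in sequentially. nm (\<sigma> (f n) - l) < nm l" using l(3) by (rule order_tendstoD(2)[rotated])
      then obtain n where "nm (\<sigma> (f n) - l) < nm l" by (meson eventually_happens trivial_limit_sequentially)
      hence "nm (\<sigma> (f n)) = nm l" by (rule nm_eq_of_less)
      moreover have "nm (\<sigma> (f n)) \<le> r" using \<sigma> by blast
      ultimately show False using \<open>\<not> nm l \<le> r\<close> by simp
    qed
    moreover have "limitin M.mtopology (\<sigma> \<circ> f) l sequentially"
      unfolding M.limitin_metric_dist_null using l \<sigma> by (auto simp: image_subset_iff)
    ultimately show "\<exists>l f. l \<in> {z \<in> V. nm z \<le> r} \<and> strict_mono f \<and> limitin M.mtopology (\<sigma> \<circ> f) l sequentially"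
      using l by blast
  qed auto
qed

end

section \<open>Compactness over the p-adic numbers\<close>

context padic_complex_numbers
begin

lemma nm_of_int_unit:
  assumes "prime p" "\<not> int p dvd m" shows "nm (of_int m) = 1"
proof -
  have "m \<noteq> 0" using assms(2) by auto
  moreover have "quotient_of (of_int m) = (m, 1)" by (rule quotient_of_rat_of_int)
  ultimately have "padic_abs_rat p (of_int m) = 1"
    using assms by (simp add: padic_abs_rat_def not_dvd_imp_multiplicity_0)
  thus ?thesis using nm_of_rat[of "of_int m"] by simp
qed

lemma nm_p:
  assumes "prime p" shows "nm (of_nat p) = 1 / real p"
proof -
  have p: "p \<noteq> 0" "p \<noteq> 1" using assms by (auto dest: prime_gt_1_nat)
  have "quotient_of (of_int (int p)) = (int p, 1)" by (rule quotient_of_rat_of_int)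
  moreover have "multiplicity (int p) (int p) = 1" using p by (intro multiplicity_self) auto
  ultimately have "padic_abs_rat p (of_int (int p)) = real p powi (- 1)"
    using p by (simp add: padic_abs_rat_def)
  thus ?thesis using nm_of_rat[of "of_int (int p)"] by (simp add: power_int_minus inverse_eq_divide)
qed

lemma nm_of_int_le: "nm (of_int m) \<le> 1"
proof (cases m)
  case (nonneg n) thus ?thesis using nm_of_nat_le[of n] by simp
next
  case (neg n)
  have "nm (of_int m) = nm (of_nat (Suc n))" unfolding neg by (simp del: of_nat_Suc add: nm_minus)
  thus ?thesis using nm_of_nat_le[of "Suc n"] by (simp only:)
qed

text \<open>By density \<open>y\<close> is close to a rational of absolute value at most
  \<open>1\<close>. In lowest terms its denominator is prime to \<open>p\<close>, hence invertible
  modulo \<open>p ^ k\<close>, and a residue takes the place of the fraction. The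
  \<open>p ^ k\<close> residues form a finite net of the unit ball.\<close>

lemma integer_approximation:
  assumes p: "prime p" and y: "y \<in> Qp" "nm y \<le> 1"
  shows "\<exists>a<p ^ k. nm (y - of_nat a) \<le> (1 / real p) ^ k"
proof -
  interpret U: Metric_space UNIV "\<lambda>x y. nm (x - y)" by (rule Metric_space_nm)
  interpret Q: Metric_space Qp "\<lambda>x y. nm (x - y)" by (rule U.subspace) simp
  have p1: "real p > 1" using p prime_gt_1_nat by simp
  hence ek: "(1 / real p) ^ k > 0" "(1 / real p) ^ k \<le> 1" by (simp_all add: power_le_one)
  have "y \<in> Q.mtopology closure_of \<rat>" using Rats_dense_Qp y(1) by simp
  hence "\<exists>q\<in>\<rat>. q \<in> Q.mball y ((1 / real p) ^ k)" using ek(1) unfolding Q.metric_closure_of by blast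
  then obtain \<rho> where \<rho>: "nm (y - of_rat \<rho>) < (1 / real p) ^ k" by (auto simp: Rats_def)
  have "nm (of_rat \<rho>) \<le> 1"
    using nm_diff_le[of y "y - of_rat \<rho>"] \<rho> y(2) ek(2) by auto
  obtain n d where nd: "quotient_of \<rho> = (n, d)" by (cases "quotient_of \<rho>")
  have d: "d > 0" "coprime n d" "\<rho> = of_int n / of_int d"
    using quotient_of_denom_pos[OF nd] quotient_of_coprime[OF nd] quotient_of_div[OF nd] by auto
  have \<rho>': "of_rat \<rho> = (of_int n / of_int d :: 'c)" by (simp add: d(3) of_rat_divide)
  have dvd: "nm (of_int (int p * m)) < 1" for m
  proof -
    have "nm (of_nat p * of_int m) \<le> 1 / real p * 1"
      unfolding nm_mult using nm_p[OF p] nm_of_int_le p1 by (intro mult_mono) (auto simp: nm_nonneg)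
    also have "\<dots> < 1" using p1 by simp
    finally show ?thesis by simp
  qed
  have "\<not> int p dvd d"
  proof
    assume pd: "int p dvd d"
    hence "nm (of_int d) < 1" using dvd by (auto simp: dvd_def)
    moreover have "nm (of_int n) \<le> nm (of_int d)"
    proof -
      have "nm (of_int d) > 0" using d(1) by (intro nm_pos) simp
      thus ?thesis using \<open>nm (of_rat \<rho>) \<le> 1\<close> unfolding \<rho>' nm_divide by (simp add: field_simps)
    qed
    ultimately have "int p dvd n" using nm_of_int_unit[OF p, of n] by fastforce
    hence "int p dvd 1" using pd d(2) by (metis coprime_common_divisor)
    thus False using p by simp
  qed
  hence nd1: "nm (of_int d) = 1" by (rule nm_of_int_unit[OF p])
  have "coprime d (int p ^ k)"
    using \<open>\<not> int p dvd d\<close> p by (metis coprime_commute coprime_power_left_iff prime_imp_coprime prime_nat_int_transfer)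
  then obtain u v where uv: "u * d + v * int p ^ k = 1"
    using bezout_int[of d "int p ^ k"] by (metis coprime_imp_gcd_eq_1)
  define a where "a = nat ((n * u) mod int p ^ k)"
  have pk: "int p ^ k > 0" using p prime_gt_0_nat by simp
  have a: "a < p ^ k"
  proof -
    have "(n * u) mod int p ^ k < int p ^ k" using pk by simp
    thus ?thesis unfolding a_def using pk by (simp add: nat_less_iff)
  qed
  obtain w where w: "int a = n * u + int p ^ k * w"
  proof -
    have "int a = n * u - int p ^ k * ((n * u) div int p ^ k)"
      using pk by (simp add: a_def minus_mult_div_eq_mod)
    thus thesis using that[of "- ((n * u) div int p ^ k)"] by simp
  qed
  have "n - d * int a = n * (u * d + v * int p ^ k) - d * (n * u + int p ^ k * w)"
    using uv w by simp
  also have "\<dots> = int p ^ k * (n * v - d * w)" by (simp add: algebra_simps)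
  finally have "of_int (n - d * int a) = (of_nat p ^ k * of_int (n * v - d * w) :: 'c)"
    by (metis of_int_mult of_int_of_nat_eq of_int_power)
  hence num: "nm (of_int (n - d * int a)) \<le> (1 / real p) ^ k * 1"
    using nm_of_int_le[of "n * v - d * w"] ek nm_p[OF p]
    by (simp add: nm_mult nm_power mult_left_le del: of_int_diff of_int_mult)
  have "of_rat \<rho> - of_nat a = (of_int (n - d * int a) / of_int d :: 'c)"
    using d(1) by (simp add: \<rho>' field_simps)
  hence "nm (of_rat \<rho> - of_nat a) \<le> (1 / real p) ^ k"
    using num nd1 by (simp add: nm_divide)
  hence "nm ((y - of_rat \<rho>) + (of_rat \<rho> - of_nat a)) \<le> (1 / real p) ^ k"
    using \<rho> by (intro order_trans[OF nm_ultrametric]) auto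
  thus ?thesis using a by auto
qed

lemma Qp_of_nat: "of_nat n \<in> Qp"
  using Qp_subfield by (induction n) (auto simp: subfield_set_def)

text \<open>Multiplication by \<open>p ^ e\<close> moves the ball into the unit ball, where residues
  give finite nets. Total boundedness yields a Cauchy subsequence, and completeness its
  limit.\<close>

lemma bolzano_weierstrass_Qp:
  assumes p: "prime p"
  shows "bolzano_weierstrass Qp"
  unfolding bolzano_weierstrass_def
proof (intro allI impI)
  interpret U: Metric_space UNIV "\<lambda>x y. nm (x - y)" by (rule Metric_space_nm)
  interpret Q: Metric_space Qp "\<lambda>x y. nm (x - y)" by (rule U.subspace) simp
  fix \<sigma> :: "nat \<Rightarrow> 'c" and r assume \<sigma>: "range \<sigma> \<subseteq> Qp \<and> (\<forall>n. nm (\<sigma> n) \<le> r)"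
  have p1: "real p > 1" using p prime_gt_1_nat by simp
  obtain e where e: "r < real p ^ e" using real_arch_pow[OF p1] by blast
  define P :: 'c where "P = of_nat p ^ e"
  have P: "P \<in> Qp" "nm P = (1 / real p) ^ e" "P \<noteq> 0"
  proof -
    show "P \<in> Qp" using Qp_of_nat[of "p ^ e"] by (simp add: P_def)
    show "nm P = (1 / real p) ^ e" using nm_p[OF p] by (simp add: P_def nm_power)
    thus "P \<noteq> 0" using p1 by auto
  qed
  have mult: "x * y \<in> Qp" "x / y \<in> Qp" if "x \<in> Qp" "y \<in> Qp" for x y
    using Qp_subfield that by (auto simp: subfield_set_def divide_inverse)
  define B where "B = {x \<in> Qp. nm x \<le> real p ^ e}"
  have "Q.mtotally_bounded B"
    unfolding Q.mtotally_bounded_def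
  proof (intro allI impI)
    fix \<epsilon> :: real assume \<epsilon>: "\<epsilon> > 0"
    have "\<epsilon> / real p ^ e > 0" using \<epsilon> p1 by simp
    then obtain k where k: "(1 / real p) ^ k < \<epsilon> / real p ^ e"
      using real_arch_pow_inv[of _ "1 / real p"] p1 by auto
    define N where "N = (\<lambda>a. of_nat a / P) ` {..<p ^ k}"
    have "N \<subseteq> B"
    proof
      fix x assume "x \<in> N"
      then obtain a where a: "x = of_nat a / P" by (auto simp: N_def)
      have "nm x \<le> real p ^ e"
        using nm_of_nat_le[of a] p1 by (simp add: a nm_divide P(2) field_simps)
      thus "x \<in> B" using a mult(2)[OF Qp_of_nat P(1)] by (simp add: B_def)
    qed
    moreover have "B \<subseteq> (\<Union>x\<in>N. Q.mball x \<epsilon>)"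
    proof
      fix x assume x: "x \<in> B"
      have "nm (x * P) \<le> real p ^ e * (1 / real p) ^ e"
        using x unfolding nm_mult P(2) B_def by (intro mult_right_mono) auto
      also have "\<dots> = 1" using p1 by (simp flip: power_mult_distrib)
      finally obtain a where a: "a < p ^ k" "nm (x * P - of_nat a) \<le> (1 / real p) ^ k"
        using integer_approximation[OF p mult(1)[of x P]] x P(1) by (auto simp: B_def)
      have "of_nat a / P - x = (of_nat a - x * P) / P" using P(3) by (simp add: field_simps)
      hence "nm (of_nat a / P - x) = nm (x * P - of_nat a) * real p ^ e"
        using p1 by (simp add: nm_divide P(2) nm_minus_commute field_simps)
      also have "\<dots> \<le> (1 / real p) ^ k * real p ^ e" using a(2) by (intro mult_right_mono) auto
      also have "\<dots> < \<epsilon>" using k p1 by (simp add: field_simps)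
      finally have "x \<in> Q.mball (of_nat a / P) \<epsilon>"
        using x mult(2)[OF Qp_of_nat P(1), of a] by (simp add: B_def)
      thus "x \<in> (\<Union>x\<in>N. Q.mball x \<epsilon>)" using a(1) by (auto simp: N_def)
    qed
    ultimately show "\<exists>N. finite N \<and> N \<subseteq> B \<and> B \<subseteq> (\<Union>x\<in>N. Q.mball x \<epsilon>)"
      by (intro exI[of _ N]) (auto simp: N_def)
  qed
  moreover have "range \<sigma> \<subseteq> B" using \<sigma> e by (auto simp: B_def image_subset_iff intro: order_trans less_imp_le)
  ultimately obtain f where f: "strict_mono f" "Q.MCauchy (\<sigma> \<circ> f)"
    unfolding Q.mtotally_bounded_sequentially by blast
  obtain l where "limitin Q.mtopology (\<sigma> \<circ> f) l sequentially"
    using Qp_complete f(2) unfolding Q.mcomplete_def by blast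
  hence "l \<in> Qp" "(\<lambda>n. nm (\<sigma> (f n) - l)) \<longlonglongrightarrow> 0"
    unfolding Q.limitin_metric_dist_null by (auto simp: comp_def)
  thus "\<exists>l\<in>Qp. \<exists>f. strict_mono f \<and> (\<lambda>n. nm (\<sigma> (f n) - l)) \<longlonglongrightarrow> 0" using f(1) by blast
qed

lemma finite_extension_local_field:
  assumes p: "prime p" and K: "finite_extension_of Qp K"
  shows "local_field nm K"
proof
  obtain B where B: "finite B" "B \<subseteq> K"
    "\<And>x. x \<in> K \<Longrightarrow> \<exists>c. (\<forall>b\<in>B. c b \<in> Qp) \<and> x = (\<Sum>b\<in>B. c b * b)"
    using K unfolding finite_extension_of_def by blast
  show sub: "subfield_set K" using K by (simp add: finite_extension_of_def)
  have QK: "Qp \<subseteq> K" using K by (simp add: finite_extension_of_def)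
  have "K = {\<Sum>b\<in>B. c b * b |c. \<forall>b\<in>B. c b \<in> Qp}"
  proof (intro equalityI subsetI)
    fix x assume "x \<in> {\<Sum>b\<in>B. c b * b |c. \<forall>b\<in>B. c b \<in> Qp}"
    then obtain c where c: "x = (\<Sum>b\<in>B. c b * b)" "\<forall>b\<in>B. c b \<in> Qp" by blast
    have "(\<Sum>b\<in>B'. c b * b) \<in> K" if "B' \<subseteq> B" for B'
      using finite_subset[OF that B(1)] that
    proof (induction B' rule: finite_induct)
      case (insert b B')
      have "c b * b \<in> K" using insert.prems c(2) QK B(2) sub unfolding subfield_set_def by blast
      thus ?case using insert sub by (simp add: subfield_set_def)
    qed (use sub in \<open>simp add: subfield_set_def\<close>)
    thus "x \<in> K" using c(1) by blast
  qed (use B(3) in blast)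
  hence "bolzano_weierstrass K"
    using bolzano_weierstrass_span[OF Qp_subfield bolzano_weierstrass_Qp[OF p] B(1)] by simp
  thus "compactin (Metric_space.mtopology K (\<lambda>x y. nm (x - y))) {z \<in> K. nm z \<le> r}" for r
    by (rule bolzano_weierstrass_compact)
  show "\<exists>u\<in>K. u \<noteq> 0 \<and> nm u < e" if e0: "e > 0" for e
  proof -
    have p1: "real p > 1" using p prime_gt_1_nat by simp
    obtain n where "(1 / real p) ^ n < e" using real_arch_pow_inv[OF e0, of "1 / real p"] p1 by auto
    moreover have "nm (of_nat (p ^ n)) = (1 / real p) ^ n" using nm_p[OF p] by (simp add: nm_power)
    moreover have "of_nat (p ^ n) \<in> K" using Qp_of_nat QK by blast
    moreover have "(of_nat (p ^ n) :: 'c) \<noteq> 0" using p by simp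
    ultimately show ?thesis by (intro bexI[of _ "of_nat (p ^ n)"] conjI) simp_all
  qed
qed

end

section \<open>The spherical metric and rational maps in charts\<close>

context nonarch_absolute_value
begin

lemma sph_dist_Infty: "sph_dist nm (Fin x) Infty = 1 / max (nm x) 1" "sph_dist nm Infty (Fin x) = 1 / max (nm x) 1"
  by (auto simp: max_def)

text \<open>With denominators cleared, the case of three finite points is \<open>key\<close>. For
  \<open>nm v > 1\<close> the plain ultrametric inequality does not absorb the factor
  \<open>nm v\<close>; the identity \<open>(u - w) * v = w * (u - v) + u * (v - w)\<close> takes its
  place.\<close>

lemma sph_dist_ultrametric: "sph_dist nm x z \<le> max (sph_dist nm x y) (sph_dist nm y z)"
proof -
  define m where "m u = max (nm u) 1" for u
  have m: "m u > 0" "m u \<ge> 1" "nm u \<le> m u" for u by (auto simp: m_def)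
  have fin: "sph_dist nm (Fin u) (Fin v) = nm (u - v) / (m u * m v)" for u v by (simp add: m_def)
  have inf: "sph_dist nm (Fin u) Infty = 1 / m u" "sph_dist nm Infty (Fin u) = 1 / m u" for u
    unfolding m_def by (rule sph_dist_Infty)+
  have m_le: "m u \<le> max (nm (u - v)) (m v)" for u v
    using nm_ultrametric[of "u - v" v] by (auto simp: m_def)
  have key: "nm (u - w) * m v \<le> max (nm (u - v) * m w) (nm (v - w) * m u)" for u v w
  proof (cases "nm v \<le> 1")
    case True
    have "nm (u - w) \<le> max (nm (u - v)) (nm (v - w))"
      using nm_ultrametric[of "u - v" "v - w"] by simp
    also have "\<dots> \<le> max (nm (u - v) * m w) (nm (v - w) * m u)"
      using mult_left_mono[OF m(2) nm_nonneg, of "u - v" w] mult_left_mono[OF m(2) nm_nonneg, of "v - w" u]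
      by (intro max.mono) auto
    finally show ?thesis using True by (simp add: m_def)
  next
    case False
    have "(u - w) * v = w * (u - v) + u * (v - w)" by (simp add: algebra_simps)
    hence "nm (u - w) * nm v \<le> max (nm w * nm (u - v)) (nm u * nm (v - w))"
      by (metis nm_mult nm_ultrametric)
    also have "\<dots> \<le> max (nm (u - v) * m w) (nm (v - w) * m u)"
      by (subst (1 2) mult.commute, intro max.mono mult_left_mono m nm_nonneg)
    finally show ?thesis using False by (simp add: m_def)
  qed
  show ?thesis
  proof (cases x; cases y; cases z)
    fix u v w assume eq: "x = Fin u" "y = Fin v" "z = Fin w"
    have "nm (u - w) / (m u * m w) = nm (u - w) * m v / (m u * m v * m w)"
      using m(1)[of v] by simp
    also have "\<dots> \<le> max (nm (u - v) * m w) (nm (v - w) * m u) / (m u * m v * m w)"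
      using m(1) by (intro divide_right_mono key) (simp add: less_imp_le)
    also have "\<dots> = max (nm (u - v) * m w / (m u * m v * m w)) (nm (v - w) * m u / (m u * m v * m w))"
      using m(1)[of u] m(1)[of v] m(1)[of w] by (simp add: max_divide_distrib_right)
    also have "\<dots> = max (nm (u - v) / (m u * m v)) (nm (v - w) / (m v * m w))"
      using m(1)[of u] m(1)[of v] m(1)[of w] by (simp add: field_simps)
    finally show ?thesis unfolding eq fin .
  next
    fix u v assume eq: "x = Fin u" "y = Fin v" "z = Infty"
    show ?thesis unfolding eq fin inf
      using m_le[of v u] m(1)[of u] m(1)[of v] by (auto simp: le_max_iff_disj field_simps nm_minus_commute)
  next
    fix v w assume eq: "x = Infty" "y = Fin v" "z = Fin w"
    show ?thesis unfolding eq fin inf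
      using m_le[of v w] m(1)[of w] m(1)[of v] by (auto simp: le_max_iff_disj field_simps)
  next
    fix u w assume eq: "x = Fin u" "y = Infty" "z = Fin w"
    have "nm (u - w) \<le> max (m u) (m w)"
      using nm_diff_le[of u w] m(3)[of u] m(3)[of w] by linarith
    thus ?thesis unfolding eq fin inf
      using m(1)[of u] m(1)[of w] by (auto simp: le_max_iff_disj field_simps)
  qed (auto simp: nm_nonneg le_max_iff_disj)
qed

definition inv_pt :: "'c \<Rightarrow> 'c proj_pt" where
  "inv_pt w = (if w = 0 then Infty else Fin (1 / w))"

text \<open>Rests on \<open>nm u * max (nm (1 / u)) 1 = max (nm u) 1\<close>. It makes the
  coordinate at infinity as good as the affine one at \<open>0\<close>.\<close>

lemma sph_dist_inv_pt: "sph_dist nm (inv_pt z) (inv_pt w) = sph_dist nm (Fin z) (Fin w)"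
proof -
  have m: "nm u * max (nm (1 / u)) 1 = max (nm u) 1" if "u \<noteq> 0" for u
    using nm_pos[OF that] by (simp add: nm_divide max_mult_distrib_left)
  have m0: "1 / max (nm (1 / u)) 1 = nm u / max (nm u) 1" if "u \<noteq> 0" for u
    using m[OF that] nm_pos[OF that] by (metis divide_divide_eq_right divide_self_if mult.commute less_irrefl times_divide_eq_right mult.right_neutral nonzero_divide_mult_cancel_left)
  consider "z = 0" "w = 0" | "z = 0" "w \<noteq> 0" | "z \<noteq> 0" "w = 0" | "z \<noteq> 0" "w \<noteq> 0" by blast
  thus ?thesis
  proof cases
    case 2
    have "sph_dist nm (inv_pt z) (inv_pt w) = 1 / max (nm (1 / w)) 1"
    proof -
      have "inv_pt z = Infty" "inv_pt w = Fin (1 / w)" using 2 by (simp_all add: inv_pt_def)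
      thus ?thesis using sph_dist_Infty(2) by (simp only:)
    qed
    thus ?thesis using m0[OF 2(2)] 2 by simp
  next
    case 3
    have "sph_dist nm (inv_pt z) (inv_pt w) = 1 / max (nm (1 / z)) 1"
    proof -
      have "inv_pt z = Fin (1 / z)" "inv_pt w = Infty" using 3 by (simp_all add: inv_pt_def)
      thus ?thesis using sph_dist_Infty(1) by (simp only:)
    qed
    thus ?thesis using m0[OF 3(1)] 3 by simp
  next
    case 4
    have "1 / z - 1 / w = (w - z) / (z * w)" using 4 by (simp add: field_simps)
    hence "nm (1 / z - 1 / w) = nm (z - w) / (nm z * nm w)"
      by (simp add: nm_divide nm_mult nm_minus_commute)
    moreover have "sph_dist nm (inv_pt z) (inv_pt w)
        = nm (1 / z - 1 / w) / (max (nm (1 / z)) 1 * max (nm (1 / w)) 1)"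
      using 4 by (simp add: inv_pt_def)
    ultimately have "sph_dist nm (inv_pt z) (inv_pt w)
        = nm (z - w) / ((nm z * max (nm (1 / z)) 1) * (nm w * max (nm (1 / w)) 1))"
      by (simp add: mult_ac)
    thus ?thesis unfolding m[OF 4(1)] m[OF 4(2)] by simp
  qed (simp add: inv_pt_def)
qed

lemma sph_dist_Fin_le: "sph_dist nm (Fin z) (Fin w) \<le> nm (z - w)"
proof -
  have "max (nm z) 1 * max (nm w) 1 \<ge> 1 * 1" by (intro mult_mono) auto
  thus ?thesis using nm_nonneg[of "z - w"]
    by (simp add: divide_le_eq mult_le_cancel_left1 del: max.bounded_iff)
qed

lemma poly_bounded_lipschitz:
  "\<exists>N\<ge>0. \<exists>L\<ge>0. \<forall>z w. nm z \<le> B \<and> nm w \<le> B \<longrightarrow> nm (poly f z) \<le> N \<and> nm (poly f z - poly f w) \<le> L * nm (z - w)"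
proof (induction f)
  case 0
  show ?case by (intro exI[of _ 0]) auto
next
  case (pCons c f)
  then obtain N L where NL: "N \<ge> 0" "L \<ge> 0"
    "\<And>z. nm z \<le> B \<Longrightarrow> nm (poly f z) \<le> N"
    "\<And>z w. nm z \<le> B \<Longrightarrow> nm w \<le> B \<Longrightarrow> nm (poly f z - poly f w) \<le> L * nm (z - w)" by blast
  \<comment> \<open>For negative \<open>B\<close> the estimates are vacuous, but the constants must
    still be nonnegative.\<close>
  define B' where "B' = max B 0"
  have "nm (poly (pCons c f) z) \<le> nm c + B' * N \<and>
      nm (poly (pCons c f) z - poly (pCons c f) w) \<le> (B' * L + N) * nm (z - w)"
    if z: "nm z \<le> B" and w: "nm w \<le> B" for z w
  proof
    have zB: "nm z \<le> B'" using z by (simp add: B'_def)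
    have "nm z * nm (poly f z) \<le> B' * N"
      using NL zB z by (intro mult_mono) (auto simp: nm_nonneg B'_def)
    thus "nm (poly (pCons c f) z) \<le> nm c + B' * N"
      using nm_triangle[of c "z * poly f z"] by (simp add: nm_mult)
    have "poly (pCons c f) z - poly (pCons c f) w = z * (poly f z - poly f w) + (z - w) * poly f w"
      by (simp add: algebra_simps)
    hence "nm (poly (pCons c f) z - poly (pCons c f) w)
        \<le> nm z * nm (poly f z - poly f w) + nm (z - w) * nm (poly f w)"
      by (metis nm_mult nm_triangle)
    also have "\<dots> \<le> B' * (L * nm (z - w)) + nm (z - w) * N"
      using NL z w zB by (intro add_mono mult_mono) (auto simp: nm_nonneg B'_def)
    finally show "nm (poly (pCons c f) z - poly (pCons c f) w) \<le> (B' * L + N) * nm (z - w)"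
      by (simp add: algebra_simps)
  qed
  moreover have "nm c + B' * N \<ge> 0" "B' * L + N \<ge> 0" using NL nm_nonneg by (auto simp: B'_def)
  ultimately show ?case by blast
qed

end

section \<open>Local normal form of a quotient of polynomials\<close>

context local_field
begin

lemma poly_over_synthetic_div: "poly_over K f \<Longrightarrow> a \<in> K \<Longrightarrow> poly_over K (synthetic_div f a)"
proof (induction f)
  case 0 thus ?case by simp
next
  case (pCons c f)
  have "poly_over K f" using pCons.prems(1) unfolding poly_over_def by (metis coeff_pCons_Suc)
  thus ?case using pCons K_poly[of f a]
    by (auto simp: poly_over_def coeff_pCons split: nat.split)
qed

text \<open>Synthetic division keeps the cofactor over \<open>K\<close>, as required for the values
  of \<open>q\<close> in a local model.\<close>

lemma factor_root:
  assumes "f \<noteq> 0" "poly_over K f" "a \<in> K"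
  shows "\<exists>n u. f = [:- a, 1:] ^ n * u \<and> poly_over K u \<and> poly u a \<noteq> 0"
  using assms
proof (induction "degree f" arbitrary: f rule: less_induct)
  case less
  show ?case
  proof (cases "poly f a = 0")
    case True
    define v where "v = synthetic_div f a"
    have fv: "f = [:- a, 1:] * v" using synthetic_div_correct'[of a f] True by (simp add: v_def)
    have "v \<noteq> 0" using fv less.prems(1) by auto
    hence "degree f = Suc (degree v)" unfolding fv by (subst degree_mult_eq) auto
    then obtain n u where u: "v = [:- a, 1:] ^ n * u" "poly_over K u" "poly u a \<noteq> 0"
      using less.hyps[of v] \<open>v \<noteq> 0\<close> poly_over_synthetic_div less.prems v_def by auto
    have "f = [:- a, 1:] ^ Suc n * u" unfolding fv u(1) by (simp only: power_Suc mult.assoc)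
    thus ?thesis using u(2,3) by blast
  next
    case False
    thus ?thesis using less.prems by (intro exI[of _ 0] exI[of _ f]) auto
  qed
qed

lemma poly_over_diff_smult:
  "poly_over K f \<Longrightarrow> poly_over K g \<Longrightarrow> b \<in> K \<Longrightarrow> poly_over K (f - smult b g)"
  by (simp add: poly_over_def K_diff K_mult)

end

context charted_space
begin

text \<open>\<open>F - smult b G\<close> vanishes at \<open>a\<close>, and its order of vanishing is
  the local degree \<open>Suc k\<close>. Dividing the remaining cofactor \<open>u\<close> by
  \<open>G\<close> gives \<open>q\<close>; the point is noncritical exactly when the root is
  simple.\<close>

lemma quotient_local_model:
  assumes c1: "chart i a \<kappa> R" and c2: "chart j b \<mu> S"
    and F: "poly_over K F" and G: "poly_over K G" and Ga: "poly G a \<noteq> 0"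
    and b: "b = poly F a / poly G a" and ne: "F - smult b G \<noteq> 0"
    and T: "\<And>z. z \<in> kball a R \<Longrightarrow> poly G z \<noteq> 0 \<Longrightarrow> T (i z) = j (poly F z / poly G z)"
  obtains q r L Q k \<psi> where "local_model nm K M d T i a \<kappa> R j b \<mu> S q r L Q k \<psi>"
    "k = 0 \<longleftrightarrow> poly (pderiv F) a * poly G a - poly F a * poly (pderiv G) a \<noteq> 0"
proof -
  have a: "a \<in> K" and R: "R > 0" and S: "S > 0" using c1 c2 by (auto simp: chart_def)
  have bK: "b \<in> K" unfolding b using F G a by (intro K_divide K_poly)
  define H where "H = F - smult b G"
  have Ha: "poly H a = 0" using Ga by (simp add: H_def b)
  obtain n u where nu: "H = [:- a, 1:] ^ n * u" "poly_over K u" "poly u a \<noteq> 0"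
    using factor_root[OF ne poly_over_diff_smult[OF F G bK] a] unfolding H_def by blast
  have "n \<noteq> 0" using nu Ha by (auto intro: ccontr)
  then obtain k where k: "n = Suc k" by (cases n) auto
  have Hz: "poly H z = (z - a) ^ Suc k * poly u z" for z
    by (simp only: nu(1) k poly_mult poly_power) simp

  define B where "B = max (nm a) 0 + R"
  obtain Lu where Lu: "Lu \<ge> 0"
    "\<And>z w. nm z \<le> B \<Longrightarrow> nm w \<le> B \<Longrightarrow> nm (poly u z - poly u w) \<le> Lu * nm (z - w)"
    using poly_bounded_lipschitz[of B u] by blast
  obtain LG where LG: "LG \<ge> 0"
    "\<And>z w. nm z \<le> B \<Longrightarrow> nm w \<le> B \<Longrightarrow> nm (poly G z - poly G w) \<le> LG * nm (z - w)"
    using poly_bounded_lipschitz[of B G] by blast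
  define \<upsilon> \<gamma> where "\<upsilon> = nm (poly u a)" and "\<gamma> = nm (poly G a)"
  have pos: "\<upsilon> > 0" "\<gamma> > 0" using nm_pos nu(3) Ga by (auto simp: \<upsilon>_def \<gamma>_def)
  define Q where "Q = \<upsilon> / \<gamma>"
  have Q: "Q > 0" using pos by (simp add: Q_def)
  \<comment> \<open>The second and third bounds make \<open>nm (poly u z)\<close> and
    \<open>nm (poly G z)\<close> constant; the bound \<open>1\<close> compares the power with
    \<open>nm (z - a)\<close>, after which \<open>S / Q\<close> keeps the image in the target
    chart.\<close>
  define r where "r = Min {R, \<upsilon> / (Lu + 1), \<gamma> / (LG + 1), 1, S / Q}"
  have r: "0 < r" "r \<le> R" "r \<le> \<upsilon> / (Lu + 1)" "r \<le> \<gamma> / (LG + 1)" "r \<le> 1" "r \<le> S / Q"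
    using R S Q pos Lu(1) LG(1) by (auto simp: r_def)
  have inB: "nm z \<le> B" if "z \<in> kball a r" for z
    using that nm_ultrametric[of "z - a" a] r(2) R nm_nonneg[of a] by (auto simp: kball_def B_def)
  have aB: "a \<in> kball a r" using a r by (simp add: kball_def)
  have u_const: "nm (poly u z) = \<upsilon>" and G_const: "nm (poly G z) = \<gamma>" if z: "z \<in> kball a r" for z
  proof -
    have small: "l * nm (z - a) < v" if "l \<ge> 0" "r \<le> v / (l + 1)" for l v
    proof -
      have "l * nm (z - a) \<le> (l + 1) * nm (z - a)" by (intro mult_right_mono) (auto simp: nm_nonneg)
      also have "\<dots> < (l + 1) * (v / (l + 1))"
        using z that by (intro mult_strict_left_mono) (auto simp: kball_def)
      finally show ?thesis using that by simp
    qed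
    have "nm (poly u z - poly u a) < \<upsilon>"
      using Lu(2)[OF inB[OF z] inB[OF aB]] small[OF Lu(1) r(3)] by linarith
    thus "nm (poly u z) = \<upsilon>" unfolding \<upsilon>_def by (rule nm_eq_of_less)
    have "nm (poly G z - poly G a) < \<gamma>"
      using LG(2)[OF inB[OF z] inB[OF aB]] small[OF LG(1) r(4)] by linarith
    thus "nm (poly G z) = \<gamma>" unfolding \<gamma>_def by (rule nm_eq_of_less)
  qed
  have G0: "poly G z \<noteq> 0" if "z \<in> kball a r" for z using G_const[OF that] pos by auto
  define q where "q z = poly u z / poly G z" for z
  have q: "q z \<in> K" "nm (q z) = Q" if "z \<in> kball a r" for z
    using that u_const G_const K_poly[OF nu(2)] K_poly[OF G] K_divide
    by (auto simp: q_def Q_def nm_divide kball_def)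
  define L where "L = Lu / \<gamma> + \<upsilon> * LG / \<gamma>\<^sup>2"
  have L: "L \<ge> 0" using Lu(1) LG(1) pos by (simp add: L_def)
  have q_lip: "nm (q z - q w) \<le> L * nm (z - w)" if z: "z \<in> kball a r" and w: "w \<in> kball a r" for z w
  proof -
    have "q z - q w = (poly u z - poly u w) / poly G z + poly u w * (poly G w - poly G z) / (poly G z * poly G w)"
      using G0[OF z] G0[OF w] by (simp add: q_def field_simps)
    hence "nm (q z - q w) \<le> nm (poly u z - poly u w) / \<gamma> + \<upsilon> * nm (poly G z - poly G w) / (\<gamma> * \<gamma>)"
      using nm_triangle G_const[OF z] G_const[OF w] u_const[OF w]
      by (metis nm_divide nm_minus_commute nm_mult)
    also have "\<dots> \<le> (Lu * nm (z - w)) / \<gamma> + \<upsilon> * (LG * nm (z - w)) / (\<gamma> * \<gamma>)"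
      using Lu(2) LG(2) inB z w pos by (intro add_mono divide_right_mono mult_left_mono) auto
    also have "\<dots> = L * nm (z - w)" by (simp add: L_def power2_eq_square algebra_simps add_divide_distrib)
    finally show ?thesis .
  qed
  have form: "poly F z / poly G z = b + (z - a) ^ Suc k * q z" if z: "z \<in> kball a r" for z
  proof -
    have "poly F z = poly H z + b * poly G z" by (simp add: H_def)
    thus ?thesis using G0[OF z] by (simp only: Hz q_def) (simp add: field_simps)
  qed
  have range: "poly F z / poly G z \<in> kball b S" if z: "z \<in> kball a r" for z
  proof -
    have zK: "z \<in> K" and za: "nm (z - a) < r" using z by (auto simp: kball_def)
    have "nm (z - a) ^ Suc k \<le> nm (z - a) ^ 1"
      using za r(5) by (intro power_decreasing) (auto simp: nm_nonneg)
    hence "nm (z - a) ^ Suc k * Q < S / Q * Q"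
      using za r(6) Q by (intro mult_strict_right_mono) auto
    hence "nm (poly F z / poly G z - b) < S"
      using form[OF z] q(2)[OF z] Q by (simp add: nm_mult nm_power)
    thus ?thesis using zK F G by (simp add: kball_def K_divide K_poly)
  qed
  \<comment> \<open>Since \<open>poly F a = b * poly G a\<close>, the numerator of the derivative of
    the quotient reduces to the derivative of \<open>H\<close>.\<close>
  have "poly (pderiv F) a * poly G a - poly F a * poly (pderiv G) a = poly (pderiv H) a * poly G a"
    using Ga by (simp add: H_def b pderiv_diff pderiv_smult field_simps)
  also have "poly (pderiv H) a = poly ([:- a, 1:] ^ k * u) a"
  proof -
    define v where "v = [:- a, 1:] ^ k * u"
    have "H = [:- a, 1:] * v" by (simp only: nu(1) k v_def power_Suc mult.assoc)
    hence "poly (pderiv H) a = poly v a" by (simp only: pderiv_mult poly_add poly_mult) (simp add: pderiv_pCons)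
    thus ?thesis by (simp add: v_def)
  qed
  finally have crit: "k = 0 \<longleftrightarrow> poly (pderiv F) a * poly G a - poly F a * poly (pderiv G) a \<noteq> 0"
    using Ga nu(3) by (simp add: poly_mult poly_power)
  have "local_model nm K M d T i a \<kappa> R j b \<mu> S q r L Q k (\<lambda>z. poly F z / poly G z)"
  proof
    show "T (i z) = j (poly F z / poly G z)" if "z \<in> kball a r" for z
      using T G0[OF that] that r(2) by (simp add: kball_def)
  qed (fact c1 c2 r(1,2) L Q q q_lip form range)+
  thus thesis using crit by (rule that)
qed

end

section \<open>The projective line over \<open>K\<close>\<close>

context local_field
begin

sublocale P: ultrametric_space "proj_line K" "sph_dist nm"
proof -
  interpret Metric_space "proj_line K" "sph_dist nm" by (rule Metric_space_sph_dist)
  show "ultrametric_space (proj_line K) (sph_dist nm)"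
    by unfold_locales (rule sph_dist_ultrametric)
qed

sublocale charted_space nm K "proj_line K" "sph_dist nm" ..

lemma Fin_in [simp]: "Fin z \<in> proj_line K \<longleftrightarrow> z \<in> K"
  by (auto simp: proj_line_def)

lemma Infty_in [simp]: "Infty \<in> proj_line K"
  by (simp add: proj_line_def)

lemma inv_pt_in: "z \<in> K \<Longrightarrow> inv_pt z \<in> proj_line K"
  by (simp add: inv_pt_def K_divide)

text \<open>On the ball of radius \<open>max (nm a) 1\<close> the function
  \<open>max (nm z) 1\<close> is constant, so the denominator of the spherical metric is constant
  too.\<close>

lemma chart_Fin:
  assumes a: "a \<in> K"
  shows "chart Fin a (1 / (max (nm a) 1)\<^sup>2) (max (nm a) 1)"
proof -
  define m where "m = max (nm a) 1"
  have m: "m \<ge> 1" "nm a \<le> m" by (auto simp: m_def)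
  have const: "max (nm z) 1 = m" if z: "z \<in> kball a m" for z
  proof (cases "nm a \<le> 1")
    case True
    thus ?thesis using z nm_ultrametric[of "z - a" a] by (auto simp: m_def kball_def)
  next
    case False
    hence "nm (z - a) < nm a" using z by (simp add: m_def kball_def)
    hence "nm z = nm a" by (rule nm_eq_of_less)
    thus ?thesis by (simp add: m_def)
  qed
  have dist: "sph_dist nm (Fin z) (Fin w) = 1 / m\<^sup>2 * nm (z - w)" if "z \<in> kball a m" "w \<in> kball a m" for z w
    using const[OF that(1)] const[OF that(2)] by (simp add: power2_eq_square)
  have rad: "1 / m\<^sup>2 * m = 1 / m" using m by (simp add: power2_eq_square)
  have aa: "a \<in> kball a m" using a m by (simp add: kball_def)
  have "Fin ` kball a m = P.mball (Fin a) (1 / m)"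
  proof (intro equalityI subsetI)
    fix y assume "y \<in> Fin ` kball a m"
    then obtain z where z: "z \<in> kball a m" "y = Fin z" by blast
    have "1 / m\<^sup>2 * nm (a - z) < 1 / m\<^sup>2 * m"
      using z(1) m by (intro mult_strict_left_mono) (auto simp: kball_def nm_minus_commute)
    hence "sph_dist nm (Fin a) y < 1 / m" using dist[OF aa z(1)] rad z(2) by (simp only:)
    thus "y \<in> P.mball (Fin a) (1 / m)" using a z by (simp add: kball_def del: sph_dist.simps)
  next
    fix y assume y: "y \<in> P.mball (Fin a) (1 / m)"
    show "y \<in> Fin ` kball a m"
    proof (cases y)
      case Infty
      hence "sph_dist nm (Fin a) Infty < 1 / m" using y by (simp del: sph_dist.simps)
      thus ?thesis by (simp add: sph_dist_Infty m_def del: sph_dist.simps)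
    next
      case (Fin z)
      have zK: "z \<in> K" using y Fin by (simp del: sph_dist.simps)
      have "nm (a - z) / (m * max (nm z) 1) < 1 / m" using y Fin by (simp add: m_def)
      hence "nm (a - z) < max (nm z) 1" using m by (simp add: field_simps less_max_iff_disj)
      moreover have "max (nm z) 1 \<le> m"
      proof (rule ccontr)
        assume c: "\<not> max (nm z) 1 \<le> m"
        hence "nm a < nm z" using m by auto
        hence "nm ((z - a) - z) < nm z" by simp
        hence "nm (z - a) = nm z" by (rule nm_eq_of_less)
        thus False using calculation c m by (auto simp: nm_minus_commute)
      qed
      ultimately show ?thesis using Fin zK by (auto simp: kball_def nm_minus_commute)
    qed
  qed
  thus ?thesis unfolding chart_def m_def[symmetric] rad using a m dist by (auto simp del: sph_dist.simps)
qed

lemma chart_inv: "chart inv_pt 0 1 1"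
proof -
  have dist: "sph_dist nm (inv_pt z) (inv_pt w) = nm (z - w)" if "nm z \<le> 1" "nm w \<le> 1" for z w
    unfolding sph_dist_inv_pt using that by simp
  have inv0: "inv_pt 0 = Infty" by (simp add: inv_pt_def)
  have "inv_pt ` kball 0 1 = P.mball Infty 1"
  proof (intro equalityI subsetI)
    fix y assume "y \<in> inv_pt ` kball 0 1"
    then obtain z where z: "z \<in> kball 0 1" "y = inv_pt z" by blast
    have "sph_dist nm Infty y < 1" using dist[of 0 z] z inv0 by (simp add: kball_def)
    thus "y \<in> P.mball Infty 1" using z inv_pt_in by (simp add: kball_def del: sph_dist.simps)
  next
    fix y assume y: "y \<in> P.mball Infty 1"
    show "y \<in> inv_pt ` kball 0 1"
    proof (cases y)
      case Infty
      thus ?thesis using inv0 by (intro image_eqI[of _ _ 0]) (auto simp: kball_def)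
    next
      case (Fin z)
      have z: "z \<in> K" "nm z > 1" using y Fin by (auto split: if_splits)
      hence z0: "z \<noteq> 0" by auto
      have "1 / z \<in> kball 0 1" using z by (simp add: kball_def K_divide nm_divide)
      moreover have "y = inv_pt (1 / z)" using z0 Fin by (simp add: inv_pt_def)
      ultimately show ?thesis by blast
    qed
  qed
  thus ?thesis unfolding chart_def using dist inv0 by (auto simp: kball_def simp del: sph_dist.simps)
qed

text \<open>Two copies of the compact unit ball cover the line, one through \<open>Fin\<close> and
  one through \<open>inv_pt\<close>.\<close>

lemma compact_proj_line: "compact_space P.mtopology"
proof -
  let ?O = "{z \<in> K. nm z \<le> 1}"
  have cont: "continuous_map K.mtopology P.mtopology f"
    if f: "\<And>z. z \<in> K \<Longrightarrow> f z \<in> proj_line K"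
      "\<And>z w. sph_dist nm (f z) (f w) = sph_dist nm (Fin z) (Fin w)" for f
    unfolding K.metric_continuous_map[OF P.Metric_space_axioms]
  proof (intro conjI ballI allI impI)
    fix z and e :: real assume "e > 0"
    moreover have "sph_dist nm (f z) (f w) < e" if "nm (z - w) < e" for w
      unfolding f(2) using sph_dist_Fin_le[of z w] that by linarith
    ultimately show "\<exists>\<delta>>0. \<forall>w. w \<in> K \<and> nm (z - w) < \<delta> \<longrightarrow> sph_dist nm (f z) (f w) < e" by blast
  qed (use f(1) in blast)
  have "compactin P.mtopology (Fin ` ?O)" "compactin P.mtopology (inv_pt ` ?O)"
    using compact_ball by (auto intro!: image_compactin cont inv_pt_in sph_dist_inv_pt simp del: sph_dist.simps)
  hence "compactin P.mtopology (Fin ` ?O \<union> inv_pt ` ?O)" by (rule compactin_Un)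
  moreover have "Fin ` ?O \<union> inv_pt ` ?O = proj_line K"
  proof (intro equalityI subsetI)
    fix y assume "y \<in> proj_line K"
    then consider "y = Infty" | z where "y = Fin z" "z \<in> K" "nm z \<le> 1" | z where "y = Fin z" "z \<in> K" "nm z > 1"
      by (auto simp: proj_line_def) (metis not_le)
    then show "y \<in> Fin ` ?O \<union> inv_pt ` ?O"
    proof cases
      case 1
      thus ?thesis by (intro UnI2 image_eqI[of _ _ 0]) (auto simp: inv_pt_def)
    next
      case (3 z)
      hence "z \<noteq> 0" by auto
      hence "y = inv_pt (1 / z)" using 3 by (simp add: inv_pt_def)
      moreover have "1 / z \<in> ?O" using 3 by (simp add: K_divide nm_divide)
      ultimately show ?thesis by blast
    qed blast
  qed (use inv_pt_in in auto)
  ultimately show ?thesis by (simp add: compact_space_def)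
qed

abbreviation "sph_model \<equiv> local_model nm K (proj_line K) (sph_dist nm)"

text \<open>At a pole the target is read in the coordinate at infinity, which exchanges the roles of
  \<open>f\<close> and \<open>g\<close>, in agreement with \<open>critical_fin\<close>.\<close>

lemma local_model_of_pair:
  assumes c: "chart i a \<kappa> R" and f: "poly_over K f" and g: "poly_over K g"
    and nz: "poly f a \<noteq> 0 \<or> poly g a \<noteq> 0"
    and nc: "\<And>b. f - smult b g \<noteq> 0" "\<And>b. g - smult b f \<noteq> 0"
    and T: "\<And>z. z \<in> kball a R \<Longrightarrow> T (i z) = rat_eval_fin (f, g) z"
  obtains j b \<mu> S q r L Q k \<psi> where
    "sph_model T i a \<kappa> R j b \<mu> S q r L Q k \<psi>"
    "k = 0 \<longleftrightarrow> \<not> critical_fin (f, g) a"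
proof -
  have a: "a \<in> K" using c by (auto simp: chart_def)
  show thesis
  proof (cases "poly g a = 0")
    case False
    define b where "b = poly f a / poly g a"
    have bK: "b \<in> K" unfolding b_def using f g a by (intro K_divide K_poly)
    show thesis
    proof (rule quotient_local_model[OF c chart_Fin[OF bK] f g False b_def nc(1), of T])
      show "T (i z) = Fin (poly f z / poly g z)" if "z \<in> kball a R" "poly g z \<noteq> 0" for z
        using T[OF that(1)] that(2) by (simp add: rat_eval_fin_def)
    qed (rule that, assumption, use False in \<open>simp add: critical_fin_def rat_deriv_def\<close>)
  next
    case True
    hence fa: "poly f a \<noteq> 0" and b: "0 = poly g a / poly f a" using nz by auto
    show thesis
    proof (rule quotient_local_model[OF c chart_inv g f fa b nc(2), of T])
      show "T (i z) = inv_pt (poly g z / poly f z)" if "z \<in> kball a R" "poly f z \<noteq> 0" for z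
        using T[OF that(1)] that(2) by (simp add: rat_eval_fin_def inv_pt_def)
    qed (rule that, assumption, use True fa in \<open>simp add: critical_fin_def rat_deriv_def\<close>)
  qed
qed

end

section \<open>The coordinate at infinity and nonconstancy\<close>

lemma poly_reflect_monom:
  fixes h :: "'c::field poly"
  assumes "degree h \<le> d" "w \<noteq> 0"
  shows "poly (monom 1 (d - degree h) * reflect_poly h) w = w ^ d * poly h (1 / w)"
proof -
  have "poly (reflect_poly h) w = w ^ degree h * poly h (inverse w)"
    using assms(2) by (rule poly_reflect_poly_nz)
  thus ?thesis using assms(1)
    by (simp add: poly_mult poly_monom inverse_eq_divide mult.assoc[symmetric] power_add[symmetric])
qed

lemma chart_infty_eval:
  assumes "w \<noteq> 0" shows "rat_eval_fin (chart_infty \<phi>) w = rat_eval_fin \<phi> (1 / w)"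
proof -
  obtain f g where \<phi>: "\<phi> = (f, g)" by (cases \<phi>)
  define d where "d = rat_degree \<phi>"
  have le: "degree f \<le> d" "degree g \<le> d" by (auto simp: d_def rat_degree_def \<phi>)
  show ?thesis
    using poly_reflect_monom[OF le(1) assms] poly_reflect_monom[OF le(2) assms] assms
    by (simp add: rat_eval_fin_def chart_infty_def \<phi> d_def[unfolded \<phi>, symmetric])
qed

text \<open>Proportionality in the coordinate \<open>1 / z\<close> would make
  \<open>f - smult b g\<close> vanish at all of the infinitely many nonzero
  \<open>z\<close>.\<close>

lemma chart_infty_nonproportional:
  fixes f g :: "'c::field_char_0 poly"
  assumes "\<And>b. f - smult b g \<noteq> 0"
  shows "fst (chart_infty (f, g)) - smult b (snd (chart_infty (f, g))) \<noteq> 0"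
proof
  assume eq: "fst (chart_infty (f, g)) - smult b (snd (chart_infty (f, g))) = 0"
  define d where "d = rat_degree (f, g)"
  have le: "degree f \<le> d" "degree g \<le> d" by (auto simp: d_def rat_degree_def)
  have "poly (f - smult b g) z = 0" if "z \<noteq> 0" for z
  proof -
    have "poly (fst (chart_infty (f, g)) - smult b (snd (chart_infty (f, g)))) (1 / z) = 0"
      using eq by simp
    hence "(1 / z) ^ d * poly (f - smult b g) z = 0"
      using poly_reflect_monom[OF le(1), of "1 / z"] poly_reflect_monom[OF le(2), of "1 / z"] that
      by (simp add: chart_infty_def d_def[symmetric] algebra_simps)
    thus ?thesis using that by simp
  qed
  hence "UNIV - {0} \<subseteq> {z. poly (f - smult b g) z = 0}" by blast
  moreover have "infinite (UNIV - {0 :: 'c})" using infinite_UNIV_char_0 by simp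
  ultimately show False using poly_roots_finite[OF assms[of b]] finite_subset by blast
qed

text \<open>A proportional coprime pair would have a unit as \<open>g\<close>, forcing both degrees
  to be \<open>0\<close>. This ensures that every value is taken with finite multiplicity.\<close>

lemma nonproportional:
  fixes f g :: "'c::field poly"
  assumes cop: "coprime f g" and deg: "max (degree f) (degree g) \<ge> 2"
  shows "f - smult b g \<noteq> 0"
proof
  assume "f - smult b g = 0"
  hence fb: "f = smult b g" by simp
  hence "g dvd f" by (simp add: dvd_smult)
  hence unit: "is_unit g" using cop by (metis coprime_common_divisor dvd_refl)
  hence "g \<noteq> 0" by auto
  hence "degree g = 0" using unit is_unit_iff_degree by blast
  moreover have "degree f \<le> degree g" unfolding fb by (rule degree_smult_le)
  ultimately show False using deg by simp
qed

context local_field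
begin

lemma local_model_rat_map:
  assumes \<phi>: "ratfun_over K \<phi>" "rat_degree \<phi> \<ge> 2" and x: "x \<in> proj_line K"
  obtains i a \<kappa> R j b \<mu> S q r L Q k \<psi> where
    "sph_model (rat_map \<phi>) i a \<kappa> R j b \<mu> S q r L Q k \<psi>"
    "i a = x" "k = 0 \<longleftrightarrow> \<not> critical_point \<phi> x"
proof -
  obtain f g where fg: "\<phi> = (f, g)" by (cases \<phi>)
  have f: "poly_over K f" and g: "poly_over K g" and g0: "g \<noteq> 0" and cop: "coprime f g"
    and deg: "max (degree f) (degree g) \<ge> 2"
    using \<phi> by (auto simp: ratfun_over_def rat_degree_def fg)
  have nc1: "f - smult b g \<noteq> 0" and nc2: "g - smult b f \<noteq> 0" for b
    using nonproportional[of f g b] nonproportional[of g f b] cop deg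
    by (simp_all add: coprime_commute max.commute)
  show thesis
  proof (cases x)
    case (Fin a)
    have a: "a \<in> K" using x Fin by simp
    have nz: "poly f a \<noteq> 0 \<or> poly g a \<noteq> 0"
    proof (rule ccontr)
      assume "\<not> ?thesis"
      hence "[:- a, 1:] dvd f" "[:- a, 1:] dvd g" by (auto simp: poly_eq_0_iff_dvd)
      hence "is_unit [:- a, 1:]" using cop by (metis coprime_common_divisor)
      thus False by (simp add: is_unit_iff_degree)
    qed
    show thesis
    proof (rule local_model_of_pair[OF chart_Fin[OF a] f g nz nc1 nc2, of "rat_map \<phi>"])
      fix j b \<mu> S q r L Q k \<psi>
      assume m: "sph_model (rat_map \<phi>) Fin a (1 / (max (nm a) 1)\<^sup>2) (max (nm a) 1) j b \<mu> S q r L Q k \<psi>"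
        "k = 0 \<longleftrightarrow> \<not> critical_fin (f, g) a"
      show thesis by (rule that[OF m(1)]) (use m(2) Fin fg in auto)
    qed (simp add: fg)
  next
    case Infty
    define F G where "F = fst (chart_infty (f, g))" and "G = snd (chart_infty (f, g))"
    define d where "d = max (degree f) (degree g)"
    have FG: "F = monom 1 (d - degree f) * reflect_poly f" "G = monom 1 (d - degree g) * reflect_poly g"
      by (simp_all add: F_def G_def chart_infty_def rat_degree_def d_def)
    have over: "poly_over K (monom 1 n * reflect_poly h)" if "poly_over K h" for n h
      using that by (auto simp: poly_over_def coeff_monom_mult coeff_reflect_poly)
    have F: "poly_over K F" and G: "poly_over K G" unfolding FG using over f g by blast+
    have nz: "poly F 0 \<noteq> 0 \<or> poly G 0 \<noteq> 0"
    proof (cases "degree g \<le> degree f")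
      case True
      hence "f \<noteq> 0" using deg by auto
      thus ?thesis using True by (simp add: FG d_def max_def poly_0_coeff_0)
    next
      case False
      thus ?thesis using g0 by (simp add: FG d_def max_def poly_0_coeff_0)
    qed
    have n1: "F - smult b G \<noteq> 0" for b
      unfolding F_def G_def by (rule chart_infty_nonproportional[OF nc1])
    have n2: "G - smult b F \<noteq> 0" for b
    proof -
      have "fst (chart_infty (g, f)) - smult b (snd (chart_infty (g, f))) \<noteq> 0"
        by (rule chart_infty_nonproportional[OF nc2])
      thus ?thesis by (simp add: F_def G_def chart_infty_def rat_degree_def max.commute)
    qed
    have T: "rat_map \<phi> (inv_pt z) = rat_eval_fin (F, G) z" for z
    proof (cases "z = 0")
      case False
      thus ?thesis using chart_infty_eval[OF False, of \<phi>] by (simp add: inv_pt_def F_def G_def fg)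
    qed (simp add: inv_pt_def F_def G_def fg)
    show thesis
    proof (rule local_model_of_pair[OF chart_inv F G nz n1 n2, of "rat_map \<phi>"])
      fix j b \<mu> S q r L Q k \<psi>
      assume m: "sph_model (rat_map \<phi>) inv_pt 0 1 1 j b \<mu> S q r L Q k \<psi>"
        "k = 0 \<longleftrightarrow> \<not> critical_fin (F, G) 0"
      show thesis by (rule that[OF m(1)]) (use m(2) Infty fg in \<open>auto simp: F_def G_def inv_pt_def\<close>)
    qed (rule T)
  qed
qed

lemma fatou_set_eq: "fatou_set nm \<phi> K = P.fatou (rat_map \<phi>)"
  by (simp add: fatou_set_def P.fatou_def proj_top_def)

text \<open>Equicontinuity on a neighbourhood in the larger line restricts to the trace of that
  neighbourhood on the smaller one.\<close>

lemma julia_set_subset: "julia_set nm \<phi> K \<subseteq> julia_set nm \<phi> UNIV"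
proof
  fix x assume x: "x \<in> julia_set nm \<phi> K"
  interpret U: Metric_space "proj_line UNIV" "sph_dist nm" by (rule Metric_space_sph_dist)
  have sub: "proj_line K \<subseteq> proj_line UNIV" by (auto simp: proj_line_def)
  have xK: "x \<in> proj_line K" using x by (simp add: julia_set_def)
  have "x \<notin> fatou_set nm \<phi> UNIV"
  proof
    assume "x \<in> fatou_set nm \<phi> UNIV"
    then obtain V where V: "openin U.mtopology V" "x \<in> V"
      "equicontinuous_family (sph_dist nm) V (\<lambda>n. rat_map \<phi> ^^ n)"
      by (auto simp: fatou_set_def proj_top_def)
    have "openin P.mtopology (V \<inter> proj_line K)"
      unfolding P.openin_mtopology
    proof (intro conjI allI impI)
      fix y assume y: "y \<in> V \<inter> proj_line K"
      then obtain r where r: "r > 0" "U.mball y r \<subseteq> V" using V(1) unfolding U.openin_mtopology by blast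
      moreover have "P.mball y r \<subseteq> U.mball y r" using sub by auto
      moreover have "P.mball y r \<subseteq> proj_line K" by auto
      ultimately show "\<exists>r>0. P.mball y r \<subseteq> V \<inter> proj_line K" by blast
    qed blast
    moreover have "equicontinuous_family (sph_dist nm) (V \<inter> proj_line K) (\<lambda>n. rat_map \<phi> ^^ n)"
      using V(3) unfolding equicontinuous_family_def by (metis IntD1)
    ultimately have "x \<in> fatou_set nm \<phi> K"
      using V(2) xK unfolding fatou_set_def proj_top_def by blast
    thus False using x by (simp add: julia_set_def)
  qed
  thus "x \<in> julia_set nm \<phi> UNIV" using xK sub by (auto simp: julia_set_def)
qed

lemma branched_system_rat_map:
  assumes \<phi>: "ratfun_over K \<phi>" "rat_degree \<phi> \<ge> 2" and hyp: "sub_hyperbolic nm \<phi>"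
  shows "branched_system (proj_line K) (sph_dist nm) (rat_map \<phi>) {x. critical_point \<phi> x}"
proof
  show "compact_space P.mtopology" by (rule compact_proj_line)
  fix x assume x: "x \<in> proj_line K"
  obtain i a \<kappa> R j b \<mu> S q r L Q k \<psi> where
    m: "sph_model (rat_map \<phi>) i a \<kappa> R j b \<mu> S q r L Q k \<psi>"
    and ax: "i a = x" and k: "k = 0 \<longleftrightarrow> \<not> critical_point \<phi> x"
    by (rule local_model_rat_map[OF \<phi> x])
  interpret local_model nm K "proj_line K" "sph_dist nm" "rat_map \<phi>" i a \<kappa> R j b \<mu> S q r L Q k \<psi>
    by (rule m)
  show "\<exists>y\<in>proj_line K. y \<noteq> x \<and> sph_dist nm x y < e" if e: "e > 0" for e
  proof -
    obtain u where u: "u \<in> K" "u \<noteq> 0" "nm u < min R (e / \<kappa>)"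
      using discretely_small[of "min R (e / \<kappa>)"] pos e by auto
    have aR: "a \<in> kball a R" using pos by (intro kball_self)
    have uR: "a + u \<in> kball a R" using u pos by (simp add: kball_def K_add)
    have d: "sph_dist nm x (i (a + u)) = \<kappa> * nm u"
      using chart_dist[OF chart1 aR uR] ax by simp
    have "\<kappa> * nm u < \<kappa> * (e / \<kappa>)" using u(3) pos by (intro mult_strict_left_mono) auto
    hence "sph_dist nm x (i (a + u)) < e" using d pos by simp
    moreover have "i (a + u) \<noteq> x"
    proof
      assume "i (a + u) = x"
      hence "\<kappa> * nm u = 0" using d P.mdist_zero[OF x] x by simp
      thus False using pos nm_pos[OF u(2)] by simp
    qed
    moreover have "i (a + u) \<in> proj_line K" using chart_ball(1)[OF chart1 uR, of R] pos by simp
    ultimately show ?thesis by blast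
  qed
  have "a \<in> kball a r" using pos r by (intro kball_self)
  hence "rat_map \<phi> x = j (\<psi> a)" "\<psi> a \<in> kball b S" using T_\<psi> \<psi>_in ax by auto
  thus "rat_map \<phi> x \<in> proj_line K" using chart_ball(1)[OF chart2, of "\<psi> a" S] pos by simp
  show "\<exists>r l. P.scales (rat_map \<phi>) x r l" if "x \<notin> {x. critical_point \<phi> x}"
    using scales_noncritical k ax that by simp
  show "\<exists>r>0. \<exists>e>0. \<exists>th>0. e \<le> 1 \<and> th \<le> 1 \<and> (\<forall>y\<in>P.mball x r. y \<noteq> x \<longrightarrow>
      (\<exists>l. P.scales (rat_map \<phi>) y (e * sph_dist nm x y) l \<and>
        l * sph_dist nm x y = th * sph_dist nm (rat_map \<phi> x) (rat_map \<phi> y)))"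
    using scales_near_critical unfolding ax .
  show "\<exists>s>0. \<forall>y\<in>P.mball x s. \<forall>z\<in>P.mball x s.
      sph_dist nm (rat_map \<phi> y) (rat_map \<phi> z) \<le> \<eta> * sph_dist nm y z"
    if "x \<in> {x. critical_point \<phi> x}" "\<eta> > 0" for \<eta>
  proof -
    have "k \<ge> 1" using k that(1) by (cases k) auto
    thus ?thesis using contracts_near_critical[OF _ that(2)] unfolding ax by blast
  qed
next
  show "eventually_periodic (rat_map \<phi>) x"
    if "x \<in> {x. critical_point \<phi> x}" "x \<in> proj_line K - P.fatou (rat_map \<phi>)" for x
  proof -
    have "x \<in> julia_set nm \<phi> K" using that(2) by (simp add: julia_set_def fatou_set_eq)
    hence "x \<in> julia_set nm \<phi> UNIV" using julia_set_subset by blast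
    thus ?thesis using hyp that(1) by (simp add: sub_hyperbolic_def)
  qed
qed

end

theorem theorem1p4:
  fixes p :: nat and nm :: "'c::field_char_0 \<Rightarrow> real" and Qp Qpbar K :: "'c set"
    and \<phi> :: "'c ratfun"
  assumes "prime p"
    and "padic_complex_numbers nm p Qp Qpbar"
    and "finite_extension_of Qp K"
    and "ratfun_over K \<phi>"
    and "rat_degree \<phi> \<ge> 2"
    and "sub_hyperbolic nm \<phi>"
  shows "\<exists>(S :: nat set) (A :: nat \<Rightarrow> nat \<Rightarrow> nat) (h :: 'c proj_pt \<Rightarrow> nat \<Rightarrow> nat).
           zero_one_matrix S A \<and>
           bij_betw h (julia_set nm \<phi> K) (markov_space S A) \<and>
           conjugate_via (proj_top nm K) (I_set nm \<phi> K) (rat_map \<phi>)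
             (markov_top S A) left_shift h"
proof -
  interpret padic_complex_numbers nm p Qp Qpbar by fact
  interpret local_field nm K by (rule finite_extension_local_field) fact+
  interpret branched_system "proj_line K" "sph_dist nm" "rat_map \<phi>" "{x. critical_point \<phi> x}"
    by (rule branched_system_rat_map) fact+
  have J_eq: "J = julia_set nm \<phi> K" by (simp add: J_def julia_set_def fatou_set_eq)
  have "I_set nm \<phi> K \<subseteq> J - E"
  proof
    fix x assume x: "x \<in> I_set nm \<phi> K"
    have "x \<notin> E"
    proof
      assume "x \<in> E"
      then obtain c m n where c: "critical_point \<phi> c" "c \<in> J" "(rat_map \<phi> ^^ n) x = (rat_map \<phi> ^^ m) c"
        by (auto simp: E_def Z_def)
      \<comment> \<open>An orbit meeting \<open>Z\<close> meets the forward orbit of such a critical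
        point \<open>c\<close>, which puts \<open>x\<close> into the grand orbit of
        \<open>c\<close>.\<close>
      have "c \<in> Crit_star nm \<phi> K"
        using c(1,2) julia_set_subset[of \<phi>] J_sub unfolding Crit_star_def J_eq by blast
      moreover have "x \<in> grand_orbit \<phi> K c"
        using x c(3) by (auto simp: grand_orbit_def I_set_def julia_set_def)
      ultimately show False using x by (auto simp: I_set_def)
    qed
    thus "x \<in> J - E" using x by (simp add: I_set_def J_eq)
  qed
  thus ?thesis using markov_coding by (simp add: J_eq proj_top_def)
qed

end
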